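(* Let $L>0$ and $\tau,\xi>-1$. Consider a random quadratic problem whose expected spectral distribution is $\nu=\nu_{\tau,\xi}$, a distribution on $(0,L]$ with edge exponents $(\tau,\xi)$ as described in the context. Let $x_t$ be the iterates of Nesterov's method $$x_{t+1}=y_t-\tfrac1L\nabla f(y_t),\qquad y_{t+1}=x_{t+1}+\tfrac{t}{t+3}(x_{t+1}-x_t),\qquad y_0=x_0.$$ Then the average-case rates are, as $t\to\infty$, $$\mathbb{E}[f(x_t)-f(x^\star)]\sim C'_{1,\nu}\cdot\begin{cases}t^{-2(\xi+2)} & \text{if } \xi<-\tfrac12,\\ t^{-3}\log t & \text{if } \xi=-\tfrac12,\\ t^{-(\xi+7/2)} & \text{if } \xi>-\tfrac12,\end{cases}\qquad \mathbb{E}[\|\nabla f(x_t)\|_2^2]\sim C'_{2,\nu}\,t^{-(\xi+9/2)},$$ where $C'_{1,\nu}$ and $C'_{2,\nu}$ are constants depending on the distribution $\nu$.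
   Context: Random quadratic problem: $H\in\mathbb{R}^{d\times d}$ is a random symmetric positive-definite matrix, $x^\star,x_0\in\mathbb{R}^d$ are random vectors with $x_0-x^\star$ independent of $H$ and $\mathbb{E}[(x_0-x^\star)(x_0-x^\star)^\top]=I$, and $f(x)=\tfrac12(x-x^\star)^\top H(x-x^\star)$. Expectations are over $H,x_0,x^\star$. Expected spectral distribution (ESD): if $\lambda_1,\dots,\lambda_d$ are the eigenvalues of $H$, set $\mu_H=\frac1d\sum_{i=1}^d\delta_{\lambda_i}$; the ESD is the probability measure $\mathbb{E}_H[\mu_H]$. Edge assumption on $\nu_{\tau,\xi}$: $\nu_{\tau,\xi}$ is a probability distribution supported in $(0,L]$ with density $\nu_{\tau,\xi}'$ with respect to Lebesgue measure, $\nu_{\tau,\xi}'(\lambda)>0$ for $\lambda\in(0,L)$, $\nu_{\tau,\xi}'(\lambda)=\Theta(\lambda^\xi)$ as $\lambda\to0^+$ and $\nu_{\tau,\xi}'(\lambda)=\Theta((L-\lambda)^\tau)$ as $\lambda\to L^-$. The symbol $\sim$ denotes asymptotic equivalence as $t\to\infty$ (the ratio of the two sides tends to $1$).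
   Formalization: The condition ν'(λ)=Θ(λ^ξ) at 0 is strengthened: ν'(λ)/λ^ξ must converge (to a positive limit) as λ→0+; with two-sided bounds alone the claim fails, e.g. for densities proportional to λ^ξ(2+sin log λ)(L−λ)^τ. *)

theory Defs
  imports
    "HOL-Probability.Probability"
    "HOL-Computational_Algebra.Polynomial"
    "HOL-Library.Landau_Symbols"
begin

definition quadratic_objective ::
    "real ^ 'n ^ 'n \<Rightarrow> real ^ 'n \<Rightarrow> real ^ 'n \<Rightarrow> real" where
  "quadratic_objective H xs x = (1 / 2) * ((x - xs) \<bullet> (H *v (x - xs)))"

definition gradient :: "('a::real_inner \<Rightarrow> real) \<Rightarrow> 'a \<Rightarrow> 'a" where
  "gradient f x = (THE D. GDERIV f x :> D)"

fun nesterov_x :: "real \<Rightarrow> ('a::real_inner \<Rightarrow> real) \<Rightarrow> 'a \<Rightarrow> nat \<Rightarrow> 'a"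
  and nesterov_y :: "real \<Rightarrow> ('a::real_inner \<Rightarrow> real) \<Rightarrow> 'a \<Rightarrow> nat \<Rightarrow> 'a"
where
  "nesterov_x L f z 0 = z"
| "nesterov_x L f z (Suc t) =
     nesterov_y L f z t - (1 / L) *\<^sub>R gradient f (nesterov_y L f z t)"
| "nesterov_y L f z 0 = z"
| "nesterov_y L f z (Suc t) =
     nesterov_x L f z (Suc t)
       + (real t / (real t + 3)) *\<^sub>R (nesterov_x L f z (Suc t) - nesterov_x L f z t)"

definition symmetric_pos_def :: "real ^ 'n ^ 'n \<Rightarrow> bool" where
  "symmetric_pos_def A \<longleftrightarrow> transpose A = A \<and> (\<forall>v. v \<noteq> 0 \<longrightarrow> v \<bullet> (A *v v) > 0)"

(* Independence is stated for the generated sigma-algebras because indep_var needs both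
   variables to have the same type. The dimension d is CARD('n). A Bochner integral of a non-integrable function is 0,
   which differs from the identity matrix, so the last clause includes the
   integrability of the second moments of x0 - xs. *)
definition random_quadratic_problem ::
    "'w measure \<Rightarrow> ('w \<Rightarrow> real ^ 'n ^ 'n) \<Rightarrow> ('w \<Rightarrow> real ^ 'n) \<Rightarrow> ('w \<Rightarrow> real ^ 'n) \<Rightarrow> bool" where
  "random_quadratic_problem M H x0 xs \<longleftrightarrow>
     prob_space M \<and>
     H \<in> borel_measurable M \<and> x0 \<in> borel_measurable M \<and> xs \<in> borel_measurable M \<and>
     (AE \<omega> in M. symmetric_pos_def (H \<omega>)) \<and>
     prob_space.indep_set M
       {(\<lambda>\<omega>. x0 \<omega> - xs \<omega>) -` A \<inter> space M | A. A \<in> sets borel}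
       {H -` B \<inter> space M | B. B \<in> sets borel} \<and>
     (\<integral>\<omega>. (\<chi> i j. (x0 \<omega> - xs \<omega>) $ i * (x0 \<omega> - xs \<omega>) $ j) \<partial>M) = (mat 1 :: real ^ 'n ^ 'n)"

definition characteristic_poly :: "real ^ 'n ^ 'n \<Rightarrow> real poly" where
  "characteristic_poly A = det (mat [:0, 1:] - (\<chi> i j. [:A $ i $ j:]))"

(* Eigenvalues counted with algebraic multiplicity; a real symmetric matrix has
   exactly CARD('n) of them, all real. *)
definition eigenvalues_mset :: "real ^ 'n ^ 'n \<Rightarrow> real multiset" where
  "eigenvalues_mset A = proots (characteristic_poly A)"

definition empirical_spectral_measure :: "real ^ 'n ^ 'n \<Rightarrow> real measure" where
  "empirical_spectral_measure A =
     measure_of UNIV (sets borel)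
       (\<lambda>S. (\<Sum>l\<in>#eigenvalues_mset A. emeasure (return borel l) S) / of_nat CARD('n))"

definition expected_spectral_distribution ::
    "'w measure \<Rightarrow> ('w \<Rightarrow> real ^ 'n ^ 'n) \<Rightarrow> real measure" where
  "expected_spectral_distribution M H =
     measure_of UNIV (sets borel)
       (\<lambda>S. \<integral>\<^sup>+ \<omega>. emeasure (empirical_spectral_measure (H \<omega>)) S \<partial>M)"

(* At 0 the statement p = Theta(l powr xi) is taken in its sharp form: the ratio
   p l / l powr xi converges, to a limit that the Theta clause makes positive. Two-sided
   bounds alone do not give rates of the form (constant) * (power of t): a log-periodic
   density such as l powr xi * (2 + sin (ln l)) near 0 makes the rescaled averages
   oscillate. At L the two-sided bounds are enough. *)
definition edge_distribution :: "real \<Rightarrow> real \<Rightarrow> real \<Rightarrow> real measure \<Rightarrow> bool" where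
  "edge_distribution L \<tau> \<xi> \<nu> \<longleftrightarrow>
     prob_space \<nu> \<and> emeasure \<nu> (- {0<..L}) = 0 \<and>
     (\<exists>p. p \<in> borel_measurable borel \<and> (\<forall>l. 0 \<le> p l) \<and>
          \<nu> = density lborel (\<lambda>l. ennreal (p l)) \<and>
          (\<forall>l\<in>{0<..<L}. 0 < p l) \<and>
          p \<in> \<Theta>[at_right 0](\<lambda>l. l powr \<xi>) \<and>
          (\<exists>c. ((\<lambda>l. p l / l powr \<xi>) \<longlongrightarrow> c) (at_right 0)) \<and>
          p \<in> \<Theta>[at_left L](\<lambda>l. (L - l) powr \<tau>))"

end

(*
  With x = lambda / L, the residual polynomials of Nesterov's method are an elementary factor times
  derivatives of Legendre polynomials: for t > 0, x = sin^2 theta,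
     pi_t(x) = 2 cos^(t+1)(theta) P_t'(cos theta) / (t (t + 1)).
  Integrating w^(t-1) sqrt(w^2 - 2 w cos theta + 1) along the ray from 0 to e^(i theta) gives a
  solution of the three-term recurrence whose imaginary part is a multiple of pi_t; expanding the
  square root at the end point gives, uniformly for t sqrt x >= 1,
     pi_t(x)^2 = c_t x^(-3/2) (1 - x)^(t+1) (1 - sin((2 t + 1) theta)) + O(t^-4 x^-2 (1 - x)^(t+1)),
  with c_t of order t^-3, while pi_t(u / t^2) converges for every fixed u > 0. The moments
  of pi_t^2 against x^rho are then dominated by x of order t^-2 if rho < 1/2 (dominated convergence),
  by x of order t^-1 if rho > 1/2 (Beta integrals; the oscillating term is negligible), and by
  everything in between if rho = 1/2, which produces the logarithm. Any density equivalent to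
  c x^rho at 0 has the same behaviour, because the contribution of the rest of the spectrum decays exponentially.
  Diagonalizing H, the independence of H and x_0 - x* turns both expectations into such moments
  of the expected spectral distribution, with rho = xi + 1 and rho = xi + 2.
*)

theory Submission
  imports Defs "HOL-Real_Asymp.Real_Asymp"
begin

text \<open>Why the imaginary part, and why a ray: complex conjugation swaps the two branch points,
  so the imaginary part is 1/(2 i) times the integral of w^n sqrt(w^2 - 2 w cos theta + 1) from
  e^(-i theta) to e^(i theta). This is the Stieltjes form of the Mehler-Dirichlet integral for
  Gegenbauer polynomials of parameter 3/2, that is, for derivatives of Legendre polynomials. Leading
  the path through 0 concentrates the weight |w|^n at the end point, so that a one-term expansion
  there has an explicit error: a Beta value divided by sqrt(2 sin theta). The difficulty is
  uniformity in theta. An expansion valid on compact parts of (0, 1) says nothing about the scales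
  between t^-2 and t^-1, and for rho = 1/2 all of these scales have equal logarithmic weight. The
  explicit error stays useful down to theta of order 1/t, where the elementary estimate for t^2 x <=
  1 takes over.\<close>

section \<open>Integral representation of the residual polynomials\<close>

text \<open>
  A square root of \<open>w\<^sup>2 - 2 w cos \<theta> + 1\<close> for \<open>w = z cis \<theta>\<close>, factored so that both radicands
  stay in the right half plane, away from the branch cut, for real \<open>z\<close> in \<open>[0, 1)\<close>.
\<close>
definition legendre_root :: "real \<Rightarrow> complex \<Rightarrow> complex" where
  "legendre_root \<theta> z = csqrt (1 - z) * csqrt (1 - z * cis (2 * \<theta>))"

definition legendre_int :: "real \<Rightarrow> nat \<Rightarrow> complex" where
  "legendre_int \<theta> n =
     integral {0..1} (\<lambda>r. cis \<theta> * (of_real r * cis \<theta>) ^ n * legendre_root \<theta> (of_real r))"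

text \<open>For theta in (0, pi/2) the point e^(2 i theta) differs from 1, so this radicand stays in
  the open right half plane even at r = 1. The second factor of \<open>legendre_root\<close> thus
  avoids the branch cut on the whole closed segment.\<close>

lemma one_minus_cis_Re_pos:
  assumes "0 < \<theta>" "\<theta> < pi/2" "0 \<le> r" "r \<le> 1"
  shows "Re (1 - of_real r * cis (2 * \<theta>)) > 0"
proof -
  have "cos (2*\<theta>) < cos 0" using assms by (intro cos_monotone_0_pi) auto
  moreover have "r * cos (2*\<theta>) \<le> max 0 (cos (2*\<theta>))"
    using assms mult_left_le_one_le[of "cos (2*\<theta>)" r] mult_nonneg_nonpos[of r "cos (2*\<theta>)"]
    by (cases "cos (2*\<theta>) \<ge> 0") auto
  ultimately show ?thesis by auto
qed

text \<open>With w = z cis theta the two radicands are 1 - w e^(-i theta) and 1 - w e^(i theta).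
  Their product is w^2 - 2 w cos theta + 1, and completing the square prepares the antiderivative
  for n = 0.\<close>

lemma legendre_root_square:
  "legendre_root \<theta> z ^ 2 = (z * cis \<theta> - of_real (cos \<theta>)) ^ 2 + of_real (sin \<theta>) ^ 2"
proof -
  have e: "cis (2*\<theta>) = cis \<theta> ^ 2" by (simp add: Complex.DeMoivre)
  have c: "cis \<theta> ^ 2 = 2 * of_real (cos \<theta>) * cis \<theta> - 1"
    by (simp add: complex_eq_iff power2_eq_square) (use sin_cos_squared_add3[of \<theta>] in argo)
  have s: "complex_of_real (sin \<theta>) ^ 2 = 1 - of_real (cos \<theta>) ^ 2"
    by (simp add: sin_squared_eq flip: of_real_power)
  have "legendre_root \<theta> z ^ 2 = (1 - z) * (1 - z * cis \<theta> ^ 2)"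
    by (simp add: legendre_root_def power_mult_distrib e)
  also have "\<dots> = (z * cis \<theta> - of_real (cos \<theta>)) ^ 2 + of_real (sin \<theta>) ^ 2"
    unfolding s using c by algebra
  finally show ?thesis .
qed

lemma frac_telescope:
  fixes e v R :: complex
  assumes "R \<noteq> 0" "v + R \<noteq> 0"
  shows "inverse (v + R) * (e + e * v / R) = e / R"
proof -
  have "e + e * v / R = (e / R) * (v + R)" using assms by (simp add: field_simps)
  thus ?thesis using assms by simp
qed

lemma frac_cube:
  fixes e d R N W k :: complex
  assumes "R \<noteq> 0"
  shows "(k * N * e) * R ^ 3 + (3 * R ^ 2 * (e * d / R)) * W = e * R * (k * N * R ^ 2 + 3 * W * d)"
proof -
  have "R ^ 2 * (e * d / R) = R * (e * d)" using assms by (simp add: power2_eq_square)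
  thus ?thesis by algebra
qed

lemma frac_sqrt_deriv:
  fixes A B u :: complex
  assumes "A \<noteq> 0" "B \<noteq> 0"
  shows "-1 / (2 * A) * B + (- u) / (2 * B) * A = - (B^2 + u * A^2) / (2 * (A * B))"
proof -
  have "- (B^2 + u * A^2) = (-1 / (2 * A) * B + (- u) / (2 * B) * A) * (2 * (A * B))"
    using assms by (simp add: algebra_simps power2_eq_square)
  thus ?thesis using assms by simp
qed

lemma frac_collect:
  fixes e v R s :: complex
  assumes "R \<noteq> 0"
  shows "(v * (e * v / R) + e * R + s^2 * (e / R)) / 2 = e * (R ^ 2 + (v ^ 2 + s ^ 2)) / (2 * R)"
proof -
  have "e * (R ^ 2 + (v ^ 2 + s ^ 2)) = (v * (e * v / R) + e * R + s^2 * (e / R)) * R"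
    using assms by (simp add: algebra_simps power2_eq_square)
  thus ?thesis using assms by simp
qed

text \<open>For c = cos theta, (w - c)^2 + (1 - c^2) is the square of the root, so the right side is
  e times the w-derivative of w^(m+1) R^3. The recurrence holds for the integrands up to this exact
  derivative.\<close>

lemma legendre_integrand_rec:
  fixes w e R c :: complex
  shows "of_nat (m+4) * (e * w^(m+2) * R) - of_nat (2*m+5) * c * (e * w^(m+1) * R) + of_nat (m+1) * (e * w^m * R)
    = e * R * (of_nat (m+1) * w^m * ((w - c)^2 + (1 - c^2)) + 3 * w^(m+1) * (w - c))"
  unfolding power_add of_nat_add of_nat_mult of_nat_numeral by (simp only: power_one_right of_nat_1) algebra

context
  fixes \<theta> :: real
  assumes \<theta>: "0 < \<theta>" "\<theta> < pi / 2"
begin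

lemma legendre_root_nonzero:
  assumes "0 \<le> r" "r < 1"
  shows "legendre_root \<theta> (of_real r) \<noteq> 0"
proof -
  have "1 - of_real r * cis (2 * \<theta>) \<noteq> 0"
    using one_minus_cis_Re_pos[OF \<theta>, of r] assms by (metis less_eq_real_def less_irrefl zero_complex.simps(1))
  moreover have "1 - complex_of_real r \<noteq> 0" using assms by (auto simp: complex_eq_iff)
  ultimately show ?thesis by (simp add: legendre_root_def)
qed

text \<open>From R^2 = (w - c)^2 + s^2 one gets R' = cis theta * (w - c) / R. At r = 1 the root
  vanishes, so the end point is left to continuity.\<close>

lemma legendre_root_deriv:
  assumes r: "0 \<le> r" "r < 1"
  shows "(legendre_root \<theta> has_field_derivative
          cis \<theta> * (of_real r * cis \<theta> - of_real (cos \<theta>)) / legendre_root \<theta> (of_real r)) (at (of_real r))"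
proof -
  define A where "A = csqrt (1 - of_real r)"
  define B where "B = csqrt (1 - of_real r * cis (2*\<theta>))"
  have nz: "A \<noteq> 0" "B \<noteq> 0"
    using legendre_root_nonzero[OF r] by (auto simp: A_def B_def legendre_root_def)
  have a: "1 - complex_of_real r \<notin> \<real>\<^sub>\<le>\<^sub>0"
    using r by (auto simp: complex_nonpos_Reals_iff)
  have b: "1 - complex_of_real r * cis (2*\<theta>) \<notin> \<real>\<^sub>\<le>\<^sub>0"
    using one_minus_cis_Re_pos[OF \<theta>, of r] r by (auto simp: complex_nonpos_Reals_iff)
  have e: "cis (2*\<theta>) = cis \<theta> ^ 2" by (simp add: Complex.DeMoivre)
  have c: "cis \<theta> ^ 2 = 2 * of_real (cos \<theta>) * cis \<theta> - 1"
    by (simp add: complex_eq_iff power2_eq_square) (use sin_cos_squared_add3[of \<theta>] in argo)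
  have A2: "A^2 = 1 - of_real r" and B2: "B^2 = 1 - of_real r * cis \<theta> ^ 2"
    by (simp_all add: A_def B_def e)
  have "(legendre_root \<theta> has_field_derivative
          (-1 / (2 * A) * B + (- cis (2*\<theta>)) / (2 * B) * A)) (at (of_real r))"
    unfolding legendre_root_def[abs_def] A_def B_def
    by (rule derivative_eq_intros refl a b | simp)+
  also have "-1 / (2 * A) * B + (- cis (2*\<theta>)) / (2 * B) * A = - (B^2 + cis \<theta> ^ 2 * A^2) / (2 * (A * B))"
    unfolding e by (rule frac_sqrt_deriv[OF nz])
  also have "B^2 + cis \<theta> ^ 2 * A^2 = -2 * cis \<theta> * (of_real r * cis \<theta> - of_real (cos \<theta>))"
    unfolding A2 B2 using c by algebra
  also have "- (-2 * cis \<theta> * (of_real r * cis \<theta> - of_real (cos \<theta>))) / (2 * (A * B)) =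
      cis \<theta> * (of_real r * cis \<theta> - of_real (cos \<theta>)) / (A * B)" by simp
  finally show ?thesis by (simp add: A_def B_def legendre_root_def[abs_def])
qed

lemma continuous_on_legendre_root:
  "continuous_on {0..1} (\<lambda>r. legendre_root \<theta> (of_real r))"
proof -
  have slit: "1 - of_real r * cis (2*\<theta>) \<notin> \<real>\<^sub>\<le>\<^sub>0" if "r \<in> {0..1}" for r
    using one_minus_cis_Re_pos[OF \<theta>, of r] that by (auto simp: complex_nonpos_Reals_iff)
  \<comment> \<open>At r = 1 the first radicand reaches 0, the tip of the branch cut. Along the
    segment this factor is the real square root, which is continuous there.\<close>
  have eq: "legendre_root \<theta> (of_real r) = of_real (sqrt (1 - r)) * csqrt (1 - of_real r * cis (2*\<theta>))"
    if "r \<in> {0..1}" for r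
  proof -
    have "csqrt (1 - of_real r) = csqrt (of_real (1 - r))" by simp
    also have "\<dots> = of_real (sqrt (1 - r))" using that by (subst of_real_sqrt) auto
    finally show ?thesis by (simp add: legendre_root_def)
  qed
  have "continuous_on {0..1} (\<lambda>r. csqrt (1 - of_real r * cis (2*\<theta>)))"
    by (intro continuous_at_imp_continuous_on ballI isCont_o2[OF _ continuous_at_csqrt] slit continuous_intros)
  hence "continuous_on {0..1} (\<lambda>r. of_real (sqrt (1 - r)) * csqrt (1 - of_real r * cis (2*\<theta>)))"
    by (intro continuous_intros)
  then show ?thesis by (subst continuous_on_cong[OF refl eq])
qed

lemma legendre_int_has_integral:
  "((\<lambda>r. cis \<theta> * (of_real r * cis \<theta>) ^ n * legendre_root \<theta> (of_real r))
     has_integral legendre_int \<theta> n) {0..1}"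
  unfolding legendre_int_def
  by (intro integrable_integral integrable_continuous_interval continuous_intros continuous_on_legendre_root)

lemma legendre_int_step:
  fixes n :: nat
  defines "w \<equiv> \<lambda>r. of_real r * cis \<theta>"
  shows "((\<lambda>r. cis \<theta> * legendre_root \<theta> (of_real r) *
      (of_nat n * w r ^ (n - 1) * ((w r - of_real (cos \<theta>))^2 + of_real (sin \<theta>) ^ 2) + 3 * w r ^ n * (w r - of_real (cos \<theta>))))
      has_integral (if n = 0 then -1 else 0)) {0..1}"
proof -
  let ?R = "\<lambda>r. legendre_root \<theta> (complex_of_real r)"
  \<comment> \<open>Differentiating \<open>w\<^sup>n R\<^sup>3\<close>, not \<open>w\<^sup>n R\<close>, reproduces the three-term recurrence.\<close>
  let ?F = "\<lambda>r. w r ^ n * ?R r ^ 3"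
  have "((\<lambda>r. cis \<theta> * ?R r *
      (of_nat n * w r ^ (n - 1) * ((w r - of_real (cos \<theta>))^2 + of_real (sin \<theta>) ^ 2) + 3 * w r ^ n * (w r - of_real (cos \<theta>))))
      has_integral (?F 1 - ?F 0)) {0..1}"
  proof (rule fundamental_theorem_of_calculus_interior)
    show "continuous_on {0..1} ?F"
      unfolding w_def by (intro continuous_intros continuous_on_legendre_root)
    fix r :: real assume r: "r \<in> {0<..<1}"
    have nz: "?R r \<noteq> 0" using legendre_root_nonzero[of r] r by auto
    let ?D = "(of_nat n * w r ^ (n - 1) * cis \<theta>) * ?R r ^ 3 +
       (3 * ?R r ^ 2 * (cis \<theta> * (w r - of_real (cos \<theta>)) / ?R r)) * w r ^ n"
    have "((\<lambda>z. (z * cis \<theta>) ^ n * legendre_root \<theta> z ^ 3) has_field_derivative ?D) (at (of_real r))"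
      unfolding w_def
      using r by (auto intro!: derivative_eq_intros legendre_root_deriv)
    from has_vector_derivative_real_field[OF this]
    have "(?F has_vector_derivative ?D) (at r)" by (simp add: w_def)
    also have "?D = cis \<theta> * ?R r *
      (of_nat n * w r ^ (n - 1) * ?R r ^ 2 + 3 * w r ^ n * (w r - of_real (cos \<theta>)))"
      by (rule frac_cube[OF nz])
    finally show "(?F has_vector_derivative cis \<theta> * ?R r *
      (of_nat n * w r ^ (n - 1) * ((w r - of_real (cos \<theta>))^2 + of_real (sin \<theta>) ^ 2) + 3 * w r ^ n * (w r - of_real (cos \<theta>)))) (at r)"
      unfolding legendre_root_square by (simp add: w_def)
  qed auto
  \<comment> \<open>R is 0 at r = 1 and 1 at r = 0, so a boundary value survives only for n = 0,
    where the power of w equals 1 at the origin.\<close>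
  moreover have "?F 1 - ?F 0 = (if n = 0 then -1 else 0)"
    by (auto simp: w_def legendre_root_def)
  ultimately show ?thesis by simp
qed

text \<open>The boundary term -1 is real and drops out of imaginary parts, so these satisfy a
  homogeneous relation from the first step on.\<close>

lemma legendre_int_1: "3 * legendre_int \<theta> 1 - 3 * of_real (cos \<theta>) * legendre_int \<theta> 0 = -1"
proof -
  have "((\<lambda>r. 3 * (cis \<theta> * (of_real r * cis \<theta>) ^ 1 * legendre_root \<theta> (of_real r))
     - 3 * of_real (cos \<theta>) * (cis \<theta> * (of_real r * cis \<theta>) ^ 0 * legendre_root \<theta> (of_real r)))
     has_integral (3 * legendre_int \<theta> 1 - 3 * of_real (cos \<theta>) * legendre_int \<theta> 0)) {0..1}"
    by (intro has_integral_diff has_integral_mult_right legendre_int_has_integral)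
  moreover have "((\<lambda>r. 3 * (cis \<theta> * (of_real r * cis \<theta>) ^ 1 * legendre_root \<theta> (of_real r))
     - 3 * of_real (cos \<theta>) * (cis \<theta> * (of_real r * cis \<theta>) ^ 0 * legendre_root \<theta> (of_real r)))
     has_integral -1) {0..1}"
    using legendre_int_step[of 0] by (simp add: algebra_simps)
  ultimately show ?thesis by (rule has_integral_unique)
qed

lemma legendre_int_rec:
  "of_nat (m+4) * legendre_int \<theta> (m+2) - of_nat (2*m+5) * of_real (cos \<theta>) * legendre_int \<theta> (m+1)
    + of_nat (m+1) * legendre_int \<theta> m = 0"
proof -
  let ?f = "\<lambda>n r. cis \<theta> * (of_real r * cis \<theta>) ^ n * legendre_root \<theta> (of_real r)"
  have s: "complex_of_real (sin \<theta>) ^ 2 = 1 - of_real (cos \<theta>) ^ 2"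
    by (simp add: sin_squared_eq flip: of_real_power)
  have "((\<lambda>r. of_nat (m+4) * ?f (m+2) r - of_nat (2*m+5) * of_real (cos \<theta>) * ?f (m+1) r + of_nat (m+1) * ?f m r)
     has_integral (of_nat (m+4) * legendre_int \<theta> (m+2) - of_nat (2*m+5) * of_real (cos \<theta>) * legendre_int \<theta> (m+1)
    + of_nat (m+1) * legendre_int \<theta> m)) {0..1}"
    by (intro has_integral_diff has_integral_add has_integral_mult_right legendre_int_has_integral)
  moreover have "(\<lambda>r. of_nat (m+4) * ?f (m+2) r - of_nat (2*m+5) * of_real (cos \<theta>) * ?f (m+1) r + of_nat (m+1) * ?f m r)
    = (\<lambda>r. cis \<theta> * legendre_root \<theta> (of_real r) *
      (of_nat (m+1) * (of_real r * cis \<theta>) ^ (m+1 - 1) * ((of_real r * cis \<theta> - of_real (cos \<theta>))^2 + of_real (sin \<theta>) ^ 2)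
        + 3 * (of_real r * cis \<theta>) ^ (m+1) * (of_real r * cis \<theta> - of_real (cos \<theta>))))"
    unfolding s legendre_integrand_rec by simp
  ultimately show ?thesis
    using legendre_int_step[of "m+1"] by (auto dest: has_integral_unique)
qed

lemma Im_legendre_int_0: "Im (legendre_int \<theta> 0) = pi / 4 * sin \<theta> ^ 2"
proof -
  let ?R = "\<lambda>r. legendre_root \<theta> (complex_of_real r)"
  define v where "v = (\<lambda>z. z * cis \<theta> - of_real (cos \<theta>))"
  have s0: "sin \<theta> > 0" "cos \<theta> > 0" "cos \<theta> < 1"
    using \<theta> cos_monotone_0_pi[of 0 \<theta>] by (auto intro!: sin_gt_zero cos_gt_zero)
  \<comment> \<open>(v + R)(R - v) = R^2 - v^2 = sin^2 theta. A nonpositive real value of v + R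
    would be nonzero, so R - v would be real and hence v too. As Im v = r sin theta, this forces r =
    0, where v + R = 1 - cos theta > 0.\<close>
  have slit: "v (of_real r) + ?R r \<notin> \<real>\<^sub>\<le>\<^sub>0" if "r \<in> {0..1}" for r
  proof
    assume "v (of_real r) + ?R r \<in> \<real>\<^sub>\<le>\<^sub>0"
    then obtain x where x: "v (of_real r) + ?R r = of_real x" "x \<le> 0"
      by (elim nonpos_Reals_cases) auto
    have sq: "?R r ^ 2 = v (of_real r) ^ 2 + of_real (sin \<theta>) ^ 2"
      by (simp add: legendre_root_square v_def)
    have prod: "of_real x * (?R r - v (of_real r)) = complex_of_real (sin \<theta> ^ 2)"
      using sq x(1) by (simp add: algebra_simps power2_eq_square flip: x(1))
    with s0 have x0: "x \<noteq> 0" by auto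
    have "?R r - v (of_real r) = of_real (sin \<theta> ^ 2 / x)"
      using prod x0 by (simp add: field_simps)
    hence "Im (?R r - v (of_real r)) = 0" by (metis Im_complex_of_real)
    moreover have "Im (?R r + v (of_real r)) = 0" using x(1) by (metis Im_complex_of_real add.commute)
    ultimately have "Im (v (of_real r)) = 0" by simp
    hence "r = 0" using s0 by (simp add: v_def)
    hence "x = 1 - cos \<theta>"
      using x(1) by (simp add: v_def legendre_root_def complex_eq_iff)
    thus False using x(2) s0 by simp
  qed
  \<comment> \<open>Antiderivative of \<open>sqrt (v\<^sup>2 + s\<^sup>2)\<close>; the logarithm at the end point contributes \<open>\<i> \<pi> / 2\<close>.\<close>
  let ?H = "\<lambda>r. (v (of_real r) * ?R r + of_real (sin \<theta>) ^ 2 * Ln (v (of_real r) + ?R r)) / 2"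
  have "((\<lambda>r. cis \<theta> * ?R r) has_integral (?H 1 - ?H 0)) {0..1}"
  proof (rule fundamental_theorem_of_calculus_interior)
    show "continuous_on {0..1} ?H"
      using slit unfolding v_def by (intro continuous_intros continuous_on_legendre_root) auto
    fix r :: real assume r: "r \<in> {0<..<1}"
    have nz: "?R r \<noteq> 0" using legendre_root_nonzero[of r] r by auto
    have nz2: "v (of_real r) + ?R r \<noteq> 0" using slit[of r] r by auto
    let ?D = "(v (of_real r) * (cis \<theta> * v (of_real r) / ?R r) + cis \<theta> * ?R r
       + of_real (sin \<theta>) ^ 2 * (inverse (v (of_real r) + ?R r) * (cis \<theta> + cis \<theta> * v (of_real r) / ?R r))) / 2"
    have dv: "(v has_field_derivative cis \<theta>) (at (of_real r))"
      unfolding v_def by (auto intro!: derivative_eq_intros)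
    have dR: "(legendre_root \<theta> has_field_derivative cis \<theta> * v (of_real r) / ?R r) (at (of_real r))"
      using legendre_root_deriv[of r] r unfolding v_def by auto
    have "(Ln has_field_derivative inverse (v (of_real r) + ?R r)) (at (v (of_real r) + ?R r))"
      using slit[of r] r by (intro has_field_derivative_Ln) auto
    hence dL: "((\<lambda>z. Ln (v z + legendre_root \<theta> z)) has_field_derivative
        inverse (v (of_real r) + ?R r) * (cis \<theta> + cis \<theta> * v (of_real r) / ?R r)) (at (of_real r))"
      by (rule DERIV_chain2[where f = Ln]) (intro DERIV_add dv dR)
    have "((\<lambda>z. (v z * legendre_root \<theta> z + of_real (sin \<theta>) ^ 2 * Ln (v z + legendre_root \<theta> z)) / 2)
       has_field_derivative ?D) (at (of_real r))"
      by (intro DERIV_cdivide DERIV_add DERIV_mult' DERIV_cmult dv dR dL)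
    from has_vector_derivative_real_field[OF this]
    have "(?H has_vector_derivative ?D) (at r)" by simp
    also have "inverse (v (of_real r) + ?R r) * (cis \<theta> + cis \<theta> * v (of_real r) / ?R r) = cis \<theta> / ?R r"
      by (rule frac_telescope[OF nz nz2])
    also have "(v (of_real r) * (cis \<theta> * v (of_real r) / ?R r) + cis \<theta> * ?R r + of_real (sin \<theta>) ^ 2 * (cis \<theta> / ?R r)) / 2
      = cis \<theta> * (?R r ^ 2 + (v (of_real r) ^ 2 + of_real (sin \<theta>) ^ 2)) / (2 * ?R r)"
      by (rule frac_collect[OF nz])
    also have "v (of_real r) ^ 2 + of_real (sin \<theta>) ^ 2 = ?R r ^ 2"
      by (simp add: legendre_root_square v_def)
    also have "cis \<theta> * (?R r ^ 2 + ?R r ^ 2) / (2 * ?R r) = cis \<theta> * ?R r"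
      using nz by (simp add: power2_eq_square)
    finally show "(?H has_vector_derivative cis \<theta> * ?R r) (at r)" .
  qed auto
  hence "legendre_int \<theta> 0 = ?H 1 - ?H 0"
    by (intro has_integral_unique[OF legendre_int_has_integral[of 0, simplified]])
  moreover have "?H 1 = of_real (sin \<theta>) ^ 2 * Ln (\<i> * of_real (sin \<theta>)) / 2"
    by (simp add: v_def legendre_root_def cis_conv_exp exp_Euler sin_of_real cos_of_real)
  moreover have "Ln (\<i> * of_real (sin \<theta>)) = of_real (ln (sin \<theta>)) + \<i> * of_real (pi/2)"
    using s0 by (subst mult.commute) (simp add: Ln_times_of_real Ln_of_real)
  moreover have "?H 0 = of_real ((- cos \<theta> + sin \<theta> ^ 2 * ln (1 - cos \<theta>)) / 2)"
  proof -
    have "v 0 + ?R 0 = of_real (1 - cos \<theta>)" by (simp add: v_def legendre_root_def)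
    hence "Ln (v (of_real 0) + ?R 0) = of_real (ln (1 - cos \<theta>))"
      using s0 by (metis Ln_of_real of_real_0 diff_gt_0_iff_gt)
    thus ?thesis by (simp add: v_def legendre_root_def)
  qed
  ultimately have "legendre_int \<theta> 0 = of_real (sin \<theta> ^ 2) * (of_real (ln (sin \<theta>)) + \<i> * of_real (pi/2)) / 2
      - of_real ((- cos \<theta> + sin \<theta> ^ 2 * ln (1 - cos \<theta>)) / 2)"
    by (simp only: of_real_power)
  thus ?thesis by simp
qed

end

section \<open>Residual polynomials as imaginary parts\<close>

fun nesterov_residual :: "real \<Rightarrow> nat \<Rightarrow> real" where
  "nesterov_residual x 0 = 1"
| "nesterov_residual x (Suc 0) = 1 - x"
| "nesterov_residual x (Suc (Suc t)) = (1 - x) * (nesterov_residual x (Suc t) +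
     real t / (real t + 3) * (nesterov_residual x (Suc t) - nesterov_residual x t))"

lemma nesterov_residual_clear_denominator:
  fixes a b c :: real
  shows "(real m + 4) * (c * (a + real (Suc m) / (real (Suc m) + 3) * (a - b))) = c * ((2 * real m + 5) * a - (real m + 1) * b)"
  by (simp add: divide_simps) (simp add: algebra_simps)

text \<open>With 1 - x = cos^2 theta, dividing the residual of index t + 1 by cos^(t+2) theta turns
  its recurrence into \<open>legendre_int_rec\<close>; the constant is fixed by
  \<open>Im_legendre_int_0\<close>. The index shift matches the momentum coefficient 0 at t = 0: the
  residual of index 2 depends on that of index 1 alone, as Im I_1 depends on Im I_0 alone.\<close>

lemma nesterov_residual_eq_Im:
  assumes "0 < \<theta>" "\<theta> < pi / 2" 
  shows "nesterov_residual (sin \<theta> ^ 2) (Suc t) = 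
    4 * cos \<theta> ^ (t + 2) / (pi * sin \<theta> ^ 2) * Im (legendre_int \<theta> t)"
proof (induction t rule: induct_nat_012)
  case 0
  have "sin \<theta> \<noteq> 0" using assms sin_gt_zero[of \<theta>] by auto
  moreover have "1 - sin \<theta> ^ 2 = cos \<theta> ^ 2" by (simp add: cos_squared_eq)
  ultimately show ?case by (simp add: Im_legendre_int_0[OF assms] power2_eq_square)
next
  case 1
  have "sin \<theta> \<noteq> 0" using assms sin_gt_zero[of \<theta>] by auto
  have "Im (3 * legendre_int \<theta> 1 - 3 * of_real (cos \<theta>) * legendre_int \<theta> 0) = Im (-1)"
    by (simp only: legendre_int_1[OF assms])
  hence I1: "Im (legendre_int \<theta> 1) = cos \<theta> * (pi / 4 * sin \<theta> ^ 2)"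
    by (simp add: Im_legendre_int_0[OF assms] algebra_simps)
  have c: "1 - sin \<theta> ^ 2 = cos \<theta> ^ 2" by (simp add: cos_squared_eq)
  have "nesterov_residual (sin \<theta> ^ 2) (Suc 1) = cos \<theta> ^ 2 * cos \<theta> ^ 2"
    by (simp add: c)
  also have "\<dots> = 4 * cos \<theta> ^ (1 + 2) / (pi * sin \<theta> ^ 2) * (cos \<theta> * (pi / 4 * sin \<theta> ^ 2))"
    using \<open>sin \<theta> \<noteq> 0\<close> by (simp add: power2_eq_square power3_eq_cube)
  finally show ?case using I1 by (simp only: One_nat_def)
next
  case (ge2 m)
  let ?I = "\<lambda>n. Im (legendre_int \<theta> n)"
  have c: "1 - sin \<theta> ^ 2 = cos \<theta> ^ 2" by (simp add: cos_squared_eq)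
  have "Im (of_nat (m+4) * legendre_int \<theta> (m+2) - of_nat (2*m+5) * of_real (cos \<theta>) * legendre_int \<theta> (m+1)
    + of_nat (m+1) * legendre_int \<theta> m) = 0"
    using arg_cong[OF legendre_int_rec[OF assms, of m], of Im] by (simp only: zero_complex.simps)
  hence I: "(real m + 4) * ?I (m+2) = (2 * real m + 5) * cos \<theta> * ?I (Suc m) - (real m + 1) * ?I m"
    by (simp add: algebra_simps)
  have p: "cos \<theta> ^ (Suc m + 2) = cos \<theta> ^ m * cos \<theta> ^ 3"  "cos \<theta> ^ (m + 2) = cos \<theta> ^ m * cos \<theta> ^ 2"
    "cos \<theta> ^ (m + 4) = cos \<theta> ^ m * cos \<theta> ^ 4"
    by (simp_all add: eval_nat_numeral)
  have "(real m + 4) * nesterov_residual (sin \<theta> ^ 2) (Suc (Suc (Suc m))) =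
    cos \<theta> ^ 2 * ((2 * real m + 5) * nesterov_residual (sin \<theta> ^ 2) (Suc (Suc m))
      - (real m + 1) * nesterov_residual (sin \<theta> ^ 2) (Suc m))"
    unfolding nesterov_residual.simps(3)[of _ "Suc m"] c[symmetric]
    by (rule nesterov_residual_clear_denominator)
  also have "\<dots> = 4 * cos \<theta> ^ (m + 4) / (pi * sin \<theta> ^ 2) *
      ((2 * real m + 5) * cos \<theta> * ?I (Suc m) - (real m + 1) * ?I m)"
    unfolding ge2.IH p divide_inverse by algebra
  also have "\<dots> = (real m + 4) * (4 * cos \<theta> ^ (m + 4) / (pi * sin \<theta> ^ 2) * ?I (m+2))"
    unfolding I[symmetric] by simp
  finally have "nesterov_residual (sin \<theta> ^ 2) (Suc (Suc (Suc m))) = 4 * cos \<theta> ^ (m + 4) / (pi * sin \<theta> ^ 2) * ?I (m+2)"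
    by (subst (asm) mult_cancel_left) auto
  thus ?case by (simp add: numeral_eq_Suc)
qed

section \<open>Bounds for the residual polynomials\<close>

text \<open>\<open>Gamma_series\<close> is Euler's product for Gamma, and the extra factor tends to
  1. Hence Beta n a is asymptotic to Gamma a * n^(-a).\<close>

lemma Beta_nat_eq_Gamma_series:
  fixes a :: real
  assumes "a > 0" "n > 0"
  shows "Beta (real n) a * real n powr a = Gamma_series a n * ((a + real n) / real n)"
proof -
  have nz: "pochhammer a n > 0" "a + real n > 0" using assms by (auto intro: pochhammer_pos)
  have g: "Gamma a \<noteq> 0" using Gamma_real_pos[OF assms(1)] by linarith
  have p: "pochhammer a n * Gamma a = Gamma (a + real n)"
    using pochhammer_Gamma[of a n] assms g by (auto simp: nonpos_Ints_def field_simps)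
  have f: "Gamma (real n) = fact n / real n"
    using assms Gamma_fact[of "n - 1", where ?'a = real] by (cases n) (auto simp: field_simps)
  have "Beta (real n) a = fact n / real n / pochhammer a n"
    using p[symmetric] nz g assms by (simp add: Beta_def f add.commute)
  moreover have "Gamma_series a n = real n powr a * fact n / (pochhammer a n * (a + real n))"
    using assms by (simp add: Gamma_series_def powr_def pochhammer_Suc)
  ultimately show ?thesis using nz by (simp add: mult.commute)
qed

lemma Beta_nat_asymp:
  fixes a :: real
  assumes "a > 0"
  shows "(\<lambda>n. Beta (real n) a * real n powr a) \<longlonglongrightarrow> Gamma a"
proof -
  have "(\<lambda>n. Gamma_series a n * ((a + real n) / real n)) \<longlonglongrightarrow> Gamma a * 1"
    by (intro tendsto_mult Gamma_series_LIMSEQ) real_asymp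
  hence "(\<lambda>n. Gamma_series a n * ((a + real n) / real n)) \<longlonglongrightarrow> Gamma a" by simp
  moreover have "eventually (\<lambda>n. Gamma_series a n * ((a + real n) / real n) = Beta (real n) a * real n powr a) sequentially"
    using eventually_gt_at_top[of 0] by eventually_elim (simp add: Beta_nat_eq_Gamma_series[OF assms])
  ultimately show ?thesis by (rule Lim_transform_eventually)
qed

lemma Beta_nat_shift_asymp:
  fixes a :: real
  assumes "a > 0"
  shows "(\<lambda>n. Beta (real (n + k)) a * real n powr a) \<longlonglongrightarrow> Gamma a"
proof -
  have "(\<lambda>n. Beta (real (n + k)) a * real (n + k) powr a * (real n / real (n + k)) powr a) \<longlonglongrightarrow> Gamma a * 1 powr a"
  proof (intro tendsto_mult tendsto_powr tendsto_const)
    show "(\<lambda>n. Beta (real (n + k)) a * real (n + k) powr a) \<longlonglongrightarrow> Gamma a"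
      using LIMSEQ_ignore_initial_segment[OF Beta_nat_asymp[OF assms], of k] .
    show "(\<lambda>n. real n / real (n + k)) \<longlonglongrightarrow> 1" by real_asymp
  qed auto
  hence "(\<lambda>n. Beta (real (n + k)) a * real (n + k) powr a * (real n / real (n + k)) powr a) \<longlonglongrightarrow> Gamma a"
    by simp
  moreover have "eventually (\<lambda>n. Beta (real (n + k)) a * real (n + k) powr a * (real n / real (n + k)) powr a
     = Beta (real (n + k)) a * real n powr a) sequentially"
    using eventually_gt_at_top[of 0] by eventually_elim (simp add: powr_divide mult.assoc)
  ultimately show ?thesis by (rule Lim_transform_eventually)
qed

text \<open>A convergent sequence is bounded, so the estimate holds for every n > 0 and not just
  eventually. The shift k serves the arguments t + 1 and t + 2 below.\<close>

lemma Beta_nat_bound: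
  fixes a :: real
  assumes "a > 0"
  obtains K where "K > 0" "\<And>n. n > 0 \<Longrightarrow> Beta (real (n + k)) a \<le> K * real n powr (-a)"
proof -
  have "Bseq (\<lambda>n. Beta (real (n + k)) a * real n powr a)"
    using Beta_nat_shift_asymp[OF assms] convergent_imp_Bseq convergentI by blast
  then obtain K where K: "K > 0" "\<And>n. norm (Beta (real (n + k)) a * real n powr a) \<le> K"
    by (auto simp: Bseq_def)
  show ?thesis
  proof (rule that[OF K(1)])
    fix n :: nat assume "n > 0"
    thus "Beta (real (n + k)) a \<le> K * real n powr (-a)"
      using K(2)[of n] by (simp add: powr_minus field_simps)
  qed
qed

text \<open>At each step the increment p(t+1) - p(t) is multiplied by a factor in [0, 1] and changed
  by -x p(t+1), where |p(t+1)| <= 2 as long as the hypothesis holds. Increments grow by at most 2 x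
  per step, and the odd numbers sum to t^2. Value and increment go through one induction because
  each bound uses the other.\<close>

lemma nesterov_residual_near_one:
  assumes "0 \<le> x" "x \<le> 1" "real t ^ 2 * x \<le> 1"
  shows "\<bar>nesterov_residual x t - 1\<bar> \<le> real t ^ 2 * x"
proof -
  have "real t ^ 2 * x \<le> 1 \<longrightarrow> \<bar>nesterov_residual x t - 1\<bar> \<le> real t ^ 2 * x \<and>
     \<bar>nesterov_residual x (Suc t) - nesterov_residual x t\<bar> \<le> (2 * real t + 1) * x"
  proof (induction t)
    case 0
    thus ?case using assms by simp
  next
    case (Suc t)
    show ?case
    proof
      assume le: "real (Suc t) ^ 2 * x \<le> 1"
      have sq: "real (Suc t) ^ 2 * x = real t ^ 2 * x + (2 * real t + 1) * x"
        by (simp add: algebra_simps power2_eq_square)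
      have "0 \<le> (2 * real t + 1) * x" using assms by simp
      with le sq have le': "real t ^ 2 * x \<le> 1" by linarith
      let ?p = "nesterov_residual x"
      from Suc.IH le' have IH: "\<bar>?p t - 1\<bar> \<le> real t ^ 2 * x" "\<bar>?p (Suc t) - ?p t\<bar> \<le> (2 * real t + 1) * x" by auto
      have p1: "\<bar>?p (Suc t) - 1\<bar> \<le> real (Suc t) ^ 2 * x" using IH sq by linarith
      with le have p2: "\<bar>?p (Suc t)\<bar> \<le> 2" by linarith
      have "?p (Suc (Suc t)) - ?p (Suc t) =
          ((1 - x) * (real t / (real t + 3))) * (?p (Suc t) - ?p t) - x * ?p (Suc t)"
        by (simp add: algebra_simps)
      also have "\<bar>\<dots>\<bar> \<le> \<bar>((1 - x) * (real t / (real t + 3))) * (?p (Suc t) - ?p t)\<bar> + \<bar>x * ?p (Suc t)\<bar>"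
        by (rule abs_triangle_ineq4)
      also have "\<bar>((1 - x) * (real t / (real t + 3))) * (?p (Suc t) - ?p t)\<bar> \<le> 1 * \<bar>?p (Suc t) - ?p t\<bar>"
      proof -
        have "(1 - x) * (real t / (real t + 3)) \<le> 1 * 1" using assms by (intro mult_mono) auto
        thus ?thesis unfolding abs_mult using assms by (intro mult_right_mono) auto
      qed
      also have "1 * \<bar>?p (Suc t) - ?p t\<bar> \<le> (2 * real t + 1) * x" using IH by simp
      also have "\<bar>x * ?p (Suc t)\<bar> \<le> x * 2" unfolding abs_mult using assms p2 by (intro mult_mono) auto
      finally have "\<bar>?p (Suc (Suc t)) - ?p (Suc t)\<bar> \<le> (2 * real (Suc t) + 1) * x"
        by (simp add: algebra_simps)
      with p1 show "\<bar>?p (Suc t) - 1\<bar> \<le> real (Suc t) ^ 2 * x \<and>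
         \<bar>?p (Suc (Suc t)) - ?p (Suc t)\<bar> \<le> (2 * real (Suc t) + 1) * x" by simp
    qed
  qed
  thus ?thesis using assms by blast
qed

section \<open>Expansion at the end point of the ray\<close>

lemma norm_csqrt: "norm (csqrt z) = sqrt (norm z)"
proof -
  have "norm (csqrt z) ^ 2 = norm (csqrt z ^ 2)" by (rule norm_power[symmetric])
  thus ?thesis by (metis norm_ge_zero power2_csqrt real_sqrt_unique)
qed

text \<open>Both roots lie in the sector |Im| <= Re, so their inner product is nonnegative and |sqrt
  a + sqrt b| >= |sqrt b|. The factorization a - b = (sqrt a - sqrt b)(sqrt a + sqrt b) then gives
  the bound.\<close>

lemma norm_csqrt_diff_le:
  assumes "Re a > 0" "Re b > 0"
  shows "norm (csqrt a - csqrt b) * sqrt (norm b) \<le> norm (a - b)"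
proof -
  have *: "\<bar>Im (csqrt z)\<bar> \<le> Re (csqrt z)" if "Re z > 0" for z
  proof -
    have "Re z = Re (csqrt z ^ 2)" by simp
    also have "\<dots> = Re (csqrt z) ^ 2 - Im (csqrt z) ^ 2" by (simp only: Re_power2)
    finally have "Im (csqrt z) ^ 2 \<le> Re (csqrt z) ^ 2" using that by linarith
    thus ?thesis using Re_csqrt[of z] abs_le_square_iff[of "Im (csqrt z)" "Re (csqrt z)"]
      by (simp del: csqrt.simps)
  qed
  have "\<bar>Im (csqrt a) * Im (csqrt b)\<bar> \<le> Re (csqrt a) * Re (csqrt b)"
    unfolding abs_mult by (intro mult_mono * assms Re_csqrt) auto
  hence ge: "Re (csqrt a) * Re (csqrt b) + Im (csqrt a) * Im (csqrt b) \<ge> 0" by linarith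
  have "norm (csqrt b) ^ 2 \<le> norm (csqrt a + csqrt b) ^ 2"
    unfolding cmod_power2 using ge
    by (simp add: power2_eq_square algebra_simps del: csqrt.simps)
  hence "norm (csqrt b) \<le> norm (csqrt a + csqrt b)" by (rule power2_le_imp_le) auto
  moreover have "norm (csqrt b) = sqrt (norm b)" by (rule norm_csqrt)
  ultimately have "norm (csqrt a - csqrt b) * sqrt (norm b) \<le> norm (csqrt a - csqrt b) * norm (csqrt a + csqrt b)"
    by (intro mult_left_mono) auto
  also have "\<dots> = norm (csqrt a ^ 2 - csqrt b ^ 2)"
    by (simp add: power2_eq_square algebra_simps flip: norm_mult del: power2_csqrt)
  finally show ?thesis by simp
qed

context
  fixes \<theta> :: real
  assumes \<theta>: "0 < \<theta>" "\<theta> < pi / 2"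
begin

text \<open>1 - e^(2 i theta) = 2 sin theta e^(i (theta - pi/2)). Halving the angle gives a root in
  the right half plane, hence the principal one.\<close>

lemma csqrt_one_minus_cis:
  "csqrt (1 - cis (2 * \<theta>)) = of_real (sqrt (2 * sin \<theta>)) * cis (\<theta> / 2 - pi / 4)"
proof (rule csqrt_unique)
  have s: "sin \<theta> > 0" using \<theta> by (intro sin_gt_zero) auto
  have "(complex_of_real (sqrt (2 * sin \<theta>)) * cis (\<theta> / 2 - pi / 4)) ^ 2 = of_real (2 * sin \<theta>) * cis (\<theta> - pi / 2)"
    using s by (simp add: power_mult_distrib Complex.DeMoivre algebra_simps flip: of_real_power)
  also have "\<dots> = 1 - cis (2 * \<theta>)"
    by (simp add: complex_eq_iff cos_diff sin_diff cos_double_sin sin_double power2_eq_square)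
  finally show "(complex_of_real (sqrt (2 * sin \<theta>)) * cis (\<theta> / 2 - pi / 4)) ^ 2 = 1 - cis (2 * \<theta>)" .
  have "cos (\<theta> / 2 - pi / 4) > 0" using \<theta> by (intro cos_gt_zero_pi) auto
  thus "0 < Re (complex_of_real (sqrt (2 * sin \<theta>)) * cis (\<theta> / 2 - pi / 4)) \<or>
    Re (complex_of_real (sqrt (2 * sin \<theta>)) * cis (\<theta> / 2 - pi / 4)) = 0 \<and>
    0 \<le> Im (complex_of_real (sqrt (2 * sin \<theta>)) * cis (\<theta> / 2 - pi / 4))"
    using s by simp
qed

lemma norm_one_minus_cis: "norm (1 - cis (2 * \<theta>)) = 2 * sin \<theta>"
proof -
  have s: "sin \<theta> > 0" using \<theta> by (intro sin_gt_zero) auto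
  have "sqrt (norm (1 - cis (2 * \<theta>))) = norm (csqrt (1 - cis (2 * \<theta>)))" by (rule norm_csqrt[symmetric])
  also have "\<dots> = sqrt (2 * sin \<theta>)"
    unfolding csqrt_one_minus_cis norm_mult norm_of_real norm_cis using s by simp
  finally show ?thesis by simp
qed

text \<open>The weight r^n sits at r = 1, so the second root is frozen at its value there; the first
  root stays (1 - r)^(1/2) and produces Beta(n + 1, 3/2). By \<open>norm_csqrt_diff_le\<close>
  freezing costs at most (1 - r) / sqrt(2 sin theta), which raises the second Beta parameter by
  1.\<close>

lemma legendre_int_approx:
  "norm (legendre_int \<theta> n - cis \<theta> ^ Suc n * csqrt (1 - cis (2 * \<theta>)) * of_real (Beta (real (Suc n)) (3/2)))
    \<le> Beta (real (Suc n)) (5/2) / sqrt (2 * sin \<theta>)"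
proof -
  let ?a = "csqrt (1 - cis (2 * \<theta>))"
  have s: "sin \<theta> > 0" using \<theta> by (intro sin_gt_zero) auto
  have beta: "((\<lambda>r. r ^ n * (1 - r) powr (b - 1)) has_integral Beta (real (Suc n)) b) {0<..<1}" if "b > 0" for b
  proof -
    have "((\<lambda>r. r powr (real (Suc n) - 1) * (1 - r) powr (b - 1)) has_integral Beta (real (Suc n)) b) {0<..<1}"
      using has_integral_Beta_real[of "real (Suc n)" b] that by (simp add: has_integral_Icc_iff_Ioo)
    \<comment> \<open>The open interval matters: \<open>0 powr 0\<close> is 0 but
      \<open>0 ^ 0\<close> is 1, so for n = 0 the two integrands differ at r = 0.\<close>
    thus ?thesis by (rule has_integral_eq[rotated]) (auto simp: powr_realpow)
  qed
  have J: "((\<lambda>r. cis \<theta> * (of_real r * cis \<theta>) ^ n * legendre_root \<theta> (of_real r)) has_integral legendre_int \<theta> n) {0<..<1}"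
    using legendre_int_has_integral[OF \<theta>, of n] by (simp add: has_integral_Icc_iff_Ioo)
  have M: "((\<lambda>r. cis \<theta> ^ Suc n * ?a * of_real (r ^ n * (1 - r) powr (3/2 - 1)))
     has_integral cis \<theta> ^ Suc n * ?a * of_real (Beta (real (Suc n)) (3/2))) {0<..<1}"
    by (intro has_integral_mult_right has_integral_of_real beta) auto
  have E: "((\<lambda>r. r ^ n * (1 - r) powr (5/2 - 1) * (1 / sqrt (2 * sin \<theta>)))
      has_integral Beta (real (Suc n)) (5/2) * (1 / sqrt (2 * sin \<theta>))) {0<..<1}"
    by (intro has_integral_mult_left beta) auto
  have "norm (integral {0<..<1} (\<lambda>r. cis \<theta> * (of_real r * cis \<theta>) ^ n * legendre_root \<theta> (of_real r) -
       cis \<theta> ^ Suc n * ?a * of_real (r ^ n * (1 - r) powr (3/2 - 1))))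
     \<le> integral {0<..<1} (\<lambda>r. r ^ n * (1 - r) powr (5/2 - 1) * (1 / sqrt (2 * sin \<theta>)))"
  proof (rule integral_norm_bound_integral)
    show "(\<lambda>r. cis \<theta> * (of_real r * cis \<theta>) ^ n * legendre_root \<theta> (of_real r) -
       cis \<theta> ^ Suc n * ?a * of_real (r ^ n * (1 - r) powr (3/2 - 1))) integrable_on {0<..<1}"
      using has_integral_diff[OF J M] by blast
    show "(\<lambda>r. r ^ n * (1 - r) powr (5/2 - 1) * (1 / sqrt (2 * sin \<theta>))) integrable_on {0<..<1}"
      using E by blast
    fix r :: real assume r: "r \<in> {0<..<1}"
    have sq: "csqrt (1 - of_real r) = of_real (sqrt (1 - r))"
    proof -
      have "csqrt (1 - of_real r) = csqrt (of_real (1 - r))" by simp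
      also have "\<dots> = of_real (sqrt (1 - r))" using r by (subst of_real_sqrt) auto
      finally show ?thesis .
    qed
    let ?b = "csqrt (1 - of_real r * cis (2 * \<theta>))"
    have "cis \<theta> * (of_real r * cis \<theta>) ^ n * legendre_root \<theta> (of_real r) -
       cis \<theta> ^ Suc n * ?a * of_real (r ^ n * (1 - r) powr (3/2 - 1)) =
       cis \<theta> ^ Suc n * of_real (r ^ n * sqrt (1 - r)) * (?b - ?a)"
      using r by (simp only: legendre_root_def sq) (simp add: powr_half_sqrt power_mult_distrib algebra_simps)
    hence "norm (cis \<theta> * (of_real r * cis \<theta>) ^ n * legendre_root \<theta> (of_real r) -
       cis \<theta> ^ Suc n * ?a * of_real (r ^ n * (1 - r) powr (3/2 - 1))) = r ^ n * sqrt (1 - r) * norm (?b - ?a)"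
      using r by (simp only: norm_mult norm_of_real norm_power norm_cis) simp
    also have "norm (?b - ?a) \<le> (1 - r) / sqrt (2 * sin \<theta>)"
    proof -
      have "norm (?b - ?a) * sqrt (norm (1 - cis (2 * \<theta>))) \<le> norm (1 - of_real r * cis (2 * \<theta>) - (1 - cis (2 * \<theta>)))"
        using one_minus_cis_Re_pos[OF \<theta>, of r] one_minus_cis_Re_pos[OF \<theta>, of 1] r
        by (intro norm_csqrt_diff_le) auto
      also have "1 - of_real r * cis (2 * \<theta>) - (1 - cis (2 * \<theta>)) = of_real (1 - r) * cis (2 * \<theta>)"
        by (simp add: algebra_simps)
      also have "norm \<dots> = 1 - r" using r by (simp only: norm_mult norm_of_real norm_cis) simp
      finally show ?thesis using s unfolding norm_one_minus_cis by (simp add: field_simps)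
    qed
    also have "r ^ n * sqrt (1 - r) * ((1 - r) / sqrt (2 * sin \<theta>)) = r ^ n * (1 - r) powr (5/2 - 1) * (1 / sqrt (2 * sin \<theta>))"
    proof -
      have "(1 - r) powr (5/2 - 1) = (1 - r) powr (1 + 1/2)" by simp
      also have "\<dots> = (1 - r) * sqrt (1 - r)" using r unfolding powr_add by (simp add: powr_half_sqrt)
      finally show ?thesis by simp
    qed
    finally show "norm (cis \<theta> * (of_real r * cis \<theta>) ^ n * legendre_root \<theta> (of_real r) -
       cis \<theta> ^ Suc n * ?a * of_real (r ^ n * (1 - r) powr (3/2 - 1))) \<le> r ^ n * (1 - r) powr (5/2 - 1) * (1 / sqrt (2 * sin \<theta>))"
      using r by (simp add: mult_left_mono)
  qed
  thus ?thesis unfolding integral_unique[OF has_integral_diff[OF J M]] integral_unique[OF E] by simp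
qed

text \<open>The phases add up to (n + 1) theta + theta/2 - pi/4.\<close>

lemma Im_legendre_int_approx:
  "\<bar>Im (legendre_int \<theta> n) - sqrt (2 * sin \<theta>) * Beta (real (Suc n)) (3/2) * sin ((real n + 3/2) * \<theta> - pi / 4)\<bar>
    \<le> Beta (real (Suc n)) (5/2) / sqrt (2 * sin \<theta>)"
proof -
  have eq: "cis \<theta> ^ Suc n * csqrt (1 - cis (2 * \<theta>)) * of_real (Beta (real (Suc n)) (3/2)) =
      of_real (sqrt (2 * sin \<theta>) * Beta (real (Suc n)) (3/2)) * cis ((real n + 3/2) * \<theta> - pi / 4)"
    unfolding csqrt_one_minus_cis Complex.DeMoivre
    by (simp add: cis_mult algebra_simps)
  have "\<bar>Im (legendre_int \<theta> n - cis \<theta> ^ Suc n * csqrt (1 - cis (2 * \<theta>)) * of_real (Beta (real (Suc n)) (3/2)))\<bar>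
    \<le> Beta (real (Suc n)) (5/2) / sqrt (2 * sin \<theta>)"
    by (rule order.trans[OF abs_Im_le_cmod legendre_int_approx])
  thus ?thesis unfolding eq by (simp only: minus_complex.simps) simp
qed

end

section \<open>Uniform approximation of the squared residual polynomials\<close>

lemma continuous_on_nesterov_residual [continuous_intros]:
  "continuous_on A f \<Longrightarrow> continuous_on A (\<lambda>x. nesterov_residual (f x) t)"
  by (induction t rule: induct_nat_012) (auto intro!: continuous_intros)

lemma borel_measurable_nesterov_residual [measurable]:
  "(\<lambda>x. nesterov_residual x t) \<in> borel_measurable borel"
  by (intro borel_measurable_continuous_onI continuous_intros)

definition nesterov_angle :: "real \<Rightarrow> real" where
  "nesterov_angle x = arcsin (sqrt x)"

lemma nesterov_angle:
  assumes "0 < x" "x < 1"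
  shows "0 < nesterov_angle x" "nesterov_angle x < pi / 2"
    "sin (nesterov_angle x) = sqrt x" "cos (nesterov_angle x) = sqrt (1 - x)"
proof -
  show "0 < nesterov_angle x" using assms arcsin_less_arcsin[of 0 "sqrt x"] by (simp add: nesterov_angle_def)
  show "nesterov_angle x < pi / 2" using assms arcsin_less_arcsin[of "sqrt x" 1] order.trans[of "-1" 0 "sqrt x"]
    by (simp add: nesterov_angle_def)
  show "sin (nesterov_angle x) = sqrt x" using assms by (simp add: nesterov_angle_def order.trans[of "-1" 0])
  show "cos (nesterov_angle x) = sqrt (1 - x)"
    using assms by (simp add: nesterov_angle_def cos_arcsin order.trans[of "-1" 0])
qed

text \<open>The square of the leading term in \<open>Im_legendre_int_approx\<close> for n = t - 1,
  with the prefactor of \<open>nesterov_residual_eq_Im\<close>. For phi = (t + 1/2) theta - pi/4 the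
  identity 2 sin^2 phi = 1 - cos (2 phi) = 1 - sin ((2 t + 1) theta) separates the mean value from
  the oscillation.\<close>

definition nesterov_main :: "real \<Rightarrow> nat \<Rightarrow> real" where
  "nesterov_main x t = 16 / pi ^ 2 * Beta (real t) (3/2) ^ 2 * x powr (-3/2) * (1 - x) ^ (t + 1) *
     (1 - sin ((2 * real t + 1) * nesterov_angle x))"

text \<open>Up to the common factor (1 - x)^((t+1)/2), let N be the exact residual and m its leading
  term; then |N^2 - m^2| <= |N - m| (|N - m| + 2 |m|). In the cross term the factors sqrt(2 sqrt x)
  cancel, which leaves the order t^-4 x^-2. The second bound follows because t sqrt x >= 1 turns
  t^-4 x^-2 into at most t^-3 x^(-3/2).\<close>

lemma nesterov_residual_sq_bounds:
  obtains C where "C > 0"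
    "\<And>x t. 0 < x \<Longrightarrow> x < 1 \<Longrightarrow> t > 0 \<Longrightarrow> real t ^ 2 * x \<ge> 1 \<Longrightarrow>
       \<bar>nesterov_residual x t ^ 2 - nesterov_main x t\<bar> \<le> C * real t powr (-4) * x powr (-2) * (1 - x) ^ (t + 1)"
    "\<And>x t. 0 < x \<Longrightarrow> x < 1 \<Longrightarrow> t > 0 \<Longrightarrow> real t ^ 2 * x \<ge> 1 \<Longrightarrow>
       nesterov_residual x t ^ 2 \<le> C * real t powr (-3) * x powr (-3/2) * (1 - x) ^ (t + 1)"
proof -
  obtain K1 where K1: "K1 > 0" "\<And>n. n > 0 \<Longrightarrow> Beta (real n) (3/2) \<le> K1 * real n powr (-(3/2))"
    using Beta_nat_bound[of "3/2" 0] by auto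
  obtain K2 where K2: "K2 > 0" "\<And>n. n > 0 \<Longrightarrow> Beta (real n) (5/2) \<le> K2 * real n powr (-(5/2))"
    using Beta_nat_bound[of "5/2" 0] by auto
  \<comment> \<open>16 / pi^2 comes from q^2 = 16 / (pi x)^2; K2^2 and 2 K1 K2 belong to the square
    of the error and to the cross term. C2 adds the main term, where 1 - sin is at most 2.\<close>
  define C1 where "C1 = 16 / pi ^ 2 * (K2 ^ 2 + 2 * K1 * K2)"
  define C2 where "C2 = C1 + 16 / pi ^ 2 * K1 ^ 2 * 2"
  have "0 < K2 ^ 2 + 2 * K1 * K2" using K1(1) K2(1) by (intro add_pos_pos mult_pos_pos) auto
  hence C: "0 < C1" "C1 \<le> C2" unfolding C2_def C1_def by (auto intro!: divide_pos_pos)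
  have main: "\<bar>nesterov_residual x t ^ 2 - nesterov_main x t\<bar> \<le> C1 * real t powr (-4) * x powr (-2) * (1 - x) ^ (t + 1)"
      "nesterov_main x t \<le> 16 / pi ^ 2 * K1 ^ 2 * 2 * real t powr (-3) * x powr (-3/2) * (1 - x) ^ (t + 1)"
    if x: "0 < x" "x < 1" and t: "t > 0" and tx: "real t ^ 2 * x \<ge> 1" for x t
  proof -
    let ?\<theta> = "nesterov_angle x"
    define B1 where "B1 = Beta (real t) (3/2)"
    define B2 where "B2 = Beta (real t) (5/2)"
    define q where "q = 4 / (pi * x)"
    define m where "m = q * (sqrt (2 * sqrt x) * B1 * sin ((real t + 1/2) * ?\<theta> - pi / 4))"
    define N where "N = q * Im (legendre_int ?\<theta> (t - 1))"
    have Bpos: "B1 \<ge> 0" "B2 \<ge> 0" unfolding B1_def B2_def Beta_def using t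
      by (auto intro!: divide_nonneg_nonneg mult_nonneg_nonneg less_imp_le[OF Gamma_real_pos])
    note A = nesterov_angle[OF x]
    obtain n where n: "t = Suc n" using t by (cases t) auto
    have res: "nesterov_residual x t = sqrt (1 - x) ^ (t + 1) * N"
      using nesterov_residual_eq_Im[OF A(1,2), of n] x by (simp add: A n N_def q_def)
    have rec: "(sqrt (1 - x) ^ (t + 1)) ^ 2 = (1 - x) ^ (t + 1)"
      unfolding power2_eq_square power_mult_distrib[symmetric] using x by (simp only: real_sqrt_mult_self)
    have sc: "2 * sin ((real t + 1/2) * ?\<theta> - pi / 4) ^ 2 = 1 - sin ((2 * real t + 1) * ?\<theta>)"
    proof -
      have "1 - 2 * sin ((real t + 1/2) * ?\<theta> - pi / 4) ^ 2 = cos (2 * ((real t + 1/2) * ?\<theta> - pi / 4))"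
        by (simp only: cos_double_sin)
      also have "2 * ((real t + 1/2) * ?\<theta> - pi / 4) = (2 * real t + 1) * ?\<theta> - pi / 2" by (simp add: algebra_simps)
      also have "cos \<dots> = sin ((2 * real t + 1) * ?\<theta>)" by (simp add: cos_diff)
      finally show ?thesis by linarith
    qed
    have xm2: "x powr (-2) = 1 / x ^ 2"
      using x by (subst powr_minus_divide) (simp add: powr_numeral)
    have xq: "q ^ 2 * sqrt x = 16 / pi ^ 2 * x powr (-3/2)"
    proof -
      have "x powr (-3/2) = x powr (-2 + 1/2)" by simp
      also have "\<dots> = sqrt x / x ^ 2" using x unfolding powr_add
        by (simp add: powr_half_sqrt xm2)
      finally show ?thesis by (simp add: q_def power_divide power_mult_distrib)
    qed
    have m2: "m ^ 2 = 16 / pi ^ 2 * B1 ^ 2 * x powr (-3/2) * (1 - sin ((2 * real t + 1) * ?\<theta>))"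
    proof -
      have "m ^ 2 = (q ^ 2 * sqrt x) * B1 ^ 2 * (2 * sin ((real t + 1/2) * ?\<theta> - pi / 4) ^ 2)"
        using x by (simp add: m_def power_mult_distrib)
      thus ?thesis unfolding xq sc by simp
    qed
    have mainm: "nesterov_main x t = (1 - x) ^ (t + 1) * m ^ 2"
      unfolding m2 nesterov_main_def B1_def by simp
    have q0: "q > 0" using x by (simp add: q_def)
    have d: "\<bar>N - m\<bar> \<le> q * (B2 / sqrt (2 * sqrt x))"
    proof -
      have "\<bar>Im (legendre_int ?\<theta> n) - sqrt (2 * sqrt x) * B1 * sin ((real t + 1/2) * ?\<theta> - pi / 4)\<bar> \<le> B2 / sqrt (2 * sqrt x)"
        using Im_legendre_int_approx[OF A(1,2), of n] unfolding A n B1_def B2_def by (simp add: add_ac)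
      hence "q * \<bar>Im (legendre_int ?\<theta> n) - sqrt (2 * sqrt x) * B1 * sin ((real t + 1/2) * ?\<theta> - pi / 4)\<bar> \<le> q * (B2 / sqrt (2 * sqrt x))"
        using q0 by (intro mult_left_mono) auto
      also have "q * \<bar>Im (legendre_int ?\<theta> n) - sqrt (2 * sqrt x) * B1 * sin ((real t + 1/2) * ?\<theta> - pi / 4)\<bar> = \<bar>N - m\<bar>"
        using q0 by (simp add: N_def m_def n abs_mult_pos' flip: right_diff_distrib)
      finally show ?thesis .
    qed
    have mb: "\<bar>m\<bar> \<le> q * (sqrt (2 * sqrt x) * B1)"
    proof -
      have "\<bar>m\<bar> = q * (sqrt (2 * sqrt x) * B1) * \<bar>sin ((real t + 1/2) * ?\<theta> - pi / 4)\<bar>"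
        using q0 Bpos x by (simp add: m_def abs_mult)
      also have "\<dots> \<le> q * (sqrt (2 * sqrt x) * B1) * 1"
        using q0 Bpos x by (intro mult_left_mono) auto
      finally show ?thesis by simp
    qed
    have tp: "real t > 0" using t by simp
    have sqt: "1 \<le> real t * sqrt x"
    proof -
      have "1 \<le> sqrt (real t ^ 2 * x)" using tx by simp
      thus ?thesis using tp by (simp add: real_sqrt_mult)
    qed
    have B1b: "B1 \<le> K1 * real t powr (-(3/2))" and B2b: "B2 \<le> K2 * real t powr (-(5/2))"
      using K1(2)[OF t] K2(2)[OF t] by (simp_all add: B1_def B2_def)
    have "\<bar>N ^ 2 - m ^ 2\<bar> = \<bar>N - m\<bar> * \<bar>(N - m) + 2 * m\<bar>"
      by (simp add: power2_eq_square algebra_simps flip: abs_mult)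
    also have "\<dots> \<le> \<bar>N - m\<bar> * (\<bar>N - m\<bar> + 2 * \<bar>m\<bar>)"
      by (intro mult_left_mono) linarith+
    also have "\<dots> \<le> q * (B2 / sqrt (2 * sqrt x)) * (q * (B2 / sqrt (2 * sqrt x)) + 2 * (q * (sqrt (2 * sqrt x) * B1)))"
      using d mb q0 Bpos x by (intro mult_mono add_mono) auto
    also have "\<dots> = q ^ 2 * (B2 ^ 2 / (2 * sqrt x) + 2 * B1 * B2)"
    proof -
      define s where "s = sqrt (2 * sqrt x)"
      have s: "s > 0" "s ^ 2 = 2 * sqrt x" using x by (auto simp: s_def)
      have "q * (B2 / s) * (q * (B2 / s) + 2 * (q * (s * B1))) = q ^ 2 * (B2 ^ 2 / s ^ 2 + 2 * B1 * B2)"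
        using s(1) by (simp add: field_simps power2_eq_square)
      thus ?thesis unfolding s(2) by (simp add: s_def)
    qed
    \<comment> \<open>B2^2 is of order t^-5, and 1 / (2 sqrt x) <= t in the range considered; B1 B2
      is of order t^(-3/2 - 5/2). Both summands are therefore O(t^-4).\<close>
    also have "\<dots> \<le> q ^ 2 * (K2 ^ 2 * real t powr (-4) + 2 * K1 * K2 * real t powr (-4))"
    proof (intro mult_left_mono add_mono)
      have "B2 ^ 2 / (2 * sqrt x) \<le> (K2 * real t powr (-(5/2))) ^ 2 / (2 * sqrt x)"
        using B2b Bpos x by (intro divide_right_mono power_mono) auto
      also have "\<dots> = K2 ^ 2 * real t powr (-5) / (2 * sqrt x)"
        using tp by (simp add: power_mult_distrib powr_power)
      also have "\<dots> \<le> K2 ^ 2 * real t powr (-5) * real t"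
      proof -
        have "1 / (2 * sqrt x) \<le> real t" using sqt x by (simp add: field_simps)
        hence "K2 ^ 2 * real t powr (-5) * (1 / (2 * sqrt x)) \<le> K2 ^ 2 * real t powr (-5) * real t"
          by (intro mult_left_mono) auto
        thus ?thesis by simp
      qed
      also have "real t powr (-5) * real t = real t powr (-5 + 1)" using tp unfolding powr_add by simp
      hence "K2 ^ 2 * real t powr (-5) * real t = K2 ^ 2 * real t powr (-4)" by simp
      finally show "B2 ^ 2 / (2 * sqrt x) \<le> K2 ^ 2 * real t powr (-4)" .
      have "B1 * B2 \<le> K1 * real t powr (-(3/2)) * (K2 * real t powr (-(5/2)))"
        using B1b B2b Bpos K1(1) by (intro mult_mono) auto
      also have "\<dots> = K1 * K2 * (real t powr (-(3/2)) * real t powr (-(5/2)))" by simp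
      also have "\<dots> = K1 * K2 * real t powr (-4)" by (simp flip: powr_add)
      finally show "2 * B1 * B2 \<le> 2 * K1 * K2 * real t powr (-4)" by simp
    qed auto
    also have "\<dots> = C1 * real t powr (-4) * x powr (-2)"
      unfolding xm2 by (simp add: q_def C1_def power_divide power_mult_distrib add_divide_distrib algebra_simps)
    finally have NM: "\<bar>N ^ 2 - m ^ 2\<bar> \<le> C1 * real t powr (-4) * x powr (-2)" .
    have "\<bar>nesterov_residual x t ^ 2 - nesterov_main x t\<bar> = (1 - x) ^ (t + 1) * \<bar>N ^ 2 - m ^ 2\<bar>"
      unfolding res mainm power_mult_distrib rec right_diff_distrib[symmetric] abs_mult using x by simp
    also have "\<dots> \<le> (1 - x) ^ (t + 1) * (C1 * real t powr (-4) * x powr (-2))"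
      using NM x by (intro mult_left_mono) auto
    finally show "\<bar>nesterov_residual x t ^ 2 - nesterov_main x t\<bar> \<le> C1 * real t powr (-4) * x powr (-2) * (1 - x) ^ (t + 1)"
      by (simp add: mult_ac)
    have "nesterov_main x t \<le> 16 / pi ^ 2 * (K1 * real t powr (-(3/2))) ^ 2 * x powr (-3/2) * (1 - x) ^ (t + 1) * 2"
      unfolding nesterov_main_def B1_def[symmetric] using B1b Bpos x sin_ge_minus_one[of "(2 * real t + 1) * nesterov_angle x"]
      by (intro mult_mono power_mono) auto
    also have "(K1 * real t powr (-(3/2))) ^ 2 = K1 ^ 2 * real t powr (-3)"
      using tp by (simp add: power_mult_distrib powr_power)
    finally show "nesterov_main x t \<le> 16 / pi ^ 2 * K1 ^ 2 * 2 * real t powr (-3) * x powr (-3/2) * (1 - x) ^ (t + 1)"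
      by (simp add: mult_ac)
  qed
  show ?thesis
  proof (rule that[of C2])
    show "C2 > 0" using C by simp
    fix x :: real and t :: nat assume x: "0 < x" "x < 1" and t: "t > 0" and tx: "real t ^ 2 * x \<ge> 1"
    have "C1 * real t powr (-4) * x powr (-2) * (1 - x) ^ (t + 1) \<le> C2 * real t powr (-4) * x powr (-2) * (1 - x) ^ (t + 1)"
      using C x by (intro mult_right_mono) auto
    with main(1)[OF x t tx] show "\<bar>nesterov_residual x t ^ 2 - nesterov_main x t\<bar> \<le> C2 * real t powr (-4) * x powr (-2) * (1 - x) ^ (t + 1)"
      by linarith
    have "real t powr (-4) * x powr (-2) \<le> real t powr (-3) * x powr (-3/2)"
    proof -
      have "1 \<le> sqrt (real t ^ 2 * x)" using tx by simp
      hence sqt: "1 \<le> real t * x powr (1/2)" using x t by (simp add: real_sqrt_mult powr_half_sqrt)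
      have "real t powr (-4) * x powr (-2) * 1 \<le> real t powr (-4) * x powr (-2) * (real t * x powr (1/2))"
        using sqt by (intro mult_left_mono) auto
      also have "\<dots> = (real t powr (-4) * real t powr 1) * (x powr (-2) * x powr (1/2))" using t by simp
      also have "\<dots> = real t powr (-3) * x powr (-3/2)" by (simp only: powr_add[symmetric]) simp
      finally show ?thesis by simp
    qed
    hence "C1 * (real t powr (-4) * x powr (-2)) * (1 - x) ^ (t + 1) \<le> C1 * (real t powr (-3) * x powr (-3/2)) * (1 - x) ^ (t + 1)"
      using C x by (intro mult_right_mono mult_left_mono) auto
    hence "nesterov_residual x t ^ 2 \<le> C1 * (real t powr (-3) * x powr (-3/2)) * (1 - x) ^ (t + 1)
       + 16 / pi ^ 2 * K1 ^ 2 * 2 * real t powr (-3) * x powr (-3/2) * (1 - x) ^ (t + 1)"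
      using main[OF x t tx] by (simp only: mult.assoc)
    thus "nesterov_residual x t ^ 2 \<le> C2 * real t powr (-3) * x powr (-3/2) * (1 - x) ^ (t + 1)"
      by (simp add: C2_def algebra_simps)
  qed
qed

section \<open>Moments against powers\<close>

lemma powr_power_has_integral_Beta:
  fixes b :: real
  assumes "b > -1"
  shows "((\<lambda>x. x powr b * (1 - x) ^ m) has_integral Beta (real (m + 1)) (b + 1)) {0..1}"
proof -
  have "((\<lambda>x. x powr b * (1 - x) powr (real (m + 1) - 1)) has_integral Beta (b + 1) (real (m + 1))) {0<..<1}"
    using has_integral_Beta_real[of "b + 1" "real (m + 1)"] assms by (simp add: has_integral_Icc_iff_Ioo)
  hence "((\<lambda>x. x powr b * (1 - x) ^ m) has_integral Beta (b + 1) (real (m + 1))) {0<..<1}"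
    by (rule has_integral_eq[rotated]) (auto simp: powr_realpow)
  thus ?thesis by (simp add: has_integral_Icc_iff_Ioo Beta_commute)
qed

lemma inverse_square_powr:
  fixes x c :: real
  assumes "x > 0"
  shows "(1 / x ^ 2) powr c = x powr (-2 * c)"
proof -
  have "1 / x ^ 2 = x powr (-2)" using assms by (subst powr_minus_divide) (simp add: powr_numeral)
  thus ?thesis by (simp add: powr_powr)
qed

text \<open>
  The cut-off at \<open>t\<^sup>-\<^sup>2\<close> is the limit of validity of the oscillatory approximation, and it keeps
  the integral finite for \<open>b \<le> -1\<close>.
\<close>
definition truncated_Beta :: "real \<Rightarrow> nat \<Rightarrow> real" where
  "truncated_Beta b t = integral {1 / real t ^ 2..1} (\<lambda>x. x powr b * (1 - x) ^ (t + 1))"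

definition nesterov_moment :: "real \<Rightarrow> nat \<Rightarrow> real" where
  "nesterov_moment \<rho> t = integral {0..1} (\<lambda>x. x powr \<rho> * nesterov_residual x t ^ 2)"

lemma truncated_Beta_has_integral:
  assumes "t > 0"
  shows "((\<lambda>x. x powr b * (1 - x) ^ (t + 1)) has_integral truncated_Beta b t) {1 / real t ^ 2..1}"
  unfolding truncated_Beta_def using assms
  by (intro integrable_integral integrable_continuous_interval continuous_intros) auto

lemma truncated_Beta_nonneg: "t > 0 \<Longrightarrow> truncated_Beta b t \<ge> 0"
  by (rule has_integral_nonneg[OF truncated_Beta_has_integral]) auto

text \<open>The part cut off is at most the integral of x^b over [0, t^-2], whose order t^(-2 (b +
  1)) is the square of the order of the full Beta value.\<close>

lemma truncated_Beta_bounds: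
  assumes "b > -1" "t > 0"
  shows "truncated_Beta b t \<le> Beta (real (t + 2)) (b + 1)"
    "Beta (real (t + 2)) (b + 1) - real t powr (-2 * (b + 1)) / (b + 1) \<le> truncated_Beta b t"
proof -
  define a where "a = 1 / real t ^ 2"
  have a: "0 < a" "a \<le> 1" using assms by (auto simp: a_def)
  let ?f = "\<lambda>x. x powr b * (1 - x) ^ (t + 1)"
  have full: "(?f has_integral Beta (real (t + 2)) (b + 1)) {0..1}"
    using powr_power_has_integral_Beta[OF assms(1), of "t + 1"] by (simp add: add_ac)
  have split: "Beta (real (t + 2)) (b + 1) = integral {0..a} ?f + truncated_Beta b t"
  proof -
    have "integral {0..a} ?f + integral {a..1} ?f = integral {0..1} ?f"
      by (rule Henstock_Kurzweil_Integration.integral_combine) (use a has_integral_integrable[OF full] in auto)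
    thus ?thesis unfolding truncated_Beta_def a_def[symmetric] integral_unique[OF full] by simp
  qed
  have i: "?f integrable_on {0..a}"
    by (rule integrable_subinterval_real[of _ 0 1]) (use full a in auto)
  have "0 \<le> integral {0..a} ?f" using a by (intro integral_nonneg i) auto
  with split show "truncated_Beta b t \<le> Beta (real (t + 2)) (b + 1)" by linarith
  have p: "((\<lambda>x. x powr b) has_integral a powr (b + 1) / (b + 1)) {0..a}"
    using has_integral_powr_from_0[of b a] assms a by auto
  have "integral {0..a} ?f \<le> a powr (b + 1) / (b + 1)"
  proof (rule has_integral_le[OF integrable_integral[OF i] p])
    fix x assume "x \<in> {0..a}"
    hence "(1 - x) ^ (t + 1) \<le> 1" using a by (intro power_le_one) auto
    thus "?f x \<le> x powr b" using mult_left_mono[of "(1 - x) ^ (t + 1)" 1 "x powr b"] by simp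
  qed
  also have "a powr (b + 1) = real t powr (-2 * (b + 1))"
    using assms by (simp add: a_def inverse_square_powr)
  finally show "Beta (real (t + 2)) (b + 1) - real t powr (-2 * (b + 1)) / (b + 1) \<le> truncated_Beta b t"
    using split by linarith
qed

lemma nesterov_angle_deriv:
  assumes "0 < x" "x < 1"
  shows "(nesterov_angle has_real_derivative 1 / (2 * sqrt x * sqrt (1 - x))) (at x)"
proof -
  have s: "-1 < sqrt x" "sqrt x < 1" using assms real_sqrt_gt_zero[of x] by (auto simp: less_trans[of "-1" 0])
  have "((\<lambda>x. arcsin (sqrt x)) has_real_derivative inverse (sqrt (1 - sqrt x ^ 2)) * (inverse (sqrt x) / 2)) (at x)"
    by (intro DERIV_chain2[where f = arcsin] DERIV_arcsin DERIV_real_sqrt s assms)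
  thus ?thesis using assms unfolding nesterov_angle_def[abs_def] by (simp add: field_simps)
qed

lemma continuous_on_nesterov_angle: "continuous_on {0..1} nesterov_angle"
  unfolding nesterov_angle_def[abs_def]
  by (intro continuous_on_arcsin continuous_intros) (auto intro: order.trans[of "-1" 0])

lemma scale_by_sin:
  fixes A B k s w :: real
  assumes "A * k = B / 2"
  shows "A * (- s * (w * k)) = - (w / 2 * (B * s))"
proof -
  have "A * (- s * (w * k)) = - (w * s * (A * k))" by simp
  thus ?thesis unfolding assms by simp
qed

text \<open>Integration by parts. As theta' = 1 / (2 sqrt(x (1 - x))), the sine is -2 sqrt(x (1 -
  x)) / (2 t + 1) times the derivative of cos ((2 t + 1) theta). The boundary value at 1 vanishes,
  and the three terms come from the boundary value at t^-2 and from differentiating the two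
  powers.\<close>

lemma oscillation_bound:
  fixes b :: real
  assumes "t > 0"
  defines "f \<equiv> \<lambda>x. x powr b * (1 - x) ^ (t + 1) * sin ((2 * real t + 1) * nesterov_angle x)"
  shows "f integrable_on {1 / real t ^ 2..1}"
    "b > -3/2 \<Longrightarrow> \<bar>integral {1 / real t ^ 2..1} f\<bar> \<le> 2 / (2 * real t + 1) *
      (real t powr (-2 * b - 1) + \<bar>b + 1/2\<bar> * truncated_Beta (b - 1/2) t + (real t + 3/2) * Beta (real (t + 1)) (b + 3/2))"
proof -
  define a where "a = 1 / real t ^ 2"
  define \<omega> where "\<omega> = 2 * real t + 1"
  have a: "0 < a" "a \<le> 1" and w: "\<omega> > 0" using assms by (auto simp: a_def \<omega>_def)
  have ang: "continuous_on {a..1} nesterov_angle"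
    by (rule continuous_on_subset[OF continuous_on_nesterov_angle]) (use a in auto)
  have fi: "f integrable_on {a..1}" unfolding f_def
    using a by (intro integrable_continuous_interval continuous_intros ang) auto
  thus "f integrable_on {1 / real t ^ 2..1}" by (simp add: a_def)
  assume b: "b > -3/2"
  define F where "F = (\<lambda>x. x powr (b + 1/2) * (1 - x) powr (real t + 3/2) * cos (\<omega> * nesterov_angle x))"
  define g1 where "g1 = (\<lambda>x. (b + 1/2) * x powr (b - 1/2) * (1 - x) powr (real t + 3/2) * cos (\<omega> * nesterov_angle x))"
  define g2 where "g2 = (\<lambda>x. (real t + 3/2) * x powr (b + 1/2) * (1 - x) powr (real t + 1/2) * cos (\<omega> * nesterov_angle x))"
  have cpow: "continuous_on {a..1} (\<lambda>x::real. (1 - x) powr c)" if "c > 0" for c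
    using that by (intro continuous_on_powr' continuous_intros) auto
  have g1i: "g1 integrable_on {a..1}" and g2i: "g2 integrable_on {a..1}" unfolding g1_def g2_def
    using a by (intro integrable_continuous_interval continuous_intros ang cpow; force)+
  have "((\<lambda>x. g1 x - g2 x - \<omega> / 2 * f x) has_integral (F 1 - F a)) {a..1}"
  proof (rule fundamental_theorem_of_calculus_interior)
    show "continuous_on {a..1} F" unfolding F_def
      using a by (intro continuous_intros ang cpow) auto
    fix x assume "x \<in> {a<..<1}"
    hence x: "0 < x" "x < 1" using a by auto
    have d1: "((\<lambda>x. x powr (b + 1/2)) has_real_derivative (b + 1/2) * x powr (b - 1/2)) (at x)"
      using x by (auto intro!: derivative_eq_intros simp: algebra_simps)
    have d2: "((\<lambda>x. (1 - x) powr (real t + 3/2)) has_real_derivative - ((real t + 3/2) * (1 - x) powr (real t + 1/2))) (at x)"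
      using x by (auto intro!: derivative_eq_intros simp: algebra_simps)
    have d3: "((\<lambda>x. cos (\<omega> * nesterov_angle x)) has_real_derivative
       - sin (\<omega> * nesterov_angle x) * (\<omega> * (1 / (2 * sqrt x * sqrt (1 - x))))) (at x)"
      by (intro DERIV_chain2[OF DERIV_cos] DERIV_cmult nesterov_angle_deriv x)
    have dF: "(F has_real_derivative
       x powr (b + 1/2) * (1 - x) powr (real t + 3/2) * (- sin (\<omega> * nesterov_angle x) * (\<omega> * (1 / (2 * sqrt x * sqrt (1 - x)))))
       + (x powr (b + 1/2) * (- ((real t + 3/2) * (1 - x) powr (real t + 1/2))) +
         ((b + 1/2) * x powr (b - 1/2)) * (1 - x) powr (real t + 3/2)) * cos (\<omega> * nesterov_angle x)) (at x)"
      unfolding F_def by (intro DERIV_mult' d1 d2 d3)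
    have "x powr (b + 1/2) * (1 - x) powr (real t + 3/2) * (1 / (2 * sqrt x * sqrt (1 - x))) = x powr b * (1 - x) ^ (t + 1) / 2"
    proof -
      have "x powr (b + 1/2) = x powr b * sqrt x" using x unfolding powr_add by (simp add: powr_half_sqrt)
      moreover have "(1 - x) powr (real t + 3/2) = (1 - x) powr (real (t + 1) + 1/2)" by (simp add: add_ac)
      moreover have "\<dots> = (1 - x) ^ (t + 1) * sqrt (1 - x)"
        using x powr_realpow[of "1 - x" "t + 1"] by (simp only: powr_add) (simp add: powr_half_sqrt)
      ultimately show ?thesis using x by simp
    qed
    hence eq: "x powr (b + 1/2) * (1 - x) powr (real t + 3/2) * (- sin (\<omega> * nesterov_angle x) * (\<omega> * (1 / (2 * sqrt x * sqrt (1 - x)))))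
       = - (\<omega> / 2 * f x)"
      unfolding f_def \<omega>_def[symmetric] by (rule scale_by_sin)
    show "(F has_vector_derivative g1 x - g2 x - \<omega> / 2 * f x) (at x)"
      unfolding has_real_derivative_iff_has_vector_derivative[symmetric]
      using dF unfolding eq by (rule DERIV_cong) (simp add: g1_def g2_def algebra_simps)
  qed (use a in auto)
  moreover have "F 1 = 0" by (simp add: F_def)
  moreover have "((\<lambda>x. g1 x - g2 x - \<omega> / 2 * f x) has_integral (integral {a..1} g1 - integral {a..1} g2 - \<omega> / 2 * integral {a..1} f)) {a..1}"
    by (intro has_integral_diff has_integral_mult_right integrable_integral fi g1i g2i)
  ultimately have "integral {a..1} g1 - integral {a..1} g2 - \<omega> / 2 * integral {a..1} f = - F a"
    by (auto dest: has_integral_unique)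
  hence "F a + integral {a..1} g1 - integral {a..1} g2 = \<omega> / 2 * integral {a..1} f" by linarith
  hence "\<bar>F a + integral {a..1} g1 - integral {a..1} g2\<bar> = \<bar>\<omega> / 2\<bar> * \<bar>integral {a..1} f\<bar>"
    by (simp only: abs_mult)
  hence "\<omega> / 2 * \<bar>integral {a..1} f\<bar> = \<bar>F a + integral {a..1} g1 - integral {a..1} g2\<bar>"
    using w by simp
  also have "\<dots> \<le> \<bar>F a\<bar> + \<bar>integral {a..1} g1\<bar> + \<bar>integral {a..1} g2\<bar>" by linarith
  also have "\<bar>F a\<bar> \<le> real t powr (-2 * b - 1)"
  proof -
    have "\<bar>F a\<bar> \<le> a powr (b + 1/2) * 1 * 1" unfolding F_def abs_mult
      using a by (intro mult_mono) (auto intro: powr_le_one_le powr_le1)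
    also have "a powr (b + 1/2) = real t powr (-2 * (b + 1/2))"
      using assms by (simp add: a_def inverse_square_powr)
    also have "-2 * (b + 1/2) = -2 * b - 1" by simp
    finally show ?thesis by simp
  qed
  also have "\<bar>integral {a..1} g1\<bar> \<le> \<bar>b + 1/2\<bar> * truncated_Beta (b - 1/2) t"
  proof -
    have "norm (integral {a..1} g1) \<le> integral {a..1} (\<lambda>x. \<bar>b + 1/2\<bar> * (x powr (b - 1/2) * (1 - x) ^ (t + 1)))"
    proof (rule integral_norm_bound_integral[OF g1i])
      show "(\<lambda>x. \<bar>b + 1/2\<bar> * (x powr (b - 1/2) * (1 - x) ^ (t + 1))) integrable_on {a..1}"
        using a by (intro integrable_continuous_interval continuous_intros) auto
      fix x assume x: "x \<in> {a..1}"
      have "(1 - x) powr (real t + 3/2) \<le> (1 - x) ^ (t + 1)"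
      proof (cases "x = 1")
        case False
        hence "(1 - x) powr (real t + 3/2) \<le> (1 - x) powr real (t + 1)"
          using x a by (intro powr_mono') auto
        thus ?thesis using False x by (subst (asm) powr_realpow) auto
      qed auto
      hence "\<bar>b + 1/2\<bar> * x powr (b - 1/2) * (1 - x) powr (real t + 3/2) * \<bar>cos (\<omega> * nesterov_angle x)\<bar>
          \<le> \<bar>b + 1/2\<bar> * x powr (b - 1/2) * (1 - x) ^ (t + 1) * 1"
        using x by (intro mult_mono) auto
      thus "norm (g1 x) \<le> \<bar>b + 1/2\<bar> * (x powr (b - 1/2) * (1 - x) ^ (t + 1))"
        by (simp add: g1_def abs_mult mult_ac)
    qed
    thus ?thesis by (simp add: truncated_Beta_def a_def)
  qed
  also have "\<bar>integral {a..1} g2\<bar> \<le> (real t + 3/2) * Beta (real (t + 1)) (b + 3/2)"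
  proof -
    have full: "((\<lambda>x. x powr (b + 1/2) * (1 - x) ^ t) has_integral Beta (real (t + 1)) (b + 3/2)) {0..1}"
      using powr_power_has_integral_Beta[of "b + 1/2" t] b by (simp add: add_ac)
    have i: "(\<lambda>x. x powr (b + 1/2) * (1 - x) ^ t) integrable_on {a..1}"
      using a by (intro integrable_continuous_interval continuous_intros) auto
    have "norm (integral {a..1} g2) \<le> integral {a..1} (\<lambda>x. (real t + 3/2) * (x powr (b + 1/2) * (1 - x) ^ t))"
    proof (rule integral_norm_bound_integral[OF g2i])
      show "(\<lambda>x. (real t + 3/2) * (x powr (b + 1/2) * (1 - x) ^ t)) integrable_on {a..1}"
        using i by (rule integrable_on_mult_right)
      fix x assume x: "x \<in> {a..1}"
      have "(1 - x) powr (real t + 1/2) \<le> (1 - x) ^ t"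
      proof (cases "x = 1")
        case False
        hence "(1 - x) powr (real t + 1/2) \<le> (1 - x) powr real t"
          using x a by (intro powr_mono') auto
        thus ?thesis using False x by (subst (asm) powr_realpow) auto
      qed auto
      hence "(real t + 3/2) * x powr (b + 1/2) * (1 - x) powr (real t + 1/2) * \<bar>cos (\<omega> * nesterov_angle x)\<bar>
          \<le> (real t + 3/2) * x powr (b + 1/2) * (1 - x) ^ t * 1"
        using x by (intro mult_mono) auto
      thus "norm (g2 x) \<le> (real t + 3/2) * (x powr (b + 1/2) * (1 - x) ^ t)"
        by (simp add: g2_def abs_mult mult_ac)
    qed
    also have "\<dots> = (real t + 3/2) * integral {a..1} (\<lambda>x. x powr (b + 1/2) * (1 - x) ^ t)" by simp
    also have "integral {a..1} (\<lambda>x. x powr (b + 1/2) * (1 - x) ^ t) \<le> integral {0..1} (\<lambda>x. x powr (b + 1/2) * (1 - x) ^ t)"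
      using a full i by (intro integral_subset_le) auto
    also have "\<dots> = Beta (real (t + 1)) (b + 3/2)" using full by (rule integral_unique)
    finally show ?thesis by simp
  qed
  finally have "\<omega> / 2 * \<bar>integral {a..1} f\<bar> \<le> real t powr (-2 * b - 1) + \<bar>b + 1/2\<bar> * truncated_Beta (b - 1/2) t + (real t + 3/2) * Beta (real (t + 1)) (b + 3/2)"
    by simp
  thus "\<bar>integral {1 / real t ^ 2..1} f\<bar> \<le> 2 / (2 * real t + 1) *
      (real t powr (-2 * b - 1) + \<bar>b + 1/2\<bar> * truncated_Beta (b - 1/2) t + (real t + 3/2) * Beta (real (t + 1)) (b + 3/2))"
    using w unfolding a_def[symmetric] \<omega>_def[symmetric] by (simp add: field_simps)
qed

lemma nesterov_residual_sq_integrable: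
  assumes q: "set_integrable lborel {0..1} q"
  shows "set_integrable lborel {0..1} (\<lambda>x. q x * nesterov_residual x t ^ 2)"
proof -
  have "compact ((\<lambda>x. nesterov_residual x t ^ 2) ` {0..1})"
    by (intro compact_continuous_image continuous_intros) auto
  then obtain K where "\<forall>y \<in> (\<lambda>x. nesterov_residual x t ^ 2) ` {0..1}. norm y \<le> K"
    using compact_imp_bounded bounded_iff by blast
  hence K: "\<And>x. x \<in> {0..1} \<Longrightarrow> norm (nesterov_residual x t ^ 2) \<le> K" by blast
  show ?thesis
  proof (rule set_integrable_bound)
    show "set_integrable lborel {0..1} (\<lambda>x. K * q x)" by (intro set_integrable_mult_right q)
    have "(\<lambda>x. indicator {0..1} x *\<^sub>R q x) \<in> borel_measurable lborel"
      using q unfolding set_integrable_def by (rule borel_measurable_integrable)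
    moreover have "(\<lambda>x. nesterov_residual x t ^ 2) \<in> borel_measurable lborel" by measurable
    ultimately have "(\<lambda>x. (indicator {0..1} x *\<^sub>R q x) * nesterov_residual x t ^ 2) \<in> borel_measurable lborel"
      by (rule borel_measurable_times)
    thus "set_borel_measurable lborel {0..1} (\<lambda>x. q x * nesterov_residual x t ^ 2)"
      unfolding set_borel_measurable_def by (simp add: mult.assoc)
    show "AE x in lborel. x \<in> {0..1} \<longrightarrow> norm (q x * nesterov_residual x t ^ 2) \<le> norm (K * q x)"
    proof (intro AE_I2 impI)
      fix x :: real assume x: "x \<in> {0..1}"
      have "norm (q x * nesterov_residual x t ^ 2) \<le> norm (q x) * K"
        unfolding norm_mult by (rule mult_left_mono[OF K[OF x] norm_ge_zero])
      also have "\<dots> \<le> norm (q x) * norm K" by (intro mult_left_mono) auto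
      finally show "norm (q x * nesterov_residual x t ^ 2) \<le> norm (K * q x)"
        by (simp only: norm_mult mult.commute)
    qed
  qed
qed

lemma nesterov_moment_integrable:
  assumes "\<rho> > -1"
  shows "set_integrable lborel {0..1} (\<lambda>x. x powr \<rho> * nesterov_residual x t ^ 2)"
    "((\<lambda>x. x powr \<rho> * nesterov_residual x t ^ 2) has_integral nesterov_moment \<rho> t) {0..1}"
    "(LINT x:{0..1}|lborel. x powr \<rho> * nesterov_residual x t ^ 2) = nesterov_moment \<rho> t"
proof -
  have "set_integrable lborel {0..1} (\<lambda>x. x powr (\<rho> + 1 - 1) * (1 - x) powr (1 - 1))"
    using assms by (intro integrable_Beta) auto
  hence "set_integrable lborel {0..1} (\<lambda>x. x powr \<rho>)"
  proof (subst (asm) set_integrable_cong_AE)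
    show "AE x\<in>{0..1} in lborel. x powr (\<rho> + 1 - 1) * (1 - x) powr (1 - 1) = x powr \<rho>"
      \<comment> \<open>Since \<open>0 powr 0\<close> is 0, the factor (1 - x) powr 0 differs from 1
        at the single point x = 1.\<close>
      using AE_lborel_singleton[of 1] by eventually_elim simp
  qed auto
  thus int: "set_integrable lborel {0..1} (\<lambda>x. x powr \<rho> * nesterov_residual x t ^ 2)"
    by (rule nesterov_residual_sq_integrable)
  show "((\<lambda>x. x powr \<rho> * nesterov_residual x t ^ 2) has_integral nesterov_moment \<rho> t) {0..1}"
    unfolding nesterov_moment_def using set_borel_integral_eq_integral(1)[OF int] by (rule integrable_integral)
  show "(LINT x:{0..1}|lborel. x powr \<rho> * nesterov_residual x t ^ 2) = nesterov_moment \<rho> t"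
    unfolding nesterov_moment_def by (rule set_borel_integral_eq_integral(2)[OF int])
qed

lemma abs_powr_eq: "\<bar>x powr c\<bar> = x powr (c::real)"
  by simp

lemma nesterov_residual_sq_le_4:
  assumes "0 \<le> x" "x \<le> 1" "real t ^ 2 * x \<le> 1"
  shows "nesterov_residual x t ^ 2 \<le> 4"
proof -
  have "\<bar>nesterov_residual x t\<bar> \<le> \<bar>2\<bar>"
    using nesterov_residual_near_one[OF assms] assms(3) by linarith
  thus ?thesis by (subst (asm) abs_le_square_iff) simp
qed

text \<open>The shift by 3/2 cancels the factor x^(-3/2) of \<open>nesterov_main\<close>, and t^3
  normalizes its constant. The range x <= t^-2 contributes the first error term and the
  approximation error t^-4 x^-2 the second; integrating the oscillation by parts adds the third and
  multiples of the other two. The value b = -1 is the critical exponent rho = 1/2.\<close>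

lemma nesterov_moment_approx:
  fixes b :: real
  assumes b: "b \<ge> -1"
  obtains C where "C > 0" "\<And>t. t > 0 \<Longrightarrow>
    \<bar>real t powr 3 * nesterov_moment (b + 3/2) t - 16 / pi ^ 2 * (Beta (real t) (3/2) * real t powr (3/2)) ^ 2 * truncated_Beta b t\<bar>
      \<le> C * (real t powr (-2 * b - 2) + truncated_Beta (b - 1/2) t / real t + real t powr (- b - 3/2))"
proof -
  obtain C0 where C0: "C0 > 0"
    "\<And>x t. 0 < x \<Longrightarrow> x < 1 \<Longrightarrow> t > 0 \<Longrightarrow> real t ^ 2 * x \<ge> 1 \<Longrightarrow>
       \<bar>nesterov_residual x t ^ 2 - nesterov_main x t\<bar> \<le> C0 * real t powr (-4) * x powr (-2) * (1 - x) ^ (t + 1)"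
    using nesterov_residual_sq_bounds by metis
  obtain K where K: "K > 0" "\<And>n. n > 0 \<Longrightarrow> Beta (real n) (3/2) \<le> K * real n powr (-(3/2))"
    using Beta_nat_bound[of "3/2" 0] by auto
  obtain K' where K': "K' > 0" "\<And>n. n > 0 \<Longrightarrow> Beta (real (n + 1)) (b + 3/2) \<le> K' * real n powr (-(b + 3/2))"
    using Beta_nat_bound[of "b + 3/2" 1] b by auto
  \<comment> \<open>4 bounds the squared residual for x <= t^-2, C0 belongs to the approximation
    error, and the last summand is a bound for beta t^3 times the constant of the oscillating
    integral R.\<close>
  define C where "C = 4 + C0 + 16 / pi ^ 2 * K ^ 2 * (1 + \<bar>b + 1/2\<bar> + 3 * K')"
  have Cpos: "C > 0" unfolding C_def using C0(1) K'(1) by (intro add_pos_nonneg) auto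
  show ?thesis
  proof (rule that[OF Cpos])
    fix t :: nat assume t: "t > 0"
    define a where "a = 1 / real t ^ 2"
    have a: "0 < a" "a \<le> 1" using t by (auto simp: a_def)
    have t1: "real t \<ge> 1" using t by simp
    define B where "B = Beta (real t) (3/2)"
    define \<beta> where "\<beta> = 16 / pi ^ 2 * B ^ 2"
    define h where "h = (\<lambda>x. x powr b * (1 - x) ^ (t + 1) * sin ((2 * real t + 1) * nesterov_angle x))"
    define R where "R = integral {a..1} h"
    define D where "D = real t powr (-2 * b - 2) + truncated_Beta (b - 1/2) t / real t + real t powr (- b - 3/2)"
    have tB: "truncated_Beta (b - 1/2) t \<ge> 0" by (rule truncated_Beta_nonneg[OF t])
    let ?f = "\<lambda>x. x powr (b + 3/2) * nesterov_residual x t ^ 2"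
    note full = nesterov_moment_integrable(2)[of "b + 3/2" t]
    have full: "(?f has_integral nesterov_moment (b + 3/2) t) {0..1}" by (rule full) (use b in simp)
    have split: "integral {0..a} ?f + integral {a..1} ?f = nesterov_moment (b + 3/2) t"
      using Henstock_Kurzweil_Integration.integral_combine[of 0 a 1 ?f] a has_integral_integrable[OF full]
      unfolding integral_unique[OF full] by auto
    have low: "\<bar>integral {0..a} ?f\<bar> \<le> 4 * real t powr (-2 * b - 5)"
    proof -
      have i: "?f integrable_on {0..a}"
        by (rule integrable_subinterval_real[OF has_integral_integrable[OF full]]) (use a in auto)
      have p: "((\<lambda>x. 4 * x powr (b + 3/2)) has_integral 4 * (a powr (b + 5/2) / (b + 5/2))) {0..a}"
        using has_integral_mult_right[OF has_integral_powr_from_0[of "b + 3/2" a], of 4] b a by (simp add: add.assoc)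
      have "0 \<le> integral {0..a} ?f" by (intro integral_nonneg i) auto
      moreover have "integral {0..a} ?f \<le> 4 * (a powr (b + 5/2) / (b + 5/2))"
      proof (rule has_integral_le[OF integrable_integral[OF i] p])
        fix x assume x: "x \<in> {0..a}"
        hence "real t ^ 2 * x \<le> 1" using t by (simp add: a_def field_simps)
        hence "nesterov_residual x t ^ 2 \<le> 4" using x a by (intro nesterov_residual_sq_le_4) auto
        hence "x powr (b + 3/2) * nesterov_residual x t ^ 2 \<le> x powr (b + 3/2) * 4" by (intro mult_left_mono) auto
        thus "?f x \<le> 4 * x powr (b + 3/2)" by simp
      qed
      moreover have "a powr (b + 5/2) / (b + 5/2) \<le> a powr (b + 5/2) / 1"
        using b by (intro divide_left_mono) auto
      moreover have "a powr (b + 5/2) = real t powr (-2 * (b + 5/2))" using t by (simp add: a_def inverse_square_powr)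
      moreover have "-2 * (b + 5/2) = -2 * b - 5" by simp
      ultimately show ?thesis by simp
    qed
    have high: "\<bar>integral {a..1} ?f - \<beta> * (truncated_Beta b t - R)\<bar> \<le> C0 * real t powr (-4) * truncated_Beta (b - 1/2) t"
    proof -
      have f: "(?f has_integral integral {a..1} ?f) {a<..<1}"
      proof -
        have "?f integrable_on {a..1}"
          by (rule integrable_subinterval_real[OF has_integral_integrable[OF full]]) (use a in auto)
        thus ?thesis by (simp add: integrable_integral flip: has_integral_Icc_iff_Ioo)
      qed
      have m: "((\<lambda>x. \<beta> * (x powr b * (1 - x) ^ (t + 1) - h x)) has_integral \<beta> * (truncated_Beta b t - R)) {a<..<1}"
        unfolding has_integral_Icc_iff_Ioo[symmetric] R_def a_def
        by (intro has_integral_mult_right has_integral_diff truncated_Beta_has_integral t integrable_integral)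
           (unfold h_def, rule oscillation_bound(1)[OF t])
      have e: "((\<lambda>x. C0 * real t powr (-4) * (x powr (b - 1/2) * (1 - x) ^ (t + 1))) has_integral C0 * real t powr (-4) * truncated_Beta (b - 1/2) t) {a<..<1}"
        unfolding has_integral_Icc_iff_Ioo[symmetric] a_def
        by (intro has_integral_mult_right truncated_Beta_has_integral t)
      have "norm (integral {a<..<1} (\<lambda>x. ?f x - \<beta> * (x powr b * (1 - x) ^ (t + 1) - h x)))
        \<le> integral {a<..<1} (\<lambda>x. C0 * real t powr (-4) * (x powr (b - 1/2) * (1 - x) ^ (t + 1)))"
      proof (rule integral_norm_bound_integral)
        fix x assume x: "x \<in> {a<..<1}"
        hence x': "0 < x" "x < 1" using a by auto
        have tx: "real t ^ 2 * x \<ge> 1" using x t by (simp add: a_def field_simps)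
        have "x powr (b + 3/2) * nesterov_main x t = \<beta> * ((x powr (b + 3/2) * x powr (-3/2)) * (1 - x) ^ (t + 1) * (1 - sin ((2 * real t + 1) * nesterov_angle x)))"
          by (simp add: nesterov_main_def \<beta>_def B_def)
        also have "x powr (b + 3/2) * x powr (-3/2) = x powr b" unfolding powr_add[symmetric] by simp
        also have "\<beta> * (x powr b * (1 - x) ^ (t + 1) * (1 - sin ((2 * real t + 1) * nesterov_angle x))) = \<beta> * (x powr b * (1 - x) ^ (t + 1) - h x)"
          by (simp add: h_def algebra_simps)
        finally have "?f x - \<beta> * (x powr b * (1 - x) ^ (t + 1) - h x) = x powr (b + 3/2) * (nesterov_residual x t ^ 2 - nesterov_main x t)"
          by (simp add: algebra_simps)
        also have "norm \<dots> \<le> x powr (b + 3/2) * (C0 * real t powr (-4) * x powr (-2) * (1 - x) ^ (t + 1))"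
          unfolding norm_mult using C0(2)[OF x' t tx] by (intro mult_mono) auto
        also have "\<dots> = C0 * real t powr (-4) * ((x powr (b + 3/2) * x powr (-2)) * (1 - x) ^ (t + 1))" by simp
        also have "x powr (b + 3/2) * x powr (-2) = x powr (b - 1/2)" unfolding powr_add[symmetric] by simp
        finally show "norm (?f x - \<beta> * (x powr b * (1 - x) ^ (t + 1) - h x)) \<le> C0 * real t powr (-4) * (x powr (b - 1/2) * (1 - x) ^ (t + 1))" .
      qed (use has_integral_diff[OF f m] e in auto)
      thus ?thesis unfolding integral_unique[OF has_integral_diff[OF f m]] integral_unique[OF e] by simp
    qed
    have R: "\<bar>R\<bar> \<le> (1 + \<bar>b + 1/2\<bar> + 3 * K') * D"
    proof -
      have "\<bar>R\<bar> \<le> 2 / (2 * real t + 1) *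
        (real t powr (-2 * b - 1) + \<bar>b + 1/2\<bar> * truncated_Beta (b - 1/2) t + (real t + 3/2) * Beta (real (t + 1)) (b + 3/2))"
        unfolding R_def h_def a_def using oscillation_bound(2)[OF t, of b] b by simp
      also have "\<dots> \<le> 1 / real t * (real t powr (-2 * b - 1) + \<bar>b + 1/2\<bar> * truncated_Beta (b - 1/2) t + (3 * real t) * (K' * real t powr (-(b + 3/2))))"
        using t1 tB K'(2)[OF t] K'(1) b Gamma_real_pos[of "b + 3/2"]
        by (intro mult_mono add_mono add_nonneg_nonneg) (auto simp: Beta_def field_simps intro!: divide_nonneg_nonneg mult_nonneg_nonneg Gamma_real_nonneg)
      also have "\<dots> = real t powr (-2 * b - 1) / real t + \<bar>b + 1/2\<bar> * (truncated_Beta (b - 1/2) t / real t) + 3 * K' * real t powr (-(b + 3/2))"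
        using t by (simp add: field_simps)
      also have "real t powr (-2 * b - 1) / real t = real t powr (-2 * b - 2)"
        using t by (simp add: powr_diff field_simps power2_eq_square powr_numeral)
      also have "-(b + 3/2) = - b - 3/2" by simp
      also have "real t powr (-2 * b - 2) + \<bar>b + 1/2\<bar> * (truncated_Beta (b - 1/2) t / real t) + 3 * K' * real t powr (- b - 3/2) \<le> (1 + \<bar>b + 1/2\<bar> + 3 * K') * D"
      proof -
        have "real t powr (-2 * b - 2) \<le> 1 * D" "truncated_Beta (b - 1/2) t / real t \<le> D" "real t powr (- b - 3/2) \<le> D"
          using tB t by (auto simp: D_def)
        hence "real t powr (-2 * b - 2) + \<bar>b + 1/2\<bar> * (truncated_Beta (b - 1/2) t / real t) + 3 * K' * real t powr (- b - 3/2)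
           \<le> 1 * D + \<bar>b + 1/2\<bar> * D + 3 * K' * D"
          using K'(1) by (intro add_mono mult_left_mono) auto
        thus ?thesis by (simp add: algebra_simps)
      qed
      finally show ?thesis .
    qed
    have D0: "D \<ge> 0" using tB by (auto simp: D_def)
    have \<beta>: "0 \<le> \<beta>" "\<beta> * real t powr 3 \<le> 16 / pi ^ 2 * K ^ 2"
    proof -
      show "0 \<le> \<beta>" by (simp add: \<beta>_def)
      have "B \<ge> 0" unfolding B_def Beta_def using t by (intro divide_nonneg_nonneg mult_nonneg_nonneg Gamma_real_nonneg) auto
      hence "B ^ 2 \<le> (K * real t powr (-(3/2))) ^ 2" using K(2)[OF t] unfolding B_def by (intro power_mono) auto
      also have "\<dots> = K ^ 2 * real t powr (-3)" using t by (simp add: power_mult_distrib powr_power)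
      finally have "B ^ 2 * real t powr 3 \<le> K ^ 2 * real t powr (-3) * real t powr 3" by (intro mult_right_mono) auto
      also have "\<dots> = K ^ 2 * (real t powr (-3) * real t powr 3)" by simp
      also have "real t powr (-3) * real t powr 3 = 1" unfolding powr_add[symmetric] using t by simp
      finally have "16 / pi ^ 2 * (B ^ 2 * real t powr 3) \<le> 16 / pi ^ 2 * (K ^ 2 * 1)" by (intro mult_left_mono) auto
      thus "\<beta> * real t powr 3 \<le> 16 / pi ^ 2 * K ^ 2" by (simp add: \<beta>_def)
    qed
    have bt: "16 / pi ^ 2 * (Beta (real t) (3/2) * real t powr (3/2)) ^ 2 = \<beta> * real t powr 3"
      using t by (simp add: \<beta>_def B_def power_mult_distrib powr_power)
    have eq: "real t powr 3 * nesterov_moment (b + 3/2) t - 16 / pi ^ 2 * (Beta (real t) (3/2) * real t powr (3/2)) ^ 2 * truncated_Beta b t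
      = real t powr 3 * integral {0..a} ?f + real t powr 3 * (integral {a..1} ?f - \<beta> * (truncated_Beta b t - R)) - (\<beta> * real t powr 3) * R"
      unfolding bt split[symmetric] by (simp add: algebra_simps)
    have l1: "\<bar>real t powr 3 * integral {0..a} ?f\<bar> \<le> 4 * D"
    proof -
      have "\<bar>real t powr 3 * integral {0..a} ?f\<bar> \<le> real t powr 3 * (4 * real t powr (-2 * b - 5))"
        unfolding abs_mult abs_powr_eq by (rule mult_left_mono[OF low powr_ge_zero])
      also have "\<dots> = 4 * (real t powr 3 * real t powr (-2 * b - 5))" by simp
      also have "real t powr 3 * real t powr (-2 * b - 5) = real t powr (-2 * b - 2)"
        unfolding powr_add[symmetric] by (rule arg_cong[where f = "(powr) (real t)"]) simp
      also have "\<dots> \<le> D" using tB by (simp add: D_def)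
      finally show ?thesis by simp
    qed
    have l2: "\<bar>real t powr 3 * (integral {a..1} ?f - \<beta> * (truncated_Beta b t - R))\<bar> \<le> C0 * D"
    proof -
      have "\<bar>real t powr 3 * (integral {a..1} ?f - \<beta> * (truncated_Beta b t - R))\<bar> \<le> real t powr 3 * (C0 * real t powr (-4) * truncated_Beta (b - 1/2) t)"
        unfolding abs_mult abs_powr_eq by (rule mult_left_mono[OF high powr_ge_zero])
      also have "\<dots> = C0 * ((real t powr 3 * real t powr (-4)) * truncated_Beta (b - 1/2) t)" by simp
      also have "real t powr 3 * real t powr (-4) = real t powr (-1)" unfolding powr_add[symmetric] by simp
      also have "\<dots> = 1 / real t" using t by (simp add: powr_minus_divide)
      also have "C0 * (1 / real t * truncated_Beta (b - 1/2) t) \<le> C0 * D"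
        using C0(1) by (intro mult_left_mono) (auto simp: D_def)
      finally show ?thesis .
    qed
    have l3: "\<bar>(\<beta> * real t powr 3) * R\<bar> \<le> (16 / pi ^ 2 * K ^ 2) * ((1 + \<bar>b + 1/2\<bar> + 3 * K') * D)"
    proof -
      have "\<bar>(\<beta> * real t powr 3) * R\<bar> = (\<beta> * real t powr 3) * \<bar>R\<bar>" using \<beta>(1) by (simp add: abs_mult)
      also have "\<dots> \<le> (16 / pi ^ 2 * K ^ 2) * ((1 + \<bar>b + 1/2\<bar> + 3 * K') * D)"
        by (intro mult_mono \<beta> R) auto
      finally show ?thesis .
    qed
    have CD: "C * D = 4 * D + C0 * D + (16 / pi ^ 2 * K ^ 2) * ((1 + \<bar>b + 1/2\<bar> + 3 * K') * D)"
      by (simp add: C_def distrib_right)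
    show "\<bar>real t powr 3 * nesterov_moment (b + 3/2) t - 16 / pi ^ 2 * (Beta (real t) (3/2) * real t powr (3/2)) ^ 2 * truncated_Beta b t\<bar>
      \<le> C * (real t powr (-2 * b - 2) + truncated_Beta (b - 1/2) t / real t + real t powr (- b - 3/2))"
      unfolding D_def[symmetric] eq CD using l1 l2 l3 by linarith
  qed
qed

section \<open>Moments for exponents rho >= 1/2\<close>

lemma powr_minus_tendsto_0:
  assumes "c < 0"
  shows "(\<lambda>t. real t powr c) \<longlonglongrightarrow> 0"
  using assms by (intro tendsto_neg_powr filterlim_real_sequentially)

text \<open>b - 1/2 may lie below -1, where the complete Beta integral diverges. Giving up a factor
  x^(kappa - 1/2), which is at most t^(1 - 2 kappa) above the cut-off, leaves a convergent integral
  of order t^(-(b - kappa + 1)). After division by t the result is smaller than the main order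
  t^(-(b + 1)) by t^(-kappa).\<close>

lemma truncated_Beta_half_bound:
  assumes "b > -1"
  obtains \<kappa> K where "\<kappa> > 0" "K > 0" "\<And>t. t > 0 \<Longrightarrow> truncated_Beta (b - 1/2) t \<le> K * real t powr (-\<kappa> - b)"
proof -
  \<comment> \<open>The bound 1/4 keeps kappa - 1/2 negative, so that x powr (kappa - 1/2) is
    largest at the cut-off; the bound (b + 1) / 2 keeps b - kappa above -1.\<close>
  define \<kappa> where "\<kappa> = min (1/4) ((b + 1) / 2)"
  have k: "\<kappa> > 0" "\<kappa> \<le> 1/4" "b - \<kappa> > -1" using assms by (auto simp: \<kappa>_def min_def field_simps)
  obtain K where K: "K > 0" "\<And>n. n > 0 \<Longrightarrow> Beta (real (n + 2)) (b - \<kappa> + 1) \<le> K * real n powr (-(b - \<kappa> + 1))"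
    using Beta_nat_bound[of "b - \<kappa> + 1" 2] k by auto
  show ?thesis
  proof (rule that[OF k(1) K(1)])
    fix t :: nat assume t: "t > 0"
    have "truncated_Beta (b - 1/2) t \<le> real t powr (1 - 2 * \<kappa>) * truncated_Beta (b - \<kappa>) t"
    proof (rule has_integral_le[OF truncated_Beta_has_integral has_integral_mult_right[OF truncated_Beta_has_integral]])
      fix x assume "x \<in> {1 / real t ^ 2..1}"
      hence x: "1 / real t ^ 2 \<le> x" "x \<le> 1" by auto
      have x0: "x > 0" by (rule less_le_trans[OF _ x(1)]) (use t in simp)
      have "x powr (b - 1/2) = x powr (\<kappa> - 1/2) * x powr (b - \<kappa>)" unfolding powr_add[symmetric] by simp
      also have "x powr (\<kappa> - 1/2) \<le> (1 / real t ^ 2) powr (\<kappa> - 1/2)"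
        using x k t by (intro powr_mono2') auto
      also have "(1 / real t ^ 2) powr (\<kappa> - 1/2) = real t powr (-2 * (\<kappa> - 1/2))" using t by (simp add: inverse_square_powr)
      also have "-2 * (\<kappa> - 1/2) = 1 - 2 * \<kappa>" by simp
      finally have "x powr (b - 1/2) \<le> real t powr (1 - 2 * \<kappa>) * x powr (b - \<kappa>)" by (simp add: mult_right_mono)
      hence "x powr (b - 1/2) * (1 - x) ^ (t + 1) \<le> real t powr (1 - 2 * \<kappa>) * x powr (b - \<kappa>) * (1 - x) ^ (t + 1)"
        using x by (intro mult_right_mono) auto
      thus "x powr (b - 1/2) * (1 - x) ^ (t + 1) \<le> real t powr (1 - 2 * \<kappa>) * (x powr (b - \<kappa>) * (1 - x) ^ (t + 1))" by simp
    qed (use t in auto)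
    also have "truncated_Beta (b - \<kappa>) t \<le> Beta (real (t + 2)) (b - \<kappa> + 1)"
      using truncated_Beta_bounds(1)[OF k(3) t] .
    also have "\<dots> \<le> K * real t powr (-(b - \<kappa> + 1))" by (rule K(2)[OF t])
    also have "real t powr (1 - 2 * \<kappa>) * (K * real t powr (-(b - \<kappa> + 1))) = K * (real t powr (1 - 2 * \<kappa>) * real t powr (-(b - \<kappa> + 1)))" by simp
    also have "real t powr (1 - 2 * \<kappa>) * real t powr (-(b - \<kappa> + 1)) = real t powr (-\<kappa> - b)"
      unfolding powr_add[symmetric] by (rule arg_cong[where f = "(powr) (real t)"]) simp
    finally show "truncated_Beta (b - 1/2) t \<le> K * real t powr (-\<kappa> - b)" by (simp add: mult_left_mono)
  qed
qed

lemma Beta_three_halves_sq_asymp: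
  "(\<lambda>t. 16 / pi ^ 2 * (Beta (real t) (3/2) * real t powr (3/2)) ^ 2) \<longlonglongrightarrow> 16 / pi ^ 2 * Gamma (3/2) ^ 2"
  by (intro tendsto_intros Beta_nat_asymp) auto

text \<open>Multiplied by t^(b+1), the errors of \<open>nesterov_moment_approx\<close> are of order
  t^(-b-1), t^(-kappa) and t^(-1/2) and vanish in the limit, so the truncated Beta integral alone
  determines it.\<close>

lemma nesterov_moment_asymp_large:
  assumes b: "b > -1"
  shows "(\<lambda>t. real t powr (b + 4) * nesterov_moment (b + 3/2) t) \<longlonglongrightarrow> 16 / pi ^ 2 * Gamma (3/2) ^ 2 * Gamma (b + 1)"
proof -
  have ev: "eventually (\<lambda>t::nat. t > 0) sequentially" by (rule eventually_gt_at_top)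
  have tB: "(\<lambda>t. real t powr (b + 1) * truncated_Beta b t) \<longlonglongrightarrow> Gamma (b + 1)"
  proof (rule tendsto_sandwich)
    have "(\<lambda>t. Beta (real (t + 2)) (b + 1) * real t powr (b + 1) - real t powr (-(b + 1)) / (b + 1)) \<longlonglongrightarrow> Gamma (b + 1) - 0 / (b + 1)"
      using b by (intro tendsto_intros Beta_nat_shift_asymp powr_minus_tendsto_0) auto
    thus "(\<lambda>t. Beta (real (t + 2)) (b + 1) * real t powr (b + 1) - real t powr (-(b + 1)) / (b + 1)) \<longlonglongrightarrow> Gamma (b + 1)" by simp
    show "(\<lambda>t. Beta (real (t + 2)) (b + 1) * real t powr (b + 1)) \<longlonglongrightarrow> Gamma (b + 1)"
      using b by (intro Beta_nat_shift_asymp) auto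
    show "\<forall>\<^sub>F t in sequentially. real t powr (b + 1) * truncated_Beta b t \<le> Beta (real (t + 2)) (b + 1) * real t powr (b + 1)"
      using ev by eventually_elim (use truncated_Beta_bounds(1)[OF b] in \<open>simp add: mult.commute mult_left_mono\<close>)
    show "\<forall>\<^sub>F t in sequentially. Beta (real (t + 2)) (b + 1) * real t powr (b + 1) - real t powr (-(b + 1)) / (b + 1)
        \<le> real t powr (b + 1) * truncated_Beta b t"
      using ev
    proof eventually_elim
      case (elim t)
      have "real t powr (b + 1) * (Beta (real (t + 2)) (b + 1) - real t powr (-2 * (b + 1)) / (b + 1)) \<le> real t powr (b + 1) * truncated_Beta b t"
        using truncated_Beta_bounds(2)[OF b elim] by (intro mult_left_mono) auto
      moreover have "real t powr (b + 1) * real t powr (-2 * (b + 1)) = real t powr (-(b + 1))"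
        unfolding powr_add[symmetric] by (rule arg_cong[where f = "(powr) (real t)"]) simp
      ultimately show ?case by (simp add: right_diff_distrib mult.commute)
    qed
  qed
  obtain C where C: "C > 0" "\<And>t. t > 0 \<Longrightarrow>
    \<bar>real t powr 3 * nesterov_moment (b + 3/2) t - 16 / pi ^ 2 * (Beta (real t) (3/2) * real t powr (3/2)) ^ 2 * truncated_Beta b t\<bar>
      \<le> C * (real t powr (-2 * b - 2) + truncated_Beta (b - 1/2) t / real t + real t powr (- b - 3/2))"
    using nesterov_moment_approx[of b] b by auto
  obtain \<kappa> K where K: "\<kappa> > 0" "K > 0" "\<And>t. t > 0 \<Longrightarrow> truncated_Beta (b - 1/2) t \<le> K * real t powr (-\<kappa> - b)"
    using truncated_Beta_half_bound[OF b] by blast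
  let ?m = "\<lambda>t. 16 / pi ^ 2 * (Beta (real t) (3/2) * real t powr (3/2)) ^ 2 * (real t powr (b + 1) * truncated_Beta b t)"
  have err: "(\<lambda>t. real t powr (b + 4) * nesterov_moment (b + 3/2) t - ?m t) \<longlonglongrightarrow> 0"
  proof (rule Lim_null_comparison)
    have "(\<lambda>t. C * (real t powr (- b - 1) + K * real t powr (-\<kappa>) + real t powr (- 1/2))) \<longlonglongrightarrow> C * (0 + K * 0 + 0)"
      using b K by (intro tendsto_intros powr_minus_tendsto_0) auto
    thus "(\<lambda>t. C * (real t powr (- b - 1) + K * real t powr (-\<kappa>) + real t powr (- 1/2))) \<longlonglongrightarrow> 0" by simp
    show "\<forall>\<^sub>F t in sequentially. norm (real t powr (b + 4) * nesterov_moment (b + 3/2) t - ?m t)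
       \<le> C * (real t powr (- b - 1) + K * real t powr (-\<kappa>) + real t powr (- 1/2))"
      using ev
    proof eventually_elim
      case (elim t)
      have p: "real t powr (b + 4) = real t powr (b + 1) * real t powr 3" unfolding powr_add[symmetric] by (simp add: add_ac)
      have "real t powr (b + 4) * nesterov_moment (b + 3/2) t - ?m t = real t powr (b + 1) *
        (real t powr 3 * nesterov_moment (b + 3/2) t - 16 / pi ^ 2 * (Beta (real t) (3/2) * real t powr (3/2)) ^ 2 * truncated_Beta b t)"
        unfolding p by (simp add: algebra_simps)
      also have "norm \<dots> \<le> real t powr (b + 1) * (C * (real t powr (-2 * b - 2) + truncated_Beta (b - 1/2) t / real t + real t powr (- b - 3/2)))"
        unfolding norm_mult using C(2)[OF elim] by (intro mult_mono) auto
      also have "\<dots> \<le> real t powr (b + 1) * (C * (real t powr (-2 * b - 2) + K * real t powr (-\<kappa> - b) / real t + real t powr (- b - 3/2)))"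
        using C(1) K(3)[OF elim] elim by (intro mult_left_mono add_mono divide_right_mono) auto
      also have "K * real t powr (-\<kappa> - b) / real t = K * real t powr (-\<kappa> - b - 1)"
        using elim by (simp add: powr_diff)
      also have "real t powr (b + 1) * (C * (real t powr (-2 * b - 2) + K * real t powr (-\<kappa> - b - 1) + real t powr (- b - 3/2)))
        = C * (real t powr (b + 1) * real t powr (-2 * b - 2) + K * (real t powr (b + 1) * real t powr (-\<kappa> - b - 1)) + real t powr (b + 1) * real t powr (- b - 3/2))"
        by (simp add: algebra_simps)
      also have "real t powr (b + 1) * real t powr (-2 * b - 2) = real t powr (- b - 1)"
        unfolding powr_add[symmetric] by (rule arg_cong[where f = "(powr) (real t)"]) simp
      also have "real t powr (b + 1) * real t powr (-\<kappa> - b - 1) = real t powr (-\<kappa>)"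
        unfolding powr_add[symmetric] by (rule arg_cong[where f = "(powr) (real t)"]) simp
      also have "real t powr (b + 1) * real t powr (- b - 3/2) = real t powr (- 1/2)"
        unfolding powr_add[symmetric] by (rule arg_cong[where f = "(powr) (real t)"]) simp
      finally show ?case .
    qed
  qed
  have "?m \<longlonglongrightarrow> 16 / pi ^ 2 * Gamma (3/2) ^ 2 * Gamma (b + 1)"
    by (intro tendsto_mult[OF Beta_three_halves_sq_asymp tB])
  from tendsto_add[OF this err] show ?thesis by simp
qed

text \<open>The logarithm is the integral of 1/x over [t^-2, t^-1]. There (1 - x)^(t+1) lies between
  1 - (t + 1) x and 1, which costs at most 2, and the range above 1/t contributes at most 1.\<close>

lemma truncated_Beta_minus_one_asymp: "(\<lambda>t. truncated_Beta (-1) t / ln (real t)) \<longlonglongrightarrow> 1"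
proof (rule tendsto_sandwich)
  have ev: "eventually (\<lambda>t::nat. t \<ge> 2) sequentially" by (rule eventually_ge_at_top)
  show "(\<lambda>t. (ln (real t) - 2) / ln (real t)) \<longlonglongrightarrow> 1" by real_asymp
  show "(\<lambda>t. (ln (real t) + 1) / ln (real t)) \<longlonglongrightarrow> 1" by real_asymp
  have bounds: "ln (real t) - 2 \<le> truncated_Beta (-1) t \<and> truncated_Beta (-1) t \<le> ln (real t) + 1" if t: "t \<ge> 2" for t
  proof -
    define a where "a = 1 / real t ^ 2"
    define c where "c = 1 / real t"
    have ac: "0 < a" "a \<le> c" "c \<le> 1" using t by (auto simp: a_def c_def field_simps power2_eq_square)
    let ?f = "\<lambda>x::real. x powr (-1) * (1 - x) ^ (t + 1)"
    have i: "?f integrable_on {a..1}"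
      using has_integral_integrable[OF truncated_Beta_has_integral, of t "-1"] t by (simp add: a_def)
    have i1: "?f integrable_on {a..c}" and i2: "?f integrable_on {c..1}"
      by (rule integrable_subinterval_real[OF i]; use ac in auto)+
    have split: "truncated_Beta (-1) t = integral {a..c} ?f + integral {c..1} ?f"
      using Henstock_Kurzweil_Integration.integral_combine[of a c 1 ?f] ac i unfolding truncated_Beta_def a_def by auto
    have l: "ln c - ln a = ln (real t)" using t by (simp add: a_def c_def ln_div ln_realpow)
    have inv: "((\<lambda>x. 1 / x) has_integral ln (real t)) {a..c}"
    proof -
      have "((\<lambda>x. 1 / x) has_integral ln c - ln a) {a..c}"
        using ac by (intro fundamental_theorem_of_calculus)
          (auto intro!: derivative_eq_intros simp flip: has_real_derivative_iff_has_vector_derivative)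
      thus ?thesis by (simp only: l)
    qed
    have u1: "integral {a..c} ?f \<le> ln (real t)"
    proof (rule has_integral_le[OF integrable_integral[OF i1] inv])
      fix x assume x: "x \<in> {a..c}"
      have "(1 - x) ^ (t + 1) \<le> 1" using x ac by (intro power_le_one) auto
      thus "?f x \<le> 1 / x" using x ac by (simp add: powr_minus_divide divide_right_mono)
    qed
    have u2: "integral {c..1} ?f \<le> 1"
    proof -
      have full: "((\<lambda>x. x powr 0 * (1 - x) ^ (t + 1)) has_integral Beta (real (t + 2)) 1) {0..1}"
        using powr_power_has_integral_Beta[of 0 "t + 1"] by (simp add: add_ac)
      have Be: "Beta (real (t + 2)) 1 = 1 / real (t + 2)"
      proof -
        have g: "Gamma (real (t + 2)) \<noteq> 0" using Gamma_real_pos[of "real (t + 2)"] by linarith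
        have "Gamma (real (t + 2) + 1) = real (t + 2) * Gamma (real (t + 2))"
          by (rule Gamma_plus1) (auto simp: nonpos_Ints_def)
        thus ?thesis using g unfolding Beta_def by simp
      qed
      have i3: "(\<lambda>x. x powr 0 * (1 - x) ^ (t + 1)) integrable_on {c..1}"
        by (rule integrable_subinterval_real[OF has_integral_integrable[OF full]]) (use ac in auto)
      \<comment> \<open>On [1/t, 1] the factor 1/x is at most t, and t Beta(t + 2, 1) = t / (t +
        2).\<close>
      have "integral {c..1} ?f \<le> integral {c..1} (\<lambda>x. real t * (x powr 0 * (1 - x) ^ (t + 1)))"
      proof (rule integral_le[OF i2 integrable_on_mult_right[OF i3]])
        fix x assume x: "x \<in> {c..1}"
        have "x powr (-1) \<le> c powr (-1)" using x ac by (intro powr_mono2') auto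
        also have "c powr (-1) = real t" using t by (simp add: c_def powr_minus_divide)
        finally have "?f x \<le> real t * (1 - x) ^ (t + 1)" by (rule mult_right_mono) (use x in auto)
        thus "?f x \<le> real t * (x powr 0 * (1 - x) ^ (t + 1))" using x ac by simp
      qed
      also have "\<dots> = real t * integral {c..1} (\<lambda>x. x powr 0 * (1 - x) ^ (t + 1))" by simp
      also have "integral {c..1} (\<lambda>x. x powr 0 * (1 - x) ^ (t + 1)) \<le> integral {0..1} (\<lambda>x. x powr 0 * (1 - x) ^ (t + 1))"
        using ac i3 has_integral_integrable[OF full] by (intro integral_subset_le) auto
      also have "real t * integral {0..1} (\<lambda>x. x powr 0 * (1 - x) ^ (t + 1)) \<le> 1"
        unfolding integral_unique[OF full] Be by simp
      finally show ?thesis by (simp add: mult_left_mono)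
    qed
    have l1: "ln (real t) - 2 \<le> integral {a..c} ?f"
    proof -
      have lo: "((\<lambda>x. 1 / x - (real t + 1)) has_integral ln (real t) - (c - a) *\<^sub>R (real t + 1)) {a..c}"
        using ac has_integral_const_real[of "real t + 1" a c] by (intro has_integral_diff inv) auto
      have "ln (real t) - (c - a) *\<^sub>R (real t + 1) \<le> integral {a..c} ?f"
      proof (rule has_integral_le[OF lo integrable_integral[OF i1]])
        fix x assume x: "x \<in> {a..c}"
        have "1 - real (t + 1) * x \<le> (1 - x) ^ (t + 1)"
          using Bernoulli_inequality[of "-x" "t + 1"] x ac by simp
        hence "(1 - real (t + 1) * x) / x \<le> (1 - x) ^ (t + 1) / x" using x ac by (intro divide_right_mono) auto
        thus "1 / x - (real t + 1) \<le> ?f x" using x ac by (simp add: powr_minus_divide diff_divide_distrib)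
      qed
      moreover have "(c - a) * (real t + 1) \<le> c * (real t + 1)" using ac by (intro mult_right_mono) auto
      moreover have "c * (real t + 1) \<le> 2" using t by (simp add: c_def field_simps)
      ultimately show ?thesis unfolding real_scaleR_def by linarith
    qed
    have l2: "0 \<le> integral {c..1} ?f" using ac by (intro integral_nonneg i2) auto
    show ?thesis using split u1 u2 l1 l2 by linarith
  qed
  show "\<forall>\<^sub>F t in sequentially. (ln (real t) - 2) / ln (real t) \<le> truncated_Beta (-1) t / ln (real t)"
    using ev by eventually_elim (use bounds in \<open>auto intro!: divide_right_mono\<close>)
  show "\<forall>\<^sub>F t in sequentially. truncated_Beta (-1) t / ln (real t) \<le> (ln (real t) + 1) / ln (real t)"
    using ev by eventually_elim (use bounds in \<open>auto intro!: divide_right_mono\<close>)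
qed

lemma truncated_Beta_minus_three_halves_le:
  assumes "t > 0"
  shows "truncated_Beta (-3/2) t \<le> 2 * real t"
proof -
  define a where "a = 1 / real t ^ 2"
  have a: "0 < a" "a \<le> 1" using assms by (auto simp: a_def)
  have "((\<lambda>x::real. x powr (-3/2)) has_integral (-2 * 1 powr (-1/2)) - (-2 * a powr (-1/2))) {a..1}"
    using a by (intro fundamental_theorem_of_calculus)
      (auto intro!: derivative_eq_intros simp flip: has_real_derivative_iff_has_vector_derivative)
  moreover have "a powr (-1/2) = real t powr (-2 * (-1/2))" using assms inverse_square_powr[of "real t" "-1/2"] by (simp add: a_def)
  ultimately have p: "((\<lambda>x::real. x powr (-3/2)) has_integral 2 * real t - 2) {a..1}" using assms by simp
  have "truncated_Beta (-3/2) t \<le> 2 * real t - 2"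
  proof (rule has_integral_le[OF truncated_Beta_has_integral[OF assms] p[unfolded a_def]])
    fix x assume "x \<in> {1 / real t ^ 2..1}"
    hence x: "0 \<le> x" "x \<le> 1" using a order.trans[of 0 "1 / real t ^ 2" x] by (auto simp: a_def)
    have "x powr (-3/2) * (1 - x) ^ (t + 1) \<le> x powr (-3/2) * 1" using x by (intro mult_left_mono power_le_one) auto
    thus "x powr (-3/2) * (1 - x) ^ (t + 1) \<le> x powr (-3/2)" by simp
  qed
  thus ?thesis by simp
qed

text \<open>At b = -1 all errors of \<open>nesterov_moment_approx\<close> stay bounded, while the
  main term grows like ln t.\<close>

lemma nesterov_moment_asymp_critical:
  "(\<lambda>t. real t powr 3 / ln (real t) * nesterov_moment (1/2) t) \<longlonglongrightarrow> 16 / pi ^ 2 * Gamma (3/2) ^ 2"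
proof -
  obtain C where C: "C > 0" "\<And>t. t > 0 \<Longrightarrow>
    \<bar>real t powr 3 * nesterov_moment (1/2) t - 16 / pi ^ 2 * (Beta (real t) (3/2) * real t powr (3/2)) ^ 2 * truncated_Beta (-1) t\<bar>
      \<le> C * (1 + truncated_Beta (-3/2) t / real t + real t powr (-1/2))"
    using nesterov_moment_approx[of "-1"] by (auto split: if_splits)
  let ?m = "\<lambda>t. 16 / pi ^ 2 * (Beta (real t) (3/2) * real t powr (3/2)) ^ 2 * (truncated_Beta (-1) t / ln (real t))"
  have err: "(\<lambda>t. real t powr 3 / ln (real t) * nesterov_moment (1/2) t - ?m t) \<longlonglongrightarrow> 0"
  proof (rule Lim_null_comparison)
    have "(\<lambda>t. C * 4 * (1 / ln (real t))) \<longlonglongrightarrow> C * 4 * 0" by (intro tendsto_mult tendsto_const) real_asymp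
    thus "(\<lambda>t. C * 4 * (1 / ln (real t))) \<longlonglongrightarrow> 0" by simp
    show "\<forall>\<^sub>F t in sequentially. norm (real t powr 3 / ln (real t) * nesterov_moment (1/2) t - ?m t) \<le> C * 4 * (1 / ln (real t))"
      using eventually_ge_at_top[of 2]
    proof eventually_elim
      case (elim t)
      have ln: "ln (real t) > 0" using elim by simp
      have "real t powr 3 / ln (real t) * nesterov_moment (1/2) t - ?m t =
         (real t powr 3 * nesterov_moment (1/2) t - 16 / pi ^ 2 * (Beta (real t) (3/2) * real t powr (3/2)) ^ 2 * truncated_Beta (-1) t) / ln (real t)"
        by (simp add: diff_divide_distrib)
      also have "norm \<dots> \<le> (C * (1 + truncated_Beta (-3/2) t / real t + real t powr (-1/2))) / ln (real t)"
        using C(2)[of t] elim ln by (simp add: divide_right_mono)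
      also have "\<dots> \<le> (C * (1 + 2 + 1)) / ln (real t)"
      proof (intro divide_right_mono mult_left_mono add_mono)
        show "truncated_Beta (-3/2) t / real t \<le> 2" using truncated_Beta_minus_three_halves_le[of t] elim by (simp add: field_simps)
        show "real t powr (-1/2) \<le> 1" using elim powr_mono[of "-1/2" 0 "real t"] by simp
      qed (use C ln in auto)
      finally show ?case by simp
    qed
  qed
  have "?m \<longlonglongrightarrow> 16 / pi ^ 2 * Gamma (3/2) ^ 2 * 1"
    by (intro tendsto_mult[OF Beta_three_halves_sq_asymp truncated_Beta_minus_one_asymp])
  from tendsto_add[OF this err] show ?thesis by simp
qed

section \<open>The limit on the scale x = u / t^2\<close>

lemma csqrt_scale:
  assumes "c > 0"
  shows "csqrt (of_real c * z) = of_real (sqrt c) * csqrt z"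
proof (rule csqrt_unique)
  show "(of_real (sqrt c) * csqrt z) ^ 2 = of_real c * z"
    using assms by (simp add: power_mult_distrib flip: of_real_power)
  have "0 < Re (csqrt z) \<or> Re (csqrt z) = 0 \<and> 0 \<le> Im (csqrt z)" by (rule csqrt_principal)
  thus "0 < Re (of_real (sqrt c) * csqrt z) \<or> Re (of_real (sqrt c) * csqrt z) = 0 \<and> 0 \<le> Im (of_real (sqrt c) * csqrt z)"
    using assms by (auto simp del: csqrt.simps)
qed

text \<open>The substitution r = 1 - v/t takes a factor 1 / sqrt t out of each of the two roots.
  What remains converges as soon as t (1 - cis (2 theta)) does, that is, when theta is of order
  1/t.\<close>

lemma legendre_root_rescaled:
  assumes t: "t > 0" and v: "0 \<le> v"
  shows "of_real t * legendre_root \<theta> (1 - of_real (v / t)) =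
     of_real (sqrt v) * csqrt (of_real t * (1 - cis (2 * \<theta>)) + of_real v * cis (2 * \<theta>))"
proof -
  have "1 - (1 - complex_of_real (v / t)) = of_real (1 / t) * of_real v" by simp
  hence a: "csqrt (1 - (1 - complex_of_real (v / t))) = of_real (sqrt (1 / t)) * of_real (sqrt v)"
    using csqrt_scale[of "1 / t" "of_real v"] t v by simp
  have "1 - (1 - complex_of_real (v / t)) * cis (2 * \<theta>) =
     of_real (1 / t) * (of_real t * (1 - cis (2 * \<theta>)) + of_real v * cis (2 * \<theta>))"
    using t by (simp add: field_simps)
  hence b: "csqrt (1 - (1 - complex_of_real (v / t)) * cis (2 * \<theta>)) =
     of_real (sqrt (1 / t)) * csqrt (of_real t * (1 - cis (2 * \<theta>)) + of_real v * cis (2 * \<theta>))"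
    using csqrt_scale[of "1 / t"] t by simp
  have "of_real t * (of_real (sqrt (1 / t)) * of_real (sqrt (1 / t))) = complex_of_real (t * (sqrt (1 / t) * sqrt (1 / t)))"
    by (simp only: of_real_mult)
  also have "t * (sqrt (1 / t) * sqrt (1 / t)) = 1" using t by (simp only: real_sqrt_mult_self) simp
  finally have c: "of_real t * (of_real (sqrt (1 / t)) * of_real (sqrt (1 / t))) = (1 :: complex)" by simp
  have "of_real t * legendre_root \<theta> (1 - of_real (v / t)) = (of_real t * (of_real (sqrt (1 / t)) * of_real (sqrt (1 / t)))) *
     (of_real (sqrt v) * csqrt (of_real t * (1 - cis (2 * \<theta>)) + of_real v * cis (2 * \<theta>)))"
    unfolding legendre_root_def a b by (simp only: mult_ac)
  thus ?thesis unfolding c by simp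
qed

text \<open>In t^2 one factor t comes from dr = dv / t and one from the two roots; the conjugated
  power removes the constant phase of w^n dw along the ray.\<close>

lemma legendre_int_rescaled:
  fixes n :: nat
  assumes \<theta>: "0 < \<theta>" "\<theta> < pi / 2"
  defines "t \<equiv> real (Suc n)"
  shows "((\<lambda>v. of_real ((1 - v / t) ^ n) * (of_real (sqrt v) * csqrt (of_real t * (1 - cis (2 * \<theta>)) + of_real v * cis (2 * \<theta>))))
     has_integral cnj (cis \<theta> ^ Suc n) * of_real (t ^ 2) * legendre_int \<theta> n) {0..t}"
proof -
  have t: "t > 0" by (simp add: t_def)
  let ?f = "\<lambda>r. of_real (r ^ n) * legendre_root \<theta> (of_real r)"
  have a1: "((\<lambda>r. cnj (cis \<theta> ^ Suc n) * (cis \<theta> * (of_real r * cis \<theta>) ^ n * legendre_root \<theta> (of_real r))) has_integral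
     cnj (cis \<theta> ^ Suc n) * legendre_int \<theta> n) {0..1}"
    by (intro has_integral_mult_right legendre_int_has_integral \<theta>)
  have a2: "cnj (cis \<theta> ^ Suc n) * (cis \<theta> * (of_real r * cis \<theta>) ^ n * legendre_root \<theta> (of_real r)) = ?f r" for r
  proof -
    have "cnj (cis \<theta> ^ Suc n) * cis \<theta> ^ Suc n = 1"
      by (simp add: Complex.DeMoivre cis_cnj cis_mult flip: power_Suc)
    moreover have "cnj (cis \<theta> ^ Suc n) * (cis \<theta> * (of_real r * cis \<theta>) ^ n * legendre_root \<theta> (of_real r)) =
      (cnj (cis \<theta> ^ Suc n) * cis \<theta> ^ Suc n) * ?f r" by (simp add: power_mult_distrib mult_ac)
    ultimately show ?thesis by simp
  qed
  have f: "(?f has_integral cnj (cis \<theta> ^ Suc n) * legendre_int \<theta> n) {0..1}" using a1 unfolding a2 .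
  have "((\<lambda>v. ?f ((-1 / t) *\<^sub>R v + 1)) has_integral (1 / \<bar>-1 / t\<bar>) *\<^sub>R (cnj (cis \<theta> ^ Suc n) * legendre_int \<theta> n))
      ((\<lambda>x. (1 / (-1/t)) *\<^sub>R x + -((1 / (-1/t)) *\<^sub>R 1)) ` {0..1})"
    using has_integral_affinity[of ?f _ 0 1 "-1/t" 1] f t by simp
  moreover have "((\<lambda>x. (1 / (-1/t)) *\<^sub>R x + -((1 / (-1/t)) *\<^sub>R 1)) ` {0..1}) = {0..t}"
  proof -
    have "(\<lambda>x::real. (1 / (-1/t)) *\<^sub>R x + -((1 / (-1/t)) *\<^sub>R 1)) = (\<lambda>x. (-t) * x + t)" by (simp add: fun_eq_iff)
    thus ?thesis using t image_affinity_atLeastAtMost[of "-t" t 0 1] by simp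
  qed
  ultimately have "((\<lambda>v. of_real t * ?f (1 - v / t)) has_integral of_real t * (t *\<^sub>R (cnj (cis \<theta> ^ Suc n) * legendre_int \<theta> n))) {0..t}"
    using t by (intro has_integral_mult_right) simp
  hence "((\<lambda>v. of_real t * ?f (1 - v / t)) has_integral cnj (cis \<theta> ^ Suc n) * of_real (t ^ 2) * legendre_int \<theta> n) {0..t}"
    by (simp add: scaleR_conv_of_real power2_eq_square mult_ac)
  thus ?thesis
  proof (rule has_integral_eq[rotated])
    fix v assume "v \<in> {0..t}"
    hence v: "0 \<le> v" by simp
    have "of_real t * ?f (1 - v / t) = of_real ((1 - v / t) ^ n) * (of_real t * legendre_root \<theta> (1 - of_real (v / t)))"
      by simp
    thus "of_real t * ?f (1 - v / t) = of_real ((1 - v / t) ^ n) * (of_real (sqrt v) * csqrt (of_real t * (1 - cis (2 * \<theta>)) + of_real v * cis (2 * \<theta>)))"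
      unfolding legendre_root_rescaled[OF t v] .
  qed
qed

text \<open>The dominating function for the next limit; v <= 4 exp (v/4) reduces it to a plain
  exponential.\<close>

lemma exp_linear_integrable: "(\<lambda>v. (v + c) * exp (- v / 2)) integrable_on {0::real..}"
proof -
  have "(\<lambda>v. exp (-(1/4) * v)) integrable_on {0::real..}"
    using has_integral_exp_minus_to_infinity[of "1/4" 0] by auto
  hence i: "(\<lambda>v. (4 + \<bar>c\<bar>) * exp (-(1/4) * v)) integrable_on {0::real..}" by (rule integrable_on_mult_right)
  show ?thesis
  proof (rule measurable_bounded_by_integrable_imp_integrable[OF _ i])
    show "(\<lambda>v. (v + c) * exp (- v / 2)) \<in> borel_measurable (lebesgue_on {0..})"
      by (intro continuous_imp_measurable_on_sets_lebesgue continuous_intros) auto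
    fix v :: real assume "v \<in> {0..}"
    hence v: "v \<ge> 0" by simp
    have "1 + v / 4 \<le> exp (v / 4)" by (rule exp_ge_add_one_self)
    hence "v \<le> 4 * exp (v / 4)" by linarith
    hence "v * exp (- v / 4) \<le> 4 * exp (v/4) * exp (- v / 4)" by (rule mult_right_mono) simp
    moreover have "exp (v / 4) * exp (- v / 4) = 1" by (simp flip: exp_add)
    ultimately have v4: "v * exp (- v / 4) \<le> 4" by (simp only: mult.assoc mult_1_right)
    have "exp (- v / 2) = exp (- v / 4) * exp (- v / 4)" by (simp flip: exp_add)
    hence "(v + \<bar>c\<bar>) * exp (- v / 2) = (v * exp (- v / 4) + \<bar>c\<bar> * exp (- v / 4)) * exp (- v / 4)"
      by (simp only: distrib_right mult.assoc)
    also have "\<dots> \<le> (4 + \<bar>c\<bar> * 1) * exp (- v / 4)" using v v4 by (intro mult_right_mono add_mono mult_left_mono) auto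
    finally have "(v + \<bar>c\<bar>) * exp (- v / 2) \<le> (4 + \<bar>c\<bar>) * exp (-(1/4) * v)" by simp
    moreover have "\<bar>v + c\<bar> * exp (- v / 2) \<le> (v + \<bar>c\<bar>) * exp (- v / 2)" using v by (intro mult_right_mono) auto
    ultimately show "norm ((v + c) * exp (- v / 2)) \<le> (4 + \<bar>c\<bar>) * exp (-(1/4) * v)"
      by (simp only: real_norm_def abs_mult abs_exp_cancel)
  qed auto
qed

text \<open>A limit of Mehler-Heine type; its value is 2 J_1(sqrt u) / sqrt u with the Bessel
  function J_1. At x = u / t^2 the angle is asymptotic to sqrt u / t, the factor t^2 in 4 / (pi x)
  is absorbed by the rescaled integral, and that integral converges by domination.\<close>

lemma nesterov_residual_pointwise_limit:
  assumes u: "u > 0"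
  shows "convergent (\<lambda>t. nesterov_residual (u / real t ^ 2) t)"
proof -
  define \<theta> where "\<theta> = (\<lambda>n. nesterov_angle (u / real (Suc n) ^ 2))"
  define s where "s = sqrt u"
  have s: "s > 0" "s ^ 2 = u" using u by (auto simp: s_def)
  define F where "F = (\<lambda>n v. if v \<le> real (Suc n) then of_real ((1 - v / real (Suc n)) ^ n) * (of_real (sqrt v) *
     csqrt (of_real (real (Suc n)) * (1 - cis (2 * \<theta> n)) + of_real v * cis (2 * \<theta> n))) else 0)"
  define G where "G = (\<lambda>v. of_real (exp (- v)) * (of_real (sqrt v) * csqrt (- 2 * \<i> * of_real s + of_real v)))"
  have th_eq: "\<theta> n = arcsin (s / real (Suc n))" for n
    by (simp add: \<theta>_def nesterov_angle_def s_def real_sqrt_divide)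
  have th0: "\<theta> \<longlonglongrightarrow> 0"
  proof -
    have "(\<lambda>n. arcsin (s / real (Suc n))) \<longlonglongrightarrow> arcsin 0"
      by (intro isCont_tendsto_compose[where g = arcsin] isCont_arcsin) (simp, simp, real_asymp)
    thus ?thesis unfolding th_eq by simp
  qed
  have tth: "(\<lambda>n. real (Suc n) * \<theta> n) \<longlonglongrightarrow> s"
  proof -
    have "((\<lambda>h. (arcsin (0 + h) - arcsin 0) / h) \<longlongrightarrow> inverse (sqrt (1 - 0\<^sup>2))) (at 0)"
      using DERIV_arcsin[of 0] unfolding DERIV_def by simp
    moreover have "filterlim (\<lambda>n. s / real (Suc n)) (at 0) sequentially"
    proof -
      have "(\<lambda>n. s / real (Suc n)) \<longlonglongrightarrow> 0" by real_asymp
      thus ?thesis using s by (intro filterlim_atI) auto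
    qed
    ultimately have "(\<lambda>n. (arcsin (0 + s / real (Suc n)) - arcsin 0) / (s / real (Suc n))) \<longlonglongrightarrow> inverse (sqrt (1 - 0\<^sup>2))"
      by (rule filterlim_compose)
    from tendsto_mult_left[OF this, of s] show ?thesis unfolding th_eq using s by (simp add: mult.commute del: of_nat_Suc)
  qed
  have ev: "eventually (\<lambda>n. u / real (Suc n) ^ 2 < 1 \<and> n \<ge> 2) sequentially"
  proof -
    have "(\<lambda>n. u / real (Suc n) ^ 2) \<longlonglongrightarrow> 0" by real_asymp
    hence "eventually (\<lambda>n. u / real (Suc n) ^ 2 < 1) sequentially" by (rule order_tendstoD) simp
    thus ?thesis using eventually_ge_at_top[of 2] by eventually_elim simp
  qed
  then obtain N where N: "\<And>n. n \<ge> N \<Longrightarrow> u / real (Suc n) ^ 2 < 1 \<and> n \<ge> 2"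
    by (auto simp: eventually_sequentially)
  \<comment> \<open>t sin theta = sqrt u holds exactly, so 1 - e^(2 i theta) = -2 i sin theta e^(i
    theta) leaves the dependence on t in a unimodular factor.\<close>
  have key: "of_real (real (Suc n)) * (1 - cis (2 * \<theta> n)) = - 2 * \<i> * of_real s * cis (\<theta> n)"
    and ang: "0 < \<theta> n" "\<theta> n < pi / 2" "sin (\<theta> n) ^ 2 = u / real (Suc n) ^ 2" if n: "n \<ge> N" for n
  proof -
    have x: "0 < u / real (Suc n) ^ 2" "u / real (Suc n) ^ 2 < 1" using N[OF n] u by auto
    have th: "\<theta> n = nesterov_angle (u / real (Suc n) ^ 2)" by (simp add: \<theta>_def)
    note A = nesterov_angle[OF x, folded th]
    show "0 < \<theta> n" "\<theta> n < pi / 2" by (fact A)+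
    show "sin (\<theta> n) ^ 2 = u / real (Suc n) ^ 2" unfolding A using x by simp
    have sn: "real (Suc n) * sin (\<theta> n) = s"
      unfolding A by (simp add: s_def real_sqrt_divide)
    have "of_real (real (Suc n)) * (1 - cis (2 * \<theta> n)) = - 2 * \<i> * of_real (real (Suc n) * sin (\<theta> n)) * cis (\<theta> n)"
      by (simp add: complex_eq_iff cos_double_sin sin_double power2_eq_square)
    thus "of_real (real (Suc n)) * (1 - cis (2 * \<theta> n)) = - 2 * \<i> * of_real s * cis (\<theta> n)" unfolding sn .
  qed
  have Fint: "(F n has_integral cnj (cis (\<theta> n) ^ Suc n) * of_real (real (Suc n) ^ 2) * legendre_int (\<theta> n) n) {0..}" if n: "n \<ge> N" for n
  proof -
    have "(\<lambda>v. if v \<in> {0..real (Suc n)} then of_real ((1 - v / real (Suc n)) ^ n) * (of_real (sqrt v) *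
       csqrt (of_real (real (Suc n)) * (1 - cis (2 * \<theta> n)) + of_real v * cis (2 * \<theta> n))) else 0) = (\<lambda>v. if v \<in> {0..} then F n v else 0)"
      by (auto simp: F_def fun_eq_iff)
    thus ?thesis using legendre_int_rescaled[OF ang(1,2)[OF n], of n]
      by (simp only: has_integral_restrict_UNIV[symmetric, of _ _ "{0..real (Suc n)}"] has_integral_restrict_UNIV[symmetric, of _ _ "{0..}"])
  qed
  have lim: "(\<lambda>n. integral {0..} (F (n + N))) \<longlonglongrightarrow> integral {0..} G"
  proof (rule dominated_convergence(2))
    show "F (n + N) integrable_on {0..}" for n using Fint[of "n + N"] by auto
    show "(\<lambda>v. (v + 2 * s) * exp (- v / 2)) integrable_on {0..}" by (rule exp_linear_integrable)
    fix v :: real assume "v \<in> {0..}"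
    hence v: "v \<ge> 0" by simp
    show "norm (F (n + N) v) \<le> (v + 2 * s) * exp (- v / 2)" for n
    proof (cases "v \<le> real (Suc (n + N))")
      case True
      let ?n = "n + N"
      have n2: "?n \<ge> 2" using N[of ?n] by auto
      \<comment> \<open>1 - y <= exp (-y) gives exp (-v n / (n + 1)), and n / (n + 1) >=
        1/2.\<close>
      have d: "(1 - v / real (Suc ?n)) ^ ?n \<le> exp (- v / 2)"
      proof -
        have "(1 - v / real (Suc ?n)) ^ ?n \<le> exp (- v / real (Suc ?n)) ^ ?n"
          using True exp_ge_add_one_self[of "- v / real (Suc ?n)"] by (intro power_mono) (auto simp: field_simps)
        also have "\<dots> = exp (real ?n * (- v / real (Suc ?n)))" by (rule exp_of_nat_mult[symmetric])
        also have "\<dots> \<le> exp (- v / 2)"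
        proof -
          have "v * 1 \<le> v * (2 * real ?n / real (Suc ?n))" using v n2 by (intro mult_left_mono) (auto simp: field_simps)
          thus ?thesis by (simp add: field_simps)
        qed
        finally show ?thesis .
      qed
      have "norm (csqrt (of_real (real (Suc ?n)) * (1 - cis (2 * \<theta> ?n)) + of_real v * cis (2 * \<theta> ?n))) =
          sqrt (norm (- 2 * \<i> * of_real s * cis (\<theta> ?n) + of_real v * cis (2 * \<theta> ?n)))"
        by (subst key) (auto simp: norm_csqrt)
      also have "\<dots> \<le> sqrt (2 * s + v)"
      proof (rule real_sqrt_le_mono)
        have "norm (- 2 * \<i> * of_real s * cis (\<theta> ?n) + of_real v * cis (2 * \<theta> ?n)) \<le> norm (- 2 * \<i> * of_real s * cis (\<theta> ?n)) + norm (of_real v * cis (2 * \<theta> ?n))"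
          by (rule norm_triangle_ineq)
        also have "\<dots> = 2 * s + v" using s v by (simp add: norm_mult)
        finally show "norm (- 2 * \<i> * of_real s * cis (\<theta> ?n) + of_real v * cis (2 * \<theta> ?n)) \<le> 2 * s + v" .
      qed
      finally have c: "norm (csqrt (of_real (real (Suc ?n)) * (1 - cis (2 * \<theta> ?n)) + of_real v * cis (2 * \<theta> ?n))) \<le> sqrt (2 * s + v)" .
      have "norm (F ?n v) = (1 - v / real (Suc ?n)) ^ ?n * (sqrt v *
          norm (csqrt (of_real (real (Suc ?n)) * (1 - cis (2 * \<theta> ?n)) + of_real v * cis (2 * \<theta> ?n))))"
      proof -
        have "(1 - v / real (Suc ?n)) ^ ?n \<ge> 0" using True by (intro zero_le_power) (simp add: field_simps)
        thus ?thesis unfolding F_def if_P[OF True] norm_mult norm_of_real using v by (simp only: abs_of_nonneg real_sqrt_ge_zero)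
      qed
      also have "\<dots> \<le> exp (- v / 2) * (sqrt (2 * s + v) * sqrt (2 * s + v))"
        using d c v s True by (intro mult_mono) (auto simp: field_simps)
      also have "\<dots> = (v + 2 * s) * exp (- v / 2)" using v s by simp
      finally show ?thesis .
    qed (use v s in \<open>auto simp: F_def\<close>)
    show "(\<lambda>n. F (n + N) v) \<longlonglongrightarrow> G v"
    proof (cases "v = 0")
      case True thus ?thesis by (simp add: F_def G_def)
    next
      case False
      with v have v0: "v > 0" by simp
      have cis0: "(\<lambda>n. cis (\<theta> n)) \<longlonglongrightarrow> 1" "(\<lambda>n. cis (2 * \<theta> n)) \<longlonglongrightarrow> 1"
        using tendsto_cis[OF th0] tendsto_cis[OF tendsto_mult_right_zero[OF th0, of 2]] by simp_all
      have "(\<lambda>n. - 2 * \<i> * of_real s * cis (\<theta> n) + of_real v * cis (2 * \<theta> n)) \<longlonglongrightarrow> - 2 * \<i> * of_real s * 1 + of_real v * 1"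
        by (intro tendsto_intros cis0)
      hence "(\<lambda>n. csqrt (- 2 * \<i> * of_real s * cis (\<theta> n) + of_real v * cis (2 * \<theta> n))) \<longlonglongrightarrow> csqrt (- 2 * \<i> * of_real s * 1 + of_real v * 1)"
        by (intro isCont_tendsto_compose[where g = csqrt] continuous_at_csqrt) (use v0 in \<open>auto simp: complex_nonpos_Reals_iff\<close>)
      moreover have "(\<lambda>n. (1 - v / real (Suc n)) ^ n) \<longlonglongrightarrow> exp (- v)"
      proof -
        \<comment> \<open>The exponential limit has exponent n + 1 for the denominator n + 1;
          dividing by one factor, which tends to 1, lowers it to n.\<close>
        have "(\<lambda>n. (1 + (- v) / real n) ^ n) \<longlonglongrightarrow> exp (- v)" by (rule tendsto_exp_limit_sequentially)
        hence "(\<lambda>n. (1 + (- v) / real (Suc n)) ^ Suc n) \<longlonglongrightarrow> exp (- v)" by (rule LIMSEQ_Suc)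
        moreover have "(\<lambda>n. 1 + (- v) / real (Suc n)) \<longlonglongrightarrow> 1" by real_asymp
        ultimately have "(\<lambda>n. (1 + (- v) / real (Suc n)) ^ Suc n / (1 + (- v) / real (Suc n))) \<longlonglongrightarrow> exp (- v) / 1"
          by (rule tendsto_divide) simp
        moreover have "eventually (\<lambda>n. (1 + (- v) / real (Suc n)) ^ Suc n / (1 + (- v) / real (Suc n)) = (1 - v / real (Suc n)) ^ n) sequentially"
        proof -
          have "eventually (\<lambda>n. real n > v) sequentially"
            using filterlim_real_sequentially by (auto simp: filterlim_at_top_dense)
          thus ?thesis
          proof eventually_elim
            case (elim n)
            hence "1 + (- v) / real (Suc n) \<noteq> 0" by (simp add: field_simps)
            thus ?case by simp
          qed
        qed
        ultimately show ?thesis using Lim_transform_eventually by fastforce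
      qed
      ultimately have "(\<lambda>n. of_real ((1 - v / real (Suc n)) ^ n) * (of_real (sqrt v) *
          csqrt (- 2 * \<i> * of_real s * cis (\<theta> n) + of_real v * cis (2 * \<theta> n)))) \<longlonglongrightarrow>
          of_real (exp (- v)) * (of_real (sqrt v) * csqrt (- 2 * \<i> * of_real s * 1 + of_real v * 1))"
        by (intro tendsto_mult tendsto_of_real tendsto_const)
      moreover have "eventually (\<lambda>n. of_real ((1 - v / real (Suc n)) ^ n) * (of_real (sqrt v) *
          csqrt (- 2 * \<i> * of_real s * cis (\<theta> n) + of_real v * cis (2 * \<theta> n))) = F n v) sequentially"
      proof -
        have "eventually (\<lambda>n. real n > v) sequentially"
          using filterlim_real_sequentially by (auto simp: filterlim_at_top_dense)
        thus ?thesis using eventually_ge_at_top[of N]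
          by eventually_elim (simp only: F_def key, simp)
      qed
      ultimately have "(\<lambda>n. F n v) \<longlonglongrightarrow> G v" unfolding G_def
        using Lim_transform_eventually by fastforce
      thus ?thesis by (rule LIMSEQ_ignore_initial_segment)
    qed
  qed
  have res: "nesterov_residual (u / real (Suc n) ^ 2) (Suc n) =
      4 / (pi * u) * cos (\<theta> n) ^ (n + 2) * Im (cis (\<theta> n) ^ Suc n * integral {0..} (F n))" if n: "n \<ge> N" for n
  proof -
    have c: "cis (\<theta> n) ^ Suc n * cnj (cis (\<theta> n) ^ Suc n) = 1"
      by (simp add: Complex.DeMoivre cis_cnj cis_mult flip: power_Suc)
    have "cis (\<theta> n) ^ Suc n * integral {0..} (F n) =
       (cis (\<theta> n) ^ Suc n * cnj (cis (\<theta> n) ^ Suc n)) * (of_real (real (Suc n) ^ 2) * legendre_int (\<theta> n) n)"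
      unfolding integral_unique[OF Fint[OF n]] by (simp only: mult.assoc)
    hence I: "Im (cis (\<theta> n) ^ Suc n * integral {0..} (F n)) = real (Suc n) ^ 2 * Im (legendre_int (\<theta> n) n)"
      unfolding c by (simp del: of_nat_Suc of_real_power)
    show ?thesis unfolding I using nesterov_residual_eq_Im[OF ang(1,2)[OF n], of n] u
      unfolding ang(3)[OF n] by simp
  qed
  have "(\<lambda>n. cos (\<theta> n) ^ (n + 2)) \<longlonglongrightarrow> 1"
  proof (rule tendsto_sandwich)
    show "(\<lambda>n. 1 - real (n + 2) * (u / real (Suc n) ^ 2)) \<longlonglongrightarrow> 1" by real_asymp
    show "\<forall>\<^sub>F n in sequentially. 1 - real (n + 2) * (u / real (Suc n) ^ 2) \<le> cos (\<theta> n) ^ (n + 2)"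
      using eventually_ge_at_top[of N]
    proof eventually_elim
      case (elim n)
      have c0: "0 \<le> cos (\<theta> n)" "cos (\<theta> n) \<le> 1" using ang(1,2)[OF elim] by (auto intro!: cos_ge_zero)
      have x: "u / real (Suc n) ^ 2 \<le> 1" using N[OF elim] by auto
      \<comment> \<open>The cosine dominates its square 1 - x, and Bernoulli's inequality then loses
        only (n + 2) x, which is of order 1/n.\<close>
      have "1 - u / real (Suc n) ^ 2 = cos (\<theta> n) ^ 2" using ang(3)[OF elim] by (simp add: cos_squared_eq)
      also have "\<dots> \<le> cos (\<theta> n)" unfolding power2_eq_square using mult_left_le[OF c0(2,1)] .
      finally have "(1 - u / real (Suc n) ^ 2) ^ (n + 2) \<le> cos (\<theta> n) ^ (n + 2)" using x by (intro power_mono) auto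
      moreover have "1 + real (n + 2) * (- (u / real (Suc n) ^ 2)) \<le> (1 + (- (u / real (Suc n) ^ 2))) ^ (n + 2)"
        using x by (intro Bernoulli_inequality) auto
      ultimately show ?case by simp
    qed
    show "\<forall>\<^sub>F n in sequentially. cos (\<theta> n) ^ (n + 2) \<le> 1"
      using eventually_ge_at_top[of N]
    proof eventually_elim
      case (elim n)
      have c0: "0 \<le> cos (\<theta> n)" "cos (\<theta> n) \<le> 1" using ang(1,2)[OF elim] by (auto intro!: cos_ge_zero)
      thus ?case by (intro power_le_one)
    qed
  qed auto
  moreover have "(\<lambda>n. cis (\<theta> n) ^ Suc n) \<longlonglongrightarrow> cis s"
    unfolding Complex.DeMoivre by (intro tendsto_cis tth)
  moreover have "(\<lambda>n. integral {0..} (F n)) \<longlonglongrightarrow> integral {0..} G" using lim by (rule LIMSEQ_offset)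
  ultimately have "(\<lambda>n. 4 / (pi * u) * cos (\<theta> n) ^ (n + 2) * Im (cis (\<theta> n) ^ Suc n * integral {0..} (F n))) \<longlonglongrightarrow>
      4 / (pi * u) * 1 * Im (cis s * integral {0..} G)"
    by (intro tendsto_mult tendsto_const tendsto_Im)
  moreover have "eventually (\<lambda>n. 4 / (pi * u) * cos (\<theta> n) ^ (n + 2) * Im (cis (\<theta> n) ^ Suc n * integral {0..} (F n)) =
      nesterov_residual (u / real (Suc n) ^ 2) (Suc n)) sequentially"
    using eventually_ge_at_top[of N] by eventually_elim (simp only: res)
  ultimately have "(\<lambda>n. nesterov_residual (u / real (Suc n) ^ 2) (Suc n)) \<longlonglongrightarrow> 4 / (pi * u) * 1 * Im (cis s * integral {0..} G)"
    by (rule Lim_transform_eventually)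
  hence "(\<lambda>n. nesterov_residual (u / real n ^ 2) n) \<longlonglongrightarrow> 4 / (pi * u) * 1 * Im (cis s * integral {0..} G)"
    by (rule filterlim_sequentially_Suc[THEN iffD1])
  thus ?thesis by (rule convergentI)
qed

text \<open>With x = u / t^2 the scaled moment is the integral of u^rho times the squared residual
  at u / t^2 over [0, t^2]. It is dominated by 4 u^rho below 1 and by C u^(rho - 3/2) above 1, which
  are integrable there exactly for -1 < rho < 1/2. The limit is positive since by
  \<open>nesterov_residual_near_one\<close> the limit function is at least 1/2 on (0, 1/2].\<close>

lemma nesterov_moment_asymp_small:
  assumes \<rho>: "-1 < \<rho>" "\<rho> < 1/2"
  obtains K where "K > 0" "(\<lambda>t. real t powr (2 * \<rho> + 2) * nesterov_moment \<rho> t) \<longlonglongrightarrow> K"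
proof -
  obtain C where C: "C > 0"
    "\<And>x t. 0 < x \<Longrightarrow> x < 1 \<Longrightarrow> t > 0 \<Longrightarrow> real t ^ 2 * x \<ge> 1 \<Longrightarrow>
       nesterov_residual x t ^ 2 \<le> C * real t powr (-3) * x powr (-3/2) * (1 - x) ^ (t + 1)"
    using nesterov_residual_sq_bounds by metis
  define \<phi> where "\<phi> = (\<lambda>u. lim (\<lambda>t. nesterov_residual (u / real t ^ 2) t))"
  have \<phi>: "(\<lambda>t. nesterov_residual (u / real t ^ 2) t) \<longlonglongrightarrow> \<phi> u" if "u > 0" for u
    using nesterov_residual_pointwise_limit[OF that] by (simp add: \<phi>_def convergent_LIMSEQ_iff)
  define g where "g = (\<lambda>t x. x powr \<rho> * nesterov_residual x t ^ 2)"
  define F where "F = (\<lambda>n u. if u \<in> {0..real (Suc n) ^ 2} then real (Suc n) powr (2 * \<rho>) * g (Suc n) (u / real (Suc n) ^ 2) else 0)"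
  define h where "h = (\<lambda>u. (if u \<in> {0..1} then 4 * u powr \<rho> else 0) + (if u \<in> {1..} then C * u powr (\<rho> - 3/2) else 0))"
  \<comment> \<open>The estimate with C excludes x = 1, which is reached at u = t^2; there the
    residual is 0.\<close>
  have res1: "nesterov_residual 1 (Suc n) = 0" for n by (cases n) auto
  have gF: "real (Suc n) powr (2 * \<rho>) * g (Suc n) (u / real (Suc n) ^ 2) = u powr \<rho> * nesterov_residual (u / real (Suc n) ^ 2) (Suc n) ^ 2"
    if "u \<ge> 0" for n u
  proof -
    have "(u / real (Suc n) ^ 2) powr \<rho> = u powr \<rho> * (1 / real (Suc n) ^ 2) powr \<rho>"
      using that by (simp add: powr_mult[symmetric] del: of_nat_Suc)
    also have "(1 / real (Suc n) ^ 2) powr \<rho> = real (Suc n) powr (-2 * \<rho>)" by (rule inverse_square_powr) simp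
    finally have "real (Suc n) powr (2 * \<rho>) * (u / real (Suc n) ^ 2) powr \<rho> = u powr \<rho> * (real (Suc n) powr (2 * \<rho>) * real (Suc n) powr (-2 * \<rho>))"
      by simp
    also have "real (Suc n) powr (2 * \<rho>) * real (Suc n) powr (-2 * \<rho>) = 1"
      unfolding powr_add[symmetric] by simp
    finally show ?thesis unfolding g_def by (simp add: mult.assoc[symmetric] del: of_nat_Suc)
  qed
  have Fint: "(F n has_integral real (Suc n) powr (2 * \<rho> + 2) * nesterov_moment \<rho> (Suc n)) {0..}" for n
  proof -
    define T where "T = real (Suc n) ^ 2"
    have T: "T > 0" by (simp add: T_def)
    have "(g (Suc n) has_integral nesterov_moment \<rho> (Suc n)) {0..1}"
      unfolding g_def by (rule nesterov_moment_integrable(2)) (use \<rho> in simp)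
    from has_integral_stretch_real[OF this, of "1 / T"] T
    have "((\<lambda>u. g (Suc n) (u / T)) has_integral T * nesterov_moment \<rho> (Suc n)) ((\<lambda>x. x * T) ` {0..1})"
      by simp
    moreover have "(\<lambda>x. x * T) ` {0..1} = {0..T}"
      using T image_affinity_atLeastAtMost[of T 0 0 1] by (simp add: mult.commute)
    ultimately have "((\<lambda>u. g (Suc n) (u / T)) has_integral T * nesterov_moment \<rho> (Suc n)) {0..T}" by simp
    hence *: "((\<lambda>u. real (Suc n) powr (2 * \<rho>) * g (Suc n) (u / T)) has_integral real (Suc n) powr (2 * \<rho>) * (T * nesterov_moment \<rho> (Suc n))) {0..T}"
      by (rule has_integral_mult_right)
    have eq: "real (Suc n) powr (2 * \<rho>) * (T * nesterov_moment \<rho> (Suc n)) = real (Suc n) powr (2 * \<rho> + 2) * nesterov_moment \<rho> (Suc n)"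
      unfolding powr_add by (simp add: T_def powr_numeral del: of_nat_Suc)
    show ?thesis using *[unfolded eq] unfolding F_def T_def[symmetric]
      by (subst has_integral_restrict) auto
  qed
  have hint: "h integrable_on {0..}"
    unfolding h_def
  proof (intro integrable_add)
    have "(\<lambda>u::real. 4 * u powr \<rho>) integrable_on {0..1}"
      using has_integral_powr_from_0[of \<rho> 1] \<rho> by (intro integrable_on_mult_right) auto
    thus "(\<lambda>u. if u \<in> {0..1} then 4 * u powr \<rho> else 0) integrable_on {0::real..}"
      by (subst integrable_restrict_Int) (simp add: Int_absorb1)
    have "(\<lambda>u::real. C * u powr (\<rho> - 3/2)) integrable_on {1..}"
      using has_integral_powr_to_inf[of "\<rho> - 3/2" 1] \<rho> by (intro integrable_on_mult_right) auto
    thus "(\<lambda>u. if u \<in> {1..} then C * u powr (\<rho> - 3/2) else 0) integrable_on {0::real..}"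
      by (subst integrable_restrict_Int) (simp add: Int_absorb2)
  qed
  have bound: "norm (F n u) \<le> h u" if "u \<in> {0..}" for n u
  proof (cases "u \<le> real (Suc n) ^ 2")
    case True
    have u: "u \<ge> 0" using that by simp
    define t where "t = Suc n"
    have t: "t > 0" by (simp add: t_def)
    have x: "0 \<le> u / real t ^ 2" "u / real t ^ 2 \<le> 1" using u True by (auto simp: t_def simp del: of_nat_Suc)
    have tx: "real t ^ 2 * (u / real t ^ 2) = u" using t by simp
    have Fe: "F n u = u powr \<rho> * nesterov_residual (u / real t ^ 2) t ^ 2"
      using True u gF[OF u, of n] by (simp add: F_def t_def del: of_nat_Suc)
    show ?thesis
    proof (cases "u \<le> 1")
      case le: True
      have "nesterov_residual (u / real t ^ 2) t ^ 2 \<le> 4"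
        by (rule nesterov_residual_sq_le_4) (use x tx le in auto)
      hence "u powr \<rho> * nesterov_residual (u / real t ^ 2) t ^ 2 \<le> u powr \<rho> * 4" by (intro mult_left_mono) auto
      thus ?thesis unfolding Fe h_def using u le C(1) by auto
    next
      case False
      hence u1: "u > 1" by simp
      have "nesterov_residual (u / real t ^ 2) t ^ 2 \<le> C * u powr (-3/2)"
      proof (cases "u / real t ^ 2 = 1")
        case True
        show ?thesis unfolding True using res1[of n] C(1) by (simp add: t_def)
      next
        case False
        hence x1: "0 < u / real t ^ 2" "u / real t ^ 2 < 1" using x u1 t by auto
        have "nesterov_residual (u / real t ^ 2) t ^ 2 \<le> C * real t powr (-3) * (u / real t ^ 2) powr (-3/2) * (1 - u / real t ^ 2) ^ (t + 1)"
          by (rule C(2)[OF x1 t]) (use tx u1 in simp)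
        also have "\<dots> \<le> C * real t powr (-3) * (u / real t ^ 2) powr (-3/2) * 1"
          using C(1) x1 by (intro mult_left_mono power_le_one) auto
        also have "(u / real t ^ 2) powr (-3/2) = u powr (-3/2) * (1 / real t ^ 2) powr (-3/2)"
          using u by (simp add: powr_mult[symmetric])
        also have "(1 / real t ^ 2) powr (-3/2) = real t powr (-2 * (-3/2))" by (rule inverse_square_powr) (use t in simp)
        also have "C * real t powr (-3) * (u powr (-3/2) * real t powr (-2 * (-3/2))) * 1 = C * u powr (-3/2) * (real t powr (-3) * real t powr (-2 * (-3/2)))"
          by simp
        also have "real t powr (-3) * real t powr (-2 * (-3/2)) = 1" unfolding powr_add[symmetric] using t by simp
        finally show ?thesis by simp
      qed
      hence "u powr \<rho> * nesterov_residual (u / real t ^ 2) t ^ 2 \<le> u powr \<rho> * (C * u powr (-3/2))" by (intro mult_left_mono) auto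
      also have "\<dots> = C * (u powr \<rho> * u powr (-3/2))" by simp
      also have "u powr \<rho> * u powr (-3/2) = u powr (\<rho> - 3/2)" unfolding powr_add[symmetric] by simp
      finally show ?thesis unfolding Fe h_def using u1 by auto
    qed
  next
    case False
    thus ?thesis using that C(1) by (auto simp: F_def h_def)
  qed
  have lim: "(\<lambda>n. F n u) \<longlonglongrightarrow> u powr \<rho> * \<phi> u ^ 2" if "u \<in> {0..}" for u
  proof (cases "u = 0")
    case True
    thus ?thesis by (simp add: F_def g_def)
  next
    case False
    hence u: "u > 0" using that by simp
    have "(\<lambda>n. u powr \<rho> * nesterov_residual (u / real (Suc n) ^ 2) (Suc n) ^ 2) \<longlonglongrightarrow> u powr \<rho> * \<phi> u ^ 2"
      by (intro tendsto_intros LIMSEQ_Suc[OF \<phi>[OF u]])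
    moreover have "eventually (\<lambda>n. u powr \<rho> * nesterov_residual (u / real (Suc n) ^ 2) (Suc n) ^ 2 = F n u) sequentially"
    proof -
      have "eventually (\<lambda>n. real n > u) sequentially"
        using filterlim_real_sequentially by (auto simp: filterlim_at_top_dense)
      thus ?thesis
      proof eventually_elim
        case (elim n)
        have "u \<le> real (Suc n) ^ 2"
        proof -
          have "u \<le> real (Suc n) * 1" using elim by simp
          also have "\<dots> \<le> real (Suc n) * real (Suc n)" by (intro mult_left_mono) auto
          finally show ?thesis by (simp only: power2_eq_square)
        qed
        thus ?case using u gF[of u n] by (simp add: F_def del: of_nat_Suc)
      qed
    qed
    ultimately show ?thesis by (rule Lim_transform_eventually)
  qed
  have fin: "\<And>n. F n integrable_on {0..}" using Fint by blast
  note dc = dominated_convergence[OF fin hint bound lim]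
  define K where "K = integral {0..} (\<lambda>u. u powr \<rho> * \<phi> u ^ 2)"
  have "(\<lambda>n. real (Suc n) powr (2 * \<rho> + 2) * nesterov_moment \<rho> (Suc n)) \<longlonglongrightarrow> K"
    using dc(2) unfolding K_def integral_unique[OF Fint] by simp
  hence limK: "(\<lambda>t. real t powr (2 * \<rho> + 2) * nesterov_moment \<rho> t) \<longlonglongrightarrow> K"
    by (rule filterlim_sequentially_Suc[THEN iffD1])
  have "K > 0"
  proof -
    have ge: "1/2 \<le> \<phi> u" if u: "0 < u" "u \<le> 1/2" for u
    proof (rule tendsto_lowerbound[OF \<phi>[OF u(1)]])
      show "\<forall>\<^sub>F t in sequentially. 1/2 \<le> nesterov_residual (u / real t ^ 2) t"
        using eventually_gt_at_top[of 0]
      proof eventually_elim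
        case (elim t)
        have "real t ^ 2 \<ge> 1" using elim by simp
        hence "u \<le> real t ^ 2" using u by linarith
        hence "u / real t ^ 2 \<le> 1" using elim by simp
        moreover have "real t ^ 2 * (u / real t ^ 2) = u" using elim by simp
        ultimately have "\<bar>nesterov_residual (u / real t ^ 2) t - 1\<bar> \<le> u"
          using nesterov_residual_near_one[of "u / real t ^ 2" t] u by simp
        thus ?case using u by linarith
      qed
    qed auto
    have p: "((\<lambda>u. 1/4 * u powr \<rho>) has_integral 1/4 * ((1/2) powr (\<rho> + 1) / (\<rho> + 1))) {0..1/2}"
      using has_integral_powr_from_0[of \<rho> "1/2"] \<rho> by (intro has_integral_mult_right) auto
    have i: "(\<lambda>u. u powr \<rho> * \<phi> u ^ 2) integrable_on {0..1/2}"
      by (rule integrable_on_subinterval[OF dc(1)]) auto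
    have "1/4 * ((1/2) powr (\<rho> + 1) / (\<rho> + 1)) \<le> integral {0..1/2} (\<lambda>u. u powr \<rho> * \<phi> u ^ 2)"
    proof (rule has_integral_le[OF p integrable_integral[OF i]])
      fix u :: real assume u: "u \<in> {0..1/2}"
      show "1/4 * u powr \<rho> \<le> u powr \<rho> * \<phi> u ^ 2"
      proof (cases "u = 0")
        case False
        hence "(1/2) ^ 2 \<le> \<phi> u ^ 2" using u ge[of u] by (intro power_mono) auto
        hence "u powr \<rho> * (1/2) ^ 2 \<le> u powr \<rho> * \<phi> u ^ 2" by (intro mult_left_mono) auto
        thus ?thesis by (simp add: power2_eq_square)
      qed simp
    qed
    also have "\<dots> \<le> K" unfolding K_def
      using i dc(1) by (intro integral_subset_le) auto
    finally have "1/4 * ((1/2) powr (\<rho> + 1) / (\<rho> + 1)) \<le> K" .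
    moreover have "0 < 1/4 * ((1/2) powr (\<rho> + 1) / (\<rho> + 1))" using \<rho> by simp
    ultimately show ?thesis by linarith
  qed
  thus ?thesis using that limK by blast
qed

text \<open>Here rho is the exponent of the weight: xi + 1 for the objective, where the threshold
  1/2 becomes xi = -1/2, and xi + 2 > 1 for the gradient, which always falls into the last
  case.\<close>

definition nesterov_rate :: "real \<Rightarrow> nat \<Rightarrow> real" where
  "nesterov_rate \<rho> t = (if \<rho> < 1/2 then real t powr (-2 * (\<rho> + 1))
     else if \<rho> = 1/2 then real t powr (-3) * ln (real t)
     else real t powr (- (\<rho> + 5/2)))"

lemma nesterov_moment_rate:
  assumes "\<rho> > -1"
  obtains K where "K > 0" "(\<lambda>t. nesterov_moment \<rho> t / nesterov_rate \<rho> t) \<longlonglongrightarrow> K"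
proof -
  consider "\<rho> < 1/2" | "\<rho> = 1/2" | "\<rho> > 1/2" by linarith
  thus ?thesis
  proof cases
    case 1
    obtain K where K: "K > 0" "(\<lambda>t. real t powr (2 * \<rho> + 2) * nesterov_moment \<rho> t) \<longlonglongrightarrow> K"
      using nesterov_moment_asymp_small[OF assms 1] by blast
    have "real t powr (2 * \<rho> + 2) = 1 / nesterov_rate \<rho> t" for t
    proof -
      have "nesterov_rate \<rho> t = real t powr (- (2 * \<rho> + 2))" using 1 by (simp add: nesterov_rate_def)
      thus ?thesis by (simp only: powr_minus inverse_eq_divide) simp
    qed
    with K show ?thesis using that by simp
  next
    case 2
    have eq: "real t powr 3 / ln (real t) = 1 / nesterov_rate \<rho> t" for t
    proof -
      have "nesterov_rate \<rho> t = real t powr (- 3) * ln (real t)" using 2 by (simp add: nesterov_rate_def)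
      thus ?thesis by (simp only: powr_minus inverse_eq_divide) simp
    qed
    have "(\<lambda>t. nesterov_moment \<rho> t / nesterov_rate \<rho> t) \<longlonglongrightarrow> 16 / pi ^ 2 * Gamma (3/2) ^ 2"
      using nesterov_moment_asymp_critical unfolding eq 2 by simp
    moreover have "16 / pi ^ 2 * Gamma (3/2 :: real) ^ 2 > 0"
      by (intro mult_pos_pos divide_pos_pos zero_less_power Gamma_real_pos) auto
    ultimately show ?thesis using that by blast
  next
    case 3
    have "real t powr (\<rho> - 3/2 + 4) = 1 / nesterov_rate \<rho> t" for t
    proof -
      have "- (\<rho> + 5/2) = - (\<rho> - 3/2 + 4)" by simp
      moreover have "nesterov_rate \<rho> t = real t powr (- (\<rho> + 5/2))" using 3 by (auto simp: nesterov_rate_def)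
      ultimately have "nesterov_rate \<rho> t = real t powr (- (\<rho> - 3/2 + 4))" by (simp only:)
      thus ?thesis by (simp only: powr_minus inverse_eq_divide) simp
    qed
    hence "(\<lambda>t. nesterov_moment \<rho> t / nesterov_rate \<rho> t) \<longlonglongrightarrow> 16 / pi ^ 2 * Gamma (3/2) ^ 2 * Gamma (\<rho> - 3/2 + 1)"
      using nesterov_moment_asymp_large[of "\<rho> - 3/2"] 3 by simp
    moreover have "16 / pi ^ 2 * Gamma (3/2 :: real) ^ 2 * Gamma (\<rho> - 3/2 + 1) > 0"
      using 3 by (intro mult_pos_pos divide_pos_pos zero_less_power Gamma_real_pos) auto
    ultimately show ?thesis using that by blast
  qed
qed

text \<open>As soon as ln t >= 1, all three rates are bounded below by t^(-a), where a is the
  largest of the three exponents.\<close>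

lemma power_div_nesterov_rate_tendsto_0:
  assumes "0 \<le> c" "c < 1"
  shows "(\<lambda>t. c ^ t / nesterov_rate \<rho> t) \<longlonglongrightarrow> 0"
proof -
  define a where "a = max 3 (max (2 * (\<rho> + 1)) (\<rho> + 5/2))"
  \<comment> \<open>The maximum with 1/2 keeps the base of the geometric sequence positive when c =
    0.\<close>
  define c' where "c' = max c (1/2)"
  have c': "0 < c'" "c' < 1" using assms by (auto simp: c'_def)
  have "(\<lambda>t. c' ^ t * real t powr a) \<longlonglongrightarrow> 0" using c' by real_asymp
  thus ?thesis
  proof (rule Lim_null_comparison[rotated])
    show "\<forall>\<^sub>F t in sequentially. norm (c ^ t / nesterov_rate \<rho> t) \<le> c' ^ t * real t powr a"
      using eventually_ge_at_top[of 3]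
    proof eventually_elim
      case (elim t)
      have t1: "real t \<ge> 1" using elim by simp
      have "1 \<le> ln (real t)"
      proof -
        have "exp 1 \<le> (3::real)" by (rule exp_le)
        also have "\<dots> \<le> real t" using elim by simp
        finally show ?thesis using elim by (subst ln_ge_iff) auto
      qed
      moreover have "real t powr (-a) \<le> real t powr (-2 * (\<rho> + 1))" "real t powr (-a) \<le> real t powr (-3)"
         "real t powr (-a) \<le> real t powr (-(\<rho> + 5/2))"
        using t1 by (auto intro!: powr_mono simp: a_def)
      moreover have "real t powr (-3) * 1 \<le> real t powr (-3) * ln (real t)"
        using \<open>1 \<le> ln (real t)\<close> by (intro mult_left_mono) auto
      ultimately have r: "real t powr (-a) \<le> nesterov_rate \<rho> t" by (auto simp: nesterov_rate_def)
      have p: "real t powr (-a) > 0" using elim by simp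
      with r have r0: "nesterov_rate \<rho> t > 0" by linarith
      have "norm (c ^ t / nesterov_rate \<rho> t) = c ^ t / nesterov_rate \<rho> t" using r0 assms by simp
      also have "\<dots> \<le> c' ^ t / real t powr (-a)"
        using r p assms by (intro frac_le power_mono) (auto simp: c'_def)
      also have "\<dots> = c' ^ t * real t powr a" by (simp add: powr_minus divide_inverse)
      finally show ?case .
    qed
  qed
qed

section \<open>Moments against densities\<close>

lemma nesterov_residual_one: "t > 0 \<Longrightarrow> nesterov_residual 1 t = 0"
  by (induction t rule: induct_nat_012) auto

text \<open>Once t^2 delta >= 1, the factor (1 - x)^(t+1) of
  \<open>nesterov_residual_sq_bounds\<close> makes the bound geometric, uniformly on [delta, 1] and
  hence against any integrable density.\<close>

lemma nesterov_residual_sq_decay: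
  assumes "0 < \<delta>" "\<delta> < 1"
  obtains D where "D > 0" "\<forall>\<^sub>F t in sequentially. \<forall>x\<in>{\<delta>..1}. nesterov_residual x t ^ 2 \<le> D * (1 - \<delta>) ^ t"
proof -
  obtain C where C: "C > 0"
    "\<And>x t. 0 < x \<Longrightarrow> x < 1 \<Longrightarrow> t > 0 \<Longrightarrow> real t ^ 2 * x \<ge> 1 \<Longrightarrow>
       nesterov_residual x t ^ 2 \<le> C * real t powr (-3) * x powr (-3/2) * (1 - x) ^ (t + 1)"
    using nesterov_residual_sq_bounds by metis
  have "filterlim (\<lambda>t. real t ^ 2 * \<delta>) at_top sequentially" using assms by real_asymp
  hence "eventually (\<lambda>t. real t ^ 2 * \<delta> \<ge> 1) sequentially" by (auto simp: filterlim_at_top)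
  hence "\<forall>\<^sub>F t in sequentially. \<forall>x\<in>{\<delta>..1}. nesterov_residual x t ^ 2 \<le> C * \<delta> powr (-3/2) * (1 - \<delta>) ^ t"
    using eventually_gt_at_top[of 0]
  proof eventually_elim
    case (elim t)
    show ?case
    proof
      fix x assume x: "x \<in> {\<delta>..1}"
      show "nesterov_residual x t ^ 2 \<le> C * \<delta> powr (-3/2) * (1 - \<delta>) ^ t"
      proof (cases "x = 1")
        case True
        show ?thesis using True C(1) assms elim nesterov_residual_one[of t] by simp
      next
        case False
        hence x1: "0 < x" "x < 1" using x assms by auto
        have "real t ^ 2 * x \<ge> real t ^ 2 * \<delta>" using x by (intro mult_left_mono) auto
        hence "real t ^ 2 * x \<ge> 1" using elim by linarith
        hence "nesterov_residual x t ^ 2 \<le> C * real t powr (-3) * x powr (-3/2) * (1 - x) ^ (t + 1)"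
          using elim by (intro C(2) x1) auto
        also have "\<dots> \<le> C * 1 * \<delta> powr (-3/2) * (1 - \<delta>) ^ t"
        proof (intro mult_mono mult_nonneg_nonneg)
          show "real t powr (-3) \<le> 1" using elim powr_mono[of "-3" 0 "real t"] by simp
          show "x powr (-3/2) \<le> \<delta> powr (-3/2)" using x assms by (intro powr_mono2') auto
          have "(1 - x) ^ (t + 1) \<le> (1 - x) ^ t" using x1 by (intro power_decreasing) auto
          also have "\<dots> \<le> (1 - \<delta>) ^ t" using x x1 by (intro power_mono) auto
          finally show "(1 - x) ^ (t + 1) \<le> (1 - \<delta>) ^ t" .
        qed (use C x1 in auto)
        finally show ?thesis by simp
      qed
    qed
  qed
  moreover have "C * \<delta> powr (-3/2) > 0" using C assms by simp
  ultimately show ?thesis using that by blast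
qed

text \<open>An Abelian argument: below delta the difference d of q and c x^rho is at most epsilon
  x^rho, so it contributes at most epsilon times the pure moment; above delta the squared residual
  is geometrically small, however q behaves there.\<close>

lemma nesterov_moment_density_unit:
  assumes \<rho>: "\<rho> > -1" and q: "set_integrable lborel {0..1} q"
    and lim: "((\<lambda>x. q x / x powr \<rho>) \<longlongrightarrow> c) (at_right 0)" and c: "c > 0"
  obtains K where "K > 0"
    "(\<lambda>t. (LINT x:{0..1}|lborel. q x * nesterov_residual x t ^ 2) / nesterov_rate \<rho> t) \<longlonglongrightarrow> K"
proof -
  obtain K where K: "K > 0" "(\<lambda>t. nesterov_moment \<rho> t / nesterov_rate \<rho> t) \<longlonglongrightarrow> K"
    using nesterov_moment_rate[OF \<rho>] by blast
  define S where "S = (\<lambda>t. LINT x:{0..1}|lborel. q x * nesterov_residual x t ^ 2)"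
  define d where "d = (\<lambda>x. \<bar>q x - c * x powr \<rho>\<bar>)"
  have pint: "set_integrable lborel {0..1} (\<lambda>x. x powr \<rho>)"
    using nesterov_moment_integrable(1)[OF \<rho>, of 0] by simp
  have dint: "set_integrable lborel {0..1} d"
    unfolding d_def by (intro set_integrable_abs set_integral_diff set_integrable_mult_right q pint)
  define D where "D = (LINT x:{0..1}|lborel. d x)"
  have D0: "D \<ge> 0" unfolding D_def set_lebesgue_integral_def by (rule integral_nonneg_AE) (auto simp: d_def indicator_def)
  have diff: "\<bar>S t - c * nesterov_moment \<rho> t\<bar> \<le> (LINT x:{0..1}|lborel. d x * nesterov_residual x t ^ 2)" for t
  proof -
    have i1: "set_integrable lborel {0..1} (\<lambda>x. q x * nesterov_residual x t ^ 2)"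
      by (rule nesterov_residual_sq_integrable[OF q])
    have i2: "set_integrable lborel {0..1} (\<lambda>x. c * (x powr \<rho> * nesterov_residual x t ^ 2))"
      by (intro set_integrable_mult_right nesterov_moment_integrable \<rho>)
    have "S t - c * nesterov_moment \<rho> t = (LINT x:{0..1}|lborel. q x * nesterov_residual x t ^ 2 - c * (x powr \<rho> * nesterov_residual x t ^ 2))"
      unfolding set_integral_diff(2)[OF i1 i2] S_def by (simp add: nesterov_moment_integrable(3)[OF \<rho>])
    also have "\<bar>\<dots>\<bar> \<le> (LINT x:{0..1}|lborel. norm (q x * nesterov_residual x t ^ 2 - c * (x powr \<rho> * nesterov_residual x t ^ 2)))"
      using set_integral_norm_bound[OF set_integral_diff(1)[OF i1 i2]] by simp
    also have "(\<lambda>x. norm (q x * nesterov_residual x t ^ 2 - c * (x powr \<rho> * nesterov_residual x t ^ 2))) = (\<lambda>x. d x * nesterov_residual x t ^ 2)"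
      by (simp add: d_def fun_eq_iff abs_mult algebra_simps flip: left_diff_distrib)
         (simp add: abs_mult flip: mult.assoc left_diff_distrib)
    finally show ?thesis .
  qed
  have null: "(\<lambda>t. (S t - c * nesterov_moment \<rho> t) / nesterov_rate \<rho> t) \<longlonglongrightarrow> 0"
  proof (rule LIMSEQ_I)
    fix e :: real assume e: "e > 0"
    \<comment> \<open>K + 1 eventually bounds the ratio of the pure moment to its rate, and the part
      above delta adds one more epsilon.\<close>
    define \<epsilon> where "\<epsilon> = e / (K + 2)"
    have eps: "\<epsilon> > 0" using e K(1) by (simp add: \<epsilon>_def)
    have "eventually (\<lambda>x. dist (q x / x powr \<rho>) c < \<epsilon>) (at_right 0)" using tendstoD[OF lim eps] .
    then obtain b where b: "b > 0" "\<And>x. 0 < x \<Longrightarrow> x < b \<Longrightarrow> dist (q x / x powr \<rho>) c < \<epsilon>"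
      by (auto simp: eventually_at_right_field)
    define \<delta> where "\<delta> = min (b / 2) (1 / 2)"
    have \<delta>: "0 < \<delta>" "\<delta> < b" "\<delta> < 1" using b by (auto simp: \<delta>_def)
    have small: "d x \<le> \<epsilon> * x powr \<rho>" if x: "0 < x" "x < \<delta>" for x
    proof -
      have "\<bar>q x / x powr \<rho> - c\<bar> \<le> \<epsilon>" using b(2)[of x] x \<delta> by (simp add: dist_real_def)
      hence "\<bar>q x / x powr \<rho> - c\<bar> * x powr \<rho> \<le> \<epsilon> * x powr \<rho>" by (rule mult_right_mono) simp
      also have "\<bar>q x / x powr \<rho> - c\<bar> * x powr \<rho> = \<bar>(q x / x powr \<rho> - c) * x powr \<rho>\<bar>" by (simp add: abs_mult)
      also have "(q x / x powr \<rho> - c) * x powr \<rho> = q x - c * x powr \<rho>" using x by (simp add: field_simps)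
      finally show ?thesis by (simp add: d_def)
    qed
    obtain B where B: "B > 0" "\<forall>\<^sub>F t in sequentially. \<forall>x\<in>{\<delta>..1}. nesterov_residual x t ^ 2 \<le> B * (1 - \<delta>) ^ t"
      using nesterov_residual_sq_decay[OF \<delta>(1,3)] by blast
    have p0: "(\<lambda>t. (B * D) * ((1 - \<delta>) ^ t / nesterov_rate \<rho> t)) \<longlonglongrightarrow> (B * D) * 0"
      by (intro tendsto_mult tendsto_const power_div_nesterov_rate_tendsto_0) (use \<delta> in auto)
    hence ev1: "\<forall>\<^sub>F t in sequentially. (B * D) * ((1 - \<delta>) ^ t / nesterov_rate \<rho> t) < \<epsilon>"
      using eps by (auto dest: order_tendstoD(2))
    have ev2: "\<forall>\<^sub>F t in sequentially. nesterov_moment \<rho> t / nesterov_rate \<rho> t < K + 1"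
      using order_tendstoD(2)[OF K(2), of "K + 1"] by simp
    have ev3: "\<forall>\<^sub>F t in sequentially. nesterov_rate \<rho> t > 0"
      using eventually_ge_at_top[of 2] by eventually_elim (auto simp: nesterov_rate_def)
    have "\<forall>\<^sub>F t in sequentially. norm ((S t - c * nesterov_moment \<rho> t) / nesterov_rate \<rho> t - 0) < e"
      using ev1 ev2 ev3 B(2)
    proof eventually_elim
      case (elim t)
      let ?r = "nesterov_rate \<rho> t"
      have i1: "set_integrable lborel {0..1} (\<lambda>x. \<epsilon> * (x powr \<rho> * nesterov_residual x t ^ 2) + B * (1 - \<delta>) ^ t * d x)"
        by (intro set_integral_add set_integrable_mult_right nesterov_moment_integrable \<rho> dint)
      have "(LINT x:{0..1}|lborel. d x * nesterov_residual x t ^ 2) \<le>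
         (LINT x:{0..1}|lborel. \<epsilon> * (x powr \<rho> * nesterov_residual x t ^ 2) + B * (1 - \<delta>) ^ t * d x)"
      proof (rule set_integral_mono_AE)
        show "set_integrable lborel {0..1} (\<lambda>x. d x * nesterov_residual x t ^ 2)"
          by (rule nesterov_residual_sq_integrable[OF dint])
        show "AE x\<in>{0..1} in lborel. d x * nesterov_residual x t ^ 2 \<le> \<epsilon> * (x powr \<rho> * nesterov_residual x t ^ 2) + B * (1 - \<delta>) ^ t * d x"
          using AE_lborel_singleton[of 0]
        proof (eventually_elim, intro impI)
          fix x :: real assume x: "x \<noteq> 0" "x \<in> {0..1}"
          have d0: "d x \<ge> 0" by (simp add: d_def)
          show "d x * nesterov_residual x t ^ 2 \<le> \<epsilon> * (x powr \<rho> * nesterov_residual x t ^ 2) + B * (1 - \<delta>) ^ t * d x"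
          proof (cases "x < \<delta>")
            case True
            hence "d x * nesterov_residual x t ^ 2 \<le> \<epsilon> * x powr \<rho> * nesterov_residual x t ^ 2"
              using small[of x] x by (intro mult_right_mono) auto
            moreover have "0 \<le> B * (1 - \<delta>) ^ t * d x" using B \<delta> d0 by simp
            ultimately show ?thesis by (simp add: mult.assoc)
          next
            case False
            hence "d x * nesterov_residual x t ^ 2 \<le> d x * (B * (1 - \<delta>) ^ t)"
              using elim(4) x d0 by (intro mult_left_mono) auto
            moreover have "0 \<le> \<epsilon> * (x powr \<rho> * nesterov_residual x t ^ 2)" using eps by simp
            ultimately show ?thesis by (simp add: mult.commute)
          qed
        qed
      qed (rule i1)
      also have "\<dots> = \<epsilon> * nesterov_moment \<rho> t + B * (1 - \<delta>) ^ t * D"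
        using nesterov_moment_integrable(1)[OF \<rho>] dint
        by (subst set_integral_add) (auto simp: nesterov_moment_integrable(3)[OF \<rho>] D_def intro!: set_integrable_mult_right)
      finally have "\<bar>S t - c * nesterov_moment \<rho> t\<bar> \<le> \<epsilon> * nesterov_moment \<rho> t + B * (1 - \<delta>) ^ t * D"
        using diff[of t] by linarith
      hence "\<bar>S t - c * nesterov_moment \<rho> t\<bar> / ?r \<le> (\<epsilon> * nesterov_moment \<rho> t + B * (1 - \<delta>) ^ t * D) / ?r"
        using elim(3) by (intro divide_right_mono) auto
      also have "\<dots> = \<epsilon> * (nesterov_moment \<rho> t / ?r) + (B * D) * ((1 - \<delta>) ^ t / ?r)"
        by (simp add: add_divide_distrib)
      also have "\<dots> < \<epsilon> * (K + 1) + \<epsilon>"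
        using elim(1,2) eps by (intro add_strict_mono mult_strict_left_mono) auto
      also have "\<dots> = \<epsilon> * (K + 2)" by (simp add: algebra_simps)
      also have "\<dots> = e" using K(1) by (simp add: \<epsilon>_def)
      finally show ?case using elim(3) by simp
    qed
    thus "\<exists>no. \<forall>n\<ge>no. norm ((S n - c * nesterov_moment \<rho> n) / nesterov_rate \<rho> n - 0) < e"
      by (simp add: eventually_sequentially)
  qed
  have "(\<lambda>t. (S t - c * nesterov_moment \<rho> t) / nesterov_rate \<rho> t + c * (nesterov_moment \<rho> t / nesterov_rate \<rho> t)) \<longlonglongrightarrow> 0 + c * K"
    by (intro tendsto_add tendsto_mult tendsto_const null K)
  hence "(\<lambda>t. S t / nesterov_rate \<rho> t) \<longlonglongrightarrow> c * K" by (simp add: diff_divide_distrib)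
  moreover have "c * K > 0" using c K by simp
  ultimately show ?thesis using that unfolding S_def by blast
qed

text \<open>The substitution l = L x; the density L q(L x) has the edge constant L^(1 + rho)
  c.\<close>

lemma nesterov_moment_density:
  fixes L \<rho> c :: real
  assumes L: "L > 0" and \<rho>: "\<rho> > -1" and q: "integrable lborel (\<lambda>l. indicator {0..L} l * q l)"
    and lim: "((\<lambda>l. q l / l powr \<rho>) \<longlongrightarrow> c) (at_right 0)" and c: "c > 0"
  obtains K where "K > 0"
    "(\<lambda>t. (\<integral>l. indicator {0..L} l * q l * nesterov_residual (l / L) t ^ 2 \<partial>lborel) / nesterov_rate \<rho> t) \<longlonglongrightarrow> K"
proof -
  define q' where "q' = (\<lambda>x. L * q (L * x))"
  have ind: "indicator {0..L} (L * x) = (indicator {0..1} x :: real)" for x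
    using L by (auto simp: indicator_def zero_le_mult_iff)
  have "integrable lborel (\<lambda>x. indicator {0..L} (0 + L * x) * q (0 + L * x))"
    using lborel_integrable_real_affine[OF q, of L 0] L by simp
  hence "integrable lborel (\<lambda>x. L * (indicator {0..1} x * q (L * x)))" by (simp add: ind)
  hence q'i: "set_integrable lborel {0..1} q'"
    unfolding set_integrable_def q'_def by (simp add: mult_ac)
  have lim': "((\<lambda>x. q' x / x powr \<rho>) \<longlongrightarrow> L * L powr \<rho> * c) (at_right 0)"
  proof -
    have "filterlim (\<lambda>x. L * x) (at_right 0) (at_right 0)"
      by (rule filterlim_times_pos[OF filterlim_ident L]) simp
    hence "((\<lambda>x. q (L * x) / (L * x) powr \<rho>) \<longlongrightarrow> c) (at_right 0)" by (rule filterlim_compose[OF lim])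
    hence "((\<lambda>x. L * L powr \<rho> * (q (L * x) / (L * x) powr \<rho>)) \<longlongrightarrow> L * L powr \<rho> * c) (at_right 0)"
      by (intro tendsto_mult tendsto_const)
    moreover have "\<forall>\<^sub>F x in at_right 0. L * L powr \<rho> * (q (L * x) / (L * x) powr \<rho>) = q' x / x powr \<rho>"
      using L by (intro eventually_at_rightI[of 0 1]) (auto simp: q'_def powr_mult)
    ultimately show ?thesis by (rule Lim_transform_eventually)
  qed
  obtain K where K: "K > 0"
    "(\<lambda>t. (LINT x:{0..1}|lborel. q' x * nesterov_residual x t ^ 2) / nesterov_rate \<rho> t) \<longlonglongrightarrow> K"
    using nesterov_moment_density_unit[OF \<rho> q'i lim'] L c by auto
  have "(\<integral>l. indicator {0..L} l * q l * nesterov_residual (l / L) t ^ 2 \<partial>lborel) = (LINT x:{0..1}|lborel. q' x * nesterov_residual x t ^ 2)" for t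
  proof -
    have "(\<integral>l. indicator {0..L} l * q l * nesterov_residual (l / L) t ^ 2 \<partial>lborel) =
       L * (\<integral>x. indicator {0..L} (0 + L * x) * q (0 + L * x) * nesterov_residual ((0 + L * x) / L) t ^ 2 \<partial>lborel)"
      using lborel_integral_real_affine[of L "\<lambda>l. indicator {0..L} l * q l * nesterov_residual (l / L) t ^ 2" 0] L by simp
    also have "\<dots> = (\<integral>x. L * (indicator {0..1} x * q (L * x) * nesterov_residual x t ^ 2) \<partial>lborel)"
      using L by (simp add: ind)
    also have "\<dots> = (LINT x:{0..1}|lborel. q' x * nesterov_residual x t ^ 2)"
      unfolding set_lebesgue_integral_def q'_def by (simp add: mult_ac)
    finally show ?thesis .
  qed
  with K show ?thesis using that by simp
qed

section \<open>Spectral theorem and iterates on quadratic objectives\<close>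

text \<open>Take v maximizing the Rayleigh quotient on the unit sphere of S, with maximum m, and w =
  m v - f v. The form m (x . x) - x . f x is nonnegative on S and zero at v; along v + s w its
  linear coefficient is 2 (w . w), which therefore vanishes.\<close>

lemma self_adjoint_eigenvector_exists:
  fixes f :: "'a::euclidean_space \<Rightarrow> 'a"
  assumes f: "linear f" and sym: "\<And>x y. f x \<bullet> y = x \<bullet> f y"
    and S: "subspace S" "f ` S \<subseteq> S" "S \<noteq> {0}"
  obtains v l where "v \<in> S" "norm v = 1" "f v = l *\<^sub>R v"
proof -
  let ?K = "sphere 0 1 \<inter> S"
  have cpt: "compact ?K" by (intro compact_Int_closed compact_sphere closed_subspace S)
  have ne: "?K \<noteq> {}"
  proof -
    obtain x where x: "x \<in> S" "x \<noteq> 0" using S subspace_0[OF S(1)] by blast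
    hence "(1 / norm x) *\<^sub>R x \<in> ?K" using subspace_scale[OF S(1) x(1)] by simp
    thus ?thesis by blast
  qed
  have cont: "continuous_on ?K (\<lambda>x. x \<bullet> f x)"
    by (intro continuous_intros linear_continuous_on linear_conv_bounded_linear[THEN iffD1] f)
  from continuous_attains_sup[OF cpt ne cont]
  obtain v where v: "v \<in> ?K" "\<And>y. y \<in> ?K \<Longrightarrow> y \<bullet> f y \<le> v \<bullet> f v" by blast
  define m where "m = v \<bullet> f v"
  have vv: "v \<bullet> v = 1" "v \<in> S" using v by (auto simp: dot_square_norm)
  have ge: "x \<bullet> f x \<le> m * (x \<bullet> x)" if x: "x \<in> S" for x
  proof (cases "x = 0")
    case False
    have "(1 / norm x) *\<^sub>R x \<in> ?K" using subspace_scale[OF S(1) x] False by simp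
    from v(2)[OF this] have "(1 / norm x) * ((1 / norm x) * (x \<bullet> f x)) \<le> m"
      by (simp add: linear_scale[OF f] m_def)
    hence "(x \<bullet> f x) / (x \<bullet> x) \<le> m" by (simp add: dot_square_norm power2_eq_square)
    thus ?thesis using False by (simp add: divide_le_eq)
  qed (simp add: linear_0[OF f])
  define w where "w = m *\<^sub>R v - f v"
  have wS: "w \<in> S" unfolding w_def using S vv by (intro subspace_diff subspace_scale) auto
  define C where "C = m * (w \<bullet> w) - w \<bullet> f w"
  have pos: "0 \<le> 2 * s * (w \<bullet> w) + s ^ 2 * C" for s
  proof -
    have "v + s *\<^sub>R w \<in> S" by (intro subspace_add subspace_scale S vv wS)
    from ge[OF this] have "0 \<le> m * ((v + s *\<^sub>R w) \<bullet> (v + s *\<^sub>R w)) - (v + s *\<^sub>R w) \<bullet> f (v + s *\<^sub>R w)" by simp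
    also have "\<dots> = 2 * s * (m * (v \<bullet> w) - f v \<bullet> w) + s ^ 2 * C"
      using sym[of v w] vv
      by (simp add: linear_add[OF f] linear_scale[OF f] inner_add_left inner_add_right C_def m_def power2_eq_square inner_commute algebra_simps)
    also have "m * (v \<bullet> w) - f v \<bullet> w = w \<bullet> w" unfolding w_def by (simp add: inner_diff_left)
    finally show ?thesis .
  qed
  have "w \<bullet> w = 0"
  proof (rule ccontr)
    assume "w \<bullet> w \<noteq> 0"
    hence ww: "w \<bullet> w > 0" using inner_ge_zero[of w] by linarith
    \<comment> \<open>For this s, |s C| <= w . w, so the linear term outweighs the quadratic one,
      and the negative sign of s makes the form negative.\<close>
    define s where "s = - (w \<bullet> w) / (\<bar>C\<bar> + 1)"
    have s: "s < 0" using ww by (simp add: s_def divide_neg_pos)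
    have "\<bar>s * C\<bar> = (w \<bullet> w) * (\<bar>C\<bar> / (\<bar>C\<bar> + 1))" using ww by (simp add: s_def abs_mult)
    also have "\<dots> \<le> (w \<bullet> w) * 1" using ww by (intro mult_left_mono) auto
    finally have "2 * (w \<bullet> w) + s * C > 0" using ww by linarith
    with s have "s * (2 * (w \<bullet> w) + s * C) < 0" by (rule mult_neg_pos)
    moreover have "s * (2 * (w \<bullet> w) + s * C) = 2 * s * (w \<bullet> w) + s ^ 2 * C"
      by (simp add: algebra_simps power2_eq_square)
    ultimately show False using pos[of s] by linarith
  qed
  hence "f v = m *\<^sub>R v" by (simp add: w_def)
  thus ?thesis using that[of v m] vv by (simp add: norm_eq_1)
qed

text \<open>Induction on the dimension: by self-adjointness the orthogonal complement of an
  eigenvector within S is again invariant.\<close>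

lemma self_adjoint_orthonormal_eigenbasis:
  fixes f :: "'a::euclidean_space \<Rightarrow> 'a"
  assumes f: "linear f" and sym: "\<And>x y. f x \<bullet> y = x \<bullet> f y"
    and S: "subspace S" "f ` S \<subseteq> S"
  shows "\<exists>B. finite B \<and> B \<subseteq> S \<and> S \<subseteq> span B \<and> pairwise orthogonal B \<and> (\<forall>b\<in>B. norm b = 1 \<and> (\<exists>l. f b = l *\<^sub>R b))"
  using S
proof (induction "dim S" arbitrary: S rule: less_induct)
  case less
  show ?case
  proof (cases "S = {0}")
    case True
    thus ?thesis by (intro exI[of _ "{}"]) auto
  next
    case False
    obtain v l where v: "v \<in> S" "norm v = 1" "f v = l *\<^sub>R v"
      using self_adjoint_eigenvector_exists[OF f sym less.prems False] by blast
    define T where "T = {x \<in> S. v \<bullet> x = 0}"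
    have T: "subspace T"
      unfolding T_def using less.prems(1) by (auto simp: subspace_def inner_add_right)
    have fT: "f ` T \<subseteq> T"
    proof (clarsimp simp: T_def)
      fix x assume x: "x \<in> S" "v \<bullet> x = 0"
      have "v \<bullet> f x = f v \<bullet> x" using sym[of v x] by simp
      thus "f x \<in> S \<and> v \<bullet> f x = 0" using x v less.prems(2) by auto
    qed
    have "v \<notin> T" using v by (auto simp: T_def dot_square_norm)
    moreover have "T \<subseteq> S" by (auto simp: T_def)
    ultimately have "T \<subset> S" using v(1) by blast
    hence "span T \<subset> span S"
      unfolding span_eq_iff[THEN iffD2, OF T] span_eq_iff[THEN iffD2, OF less.prems(1)] .
    hence "dim T < dim S" by (rule dim_psubset)
    from less.hyps[OF this T fT] obtain B where B: "finite B" "B \<subseteq> T" "T \<subseteq> span B" "pairwise orthogonal B"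
      "\<forall>b\<in>B. norm b = 1 \<and> (\<exists>l. f b = l *\<^sub>R b)" by blast
    have "S \<subseteq> span (insert v B)"
    proof
      fix x assume x: "x \<in> S"
      define y where "y = x - (v \<bullet> x) *\<^sub>R v"
      have "y \<in> T" using x v less.prems(1)
        by (auto simp: y_def T_def subspace_diff subspace_scale inner_diff_right dot_square_norm)
      hence "y \<in> span (insert v B)" using B(3) span_mono[of B "insert v B"] by blast
      moreover have "(v \<bullet> x) *\<^sub>R v \<in> span (insert v B)" by (intro span_scale span_base) simp
      ultimately have "y + (v \<bullet> x) *\<^sub>R v \<in> span (insert v B)" by (rule span_add)
      thus "x \<in> span (insert v B)" by (simp add: y_def)
    qed
    moreover have "pairwise orthogonal (insert v B)"
      using B(2,4) by (auto simp: pairwise_insert T_def orthogonal_def inner_commute)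
    ultimately show ?thesis
      using B v by (intro exI[of _ "insert v B"]) (auto simp: T_def)
  qed
qed

section \<open>Functional calculus for symmetric matrices\<close>

definition conj_diag :: "real^'n^'n \<Rightarrow> ('n \<Rightarrow> real) \<Rightarrow> real^'n^'n" where
  "conj_diag Q l = Q ** (\<chi> i j. if i = j then l i else 0) ** transpose Q"

lemma inner_matrix_mult_transpose:
  fixes R :: "real^'n^'n"
  shows "(R *v x) \<bullet> y = x \<bullet> (transpose R *v y)"
proof -
  have "x \<bullet> (transpose R *v y) = (transpose R *v y) \<bullet> x" by (rule inner_commute)
  also have "transpose R *v y = y v* R" by (simp add: transpose_matrix_vector)
  also have "(y v* R) \<bullet> x = y \<bullet> (R *v x)" by (rule dot_lmul_matrix)
  also have "\<dots> = (R *v x) \<bullet> y" by (rule inner_commute)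
  finally show ?thesis by (simp only: transpose_matrix_vector)
qed

theorem symmetric_matrix_diagonalizable:
  fixes A :: "real^'n^'n"
  assumes "transpose A = A"
  obtains Q l where "orthogonal_matrix Q" "A = conj_diag Q l"
proof -
  have "(A *v x) \<bullet> y = x \<bullet> (A *v y)" for x y
    using inner_matrix_mult_transpose[of A x y] unfolding assms .
  then obtain B where B: "finite B" "UNIV \<subseteq> span B" "pairwise orthogonal B"
    "\<forall>b\<in>B. norm b = 1 \<and> (\<exists>l. A *v b = l *\<^sub>R b)"
    using self_adjoint_orthonormal_eigenbasis[of "(*v) A" UNIV] by auto
  \<comment> \<open>A spanning set of pairwise orthogonal nonzero vectors has exactly CARD('n)
    elements, so the eigenvectors can be indexed by 'n and become the columns of Q.\<close>
  have "0 \<notin> B" using B(4) by force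
  hence "independent B" using B(3) by (intro pairwise_orthogonal_independent)
  hence "card B = dim B" by (simp add: dim_eq_card_independent)
  also have "\<dots> = dim (span B)" by (simp add: dim_span)
  also have "span B = UNIV" using B(2) by auto
  finally have "card B = CARD('n)" by (simp add: dim_UNIV)
  then obtain b where b: "bij_betw b (UNIV :: 'n set) B"
    using B(1) finite_same_card_bij[of "UNIV :: 'n set" B] by auto
  hence bB: "b i \<in> B" for i by (auto simp: bij_betw_def)
  hence "\<forall>i. \<exists>c. A *v b i = c *\<^sub>R b i" using B(4) by blast
  from choice[OF this] obtain l where l: "\<And>i. A *v b i = l i *\<^sub>R b i" by blast
  define Q where "Q = (\<chi> i j. b j $ i)"
  define D where "D = (\<chi> i j. if i = j then l i else 0)"
  have col: "column j Q = b j" for j by (simp add: column_def Q_def vec_eq_iff)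
  have inj: "b i \<noteq> b j" if "i \<noteq> j" for i j
    using b that by (auto simp: bij_betw_def inj_on_def)
  have Q: "orthogonal_matrix Q"
    unfolding orthogonal_matrix_orthonormal_columns col
    using B(3,4) bB inj by (auto simp: pairwise_def)
  have "A ** Q = Q ** D"
  proof (simp add: vec_eq_iff, intro allI)
    fix i j
    have "(A ** Q) $ i $ j = (A *v b j) $ i"
      by (simp add: matrix_matrix_mult_def matrix_vector_mult_def Q_def)
    also have "\<dots> = l j * b j $ i" by (simp add: l)
    also have "\<dots> = (Q ** D) $ i $ j"
      by (simp add: matrix_matrix_mult_def Q_def D_def if_distrib[of "\<lambda>x. _ * x"] cong: if_cong)
    finally show "(A ** Q) $ i $ j = (Q ** D) $ i $ j" .
  qed
  hence "A ** (Q ** transpose Q) = Q ** D ** transpose Q" by (simp add: matrix_mul_assoc)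
  hence "A = Q ** D ** transpose Q" using Q by (simp add: orthogonal_matrix_def)
  thus ?thesis using that[OF Q] by (simp add: conj_diag_def D_def)
qed

lemma conj_diag_nth: "conj_diag Q l $ i $ j = (\<Sum>k\<in>UNIV. Q $ i $ k * l k * Q $ j $ k)"
proof -
  have "(Q ** (\<chi> i j. if i = j then l i else 0)) $ i $ k = Q $ i $ k * l k" for k
    by (simp add: matrix_matrix_mult_def if_distrib[of "\<lambda>x. _ * x"] cong: if_cong)
  thus ?thesis by (simp add: conj_diag_def matrix_matrix_mult_def transpose_def)
qed

lemma conj_diag_add: "conj_diag Q l + conj_diag Q k = conj_diag Q (\<lambda>i. l i + k i)"
  by (simp add: vec_eq_iff conj_diag_nth sum.distrib algebra_simps)

lemma conj_diag_diff: "conj_diag Q l - conj_diag Q k = conj_diag Q (\<lambda>i. l i - k i)"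
  by (simp add: vec_eq_iff conj_diag_nth sum_subtractf algebra_simps)

lemma conj_diag_scaleR: "c *\<^sub>R conj_diag Q l = conj_diag Q (\<lambda>i. c * l i)"
  by (simp add: vec_eq_iff conj_diag_nth sum_distrib_left algebra_simps)

lemma transpose_conj_diag: "transpose (conj_diag Q l) = conj_diag Q l"
  by (simp add: vec_eq_iff conj_diag_nth transpose_def mult_ac)

text \<open>Together with the rules for sums, differences and multiples, this makes
  \<open>conj_diag Q\<close> an algebra homomorphism for fixed Q: a polynomial in the matrix acts on
  the eigenvalues.\<close>

lemma conj_diag_mult:
  assumes "orthogonal_matrix Q"
  shows "conj_diag Q l ** conj_diag Q k = conj_diag Q (\<lambda>i. l i * k i)"
proof -
  let ?D = "\<lambda>l. (\<chi> i j. if i = j then l i else 0) :: real^'a^'a"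
  have "conj_diag Q l ** conj_diag Q k = Q ** ?D l ** (transpose Q ** Q) ** ?D k ** transpose Q"
    by (simp add: conj_diag_def matrix_mul_assoc)
  also have "transpose Q ** Q = mat 1" using assms by (simp add: orthogonal_matrix_def)
  also have "Q ** ?D l ** mat 1 ** ?D k ** transpose Q = Q ** (?D l ** ?D k) ** transpose Q"
    by (simp add: matrix_mul_assoc)
  also have "?D l ** ?D k = ?D (\<lambda>i. l i * k i)"
    by (simp add: vec_eq_iff matrix_matrix_mult_def if_distrib[of "\<lambda>x. x * _"] if_distrib[of "\<lambda>x. _ * x"] cong: if_cong)
  finally show ?thesis by (simp add: conj_diag_def)
qed

lemma conj_diag_one:
  assumes "orthogonal_matrix Q"
  shows "conj_diag Q (\<lambda>_. 1) = mat 1"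
proof -
  have "((\<chi> i j. if i = j then 1 else 0) :: real^'a^'a) = mat 1" by (simp add: mat_def)
  thus ?thesis using assms by (simp add: conj_diag_def orthogonal_matrix_def)
qed

lemma trace_conj_diag:
  assumes "orthogonal_matrix Q"
  shows "trace (conj_diag Q l) = (\<Sum>i\<in>UNIV. l i)"
proof -
  let ?D = "(\<chi> i j. if i = j then l i else 0) :: real^'a^'a"
  have "trace (conj_diag Q l) = trace (transpose Q ** (Q ** ?D))"
    unfolding conj_diag_def by (rule trace_mul_sym)
  also have "transpose Q ** (Q ** ?D) = ?D" using assms by (simp add: matrix_mul_assoc orthogonal_matrix_def)
  finally show ?thesis by (simp add: trace_def)
qed

text \<open>The columns of Q are unit vectors, so all its entries are at most 1 in absolute value.
  The bound does not depend on Q, whose choice varies with the sample point.\<close>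

lemma abs_conj_diag_nth_le:
  fixes Q :: "real^'n^'n" and K :: real
  assumes "orthogonal_matrix Q" "\<And>k. \<bar>l k\<bar> \<le> K"
  shows "\<bar>conj_diag Q l $ i $ j\<bar> \<le> real CARD('n) * K"
proof -
  have Q1: "\<bar>Q $ i $ k\<bar> \<le> 1" for i k
  proof -
    have "norm (column k Q) = 1" using assms(1) by (simp add: orthogonal_matrix_orthonormal_columns)
    thus ?thesis using component_le_norm_cart[of "column k Q" i] by (simp add: column_def)
  qed
  have K: "K \<ge> 0" using assms(2)[of i] by linarith
  have "\<bar>conj_diag Q l $ i $ j\<bar> \<le> (\<Sum>k\<in>UNIV. \<bar>Q $ i $ k * l k * Q $ j $ k\<bar>)"
    unfolding conj_diag_nth by (rule sum_abs)
  also have "\<dots> \<le> (\<Sum>k\<in>(UNIV :: 'n set). 1 * K * 1)"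
    unfolding abs_mult using Q1 assms(2) K by (intro sum_mono mult_mono) auto
  finally show ?thesis by simp
qed

text \<open>The determinant lives over polynomials. The embedding c of constant matrices is
  multiplicative, so c Q is still orthogonal, and the scalar matrix X commutes with everything;
  hence the similarity carries over to X - c D.\<close>

lemma characteristic_poly_conj_diag:
  fixes Q :: "real^'n^'n"
  assumes "orthogonal_matrix Q"
  shows "characteristic_poly (conj_diag Q l) = (\<Prod>i\<in>UNIV. [:- l i, 1:])"
proof -
  define c :: "real^'n^'n \<Rightarrow> (real poly)^'n^'n" where "c = (\<lambda>A. \<chi> i j. [:A $ i $ j:])"
  have const_sum: "[:sum f S:] = (\<Sum>i\<in>S. [:f i:])" for f :: "'n \<Rightarrow> real" and S
  proof (induction S rule: infinite_finite_induct)
    case (insert x F)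
    show ?case unfolding sum.insert[OF insert.hyps(1,2)] insert.IH[symmetric] by simp
  qed auto
  have cm: "c (A ** B) = c A ** c B" for A B
    by (simp add: c_def vec_eq_iff matrix_matrix_mult_def const_sum mult.commute)
  have c1: "c (mat 1) = mat 1" by (simp add: c_def vec_eq_iff mat_def one_pCons)
  let ?D = "(\<chi> i j. if i = j then l i else 0) :: real^'n^'n"
  let ?X = "mat [:0, 1:] :: (real poly)^'n^'n"
  have comm: "A ** ?X = ?X ** A" for A
    by (simp add: vec_eq_iff matrix_matrix_mult_def mat_def if_distrib[of "\<lambda>x. _ * x"] if_distrib[of "\<lambda>x. x * _"] cong: if_cong)
  have QQ: "c Q ** c (transpose Q) = mat 1"
    using assms c1 by (simp add: orthogonal_matrix_def flip: cm)
  have "characteristic_poly (conj_diag Q l) = det (?X - c Q ** c ?D ** c (transpose Q))"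
    unfolding characteristic_poly_def conj_diag_def c_def[symmetric] by (simp only: cm[symmetric]) (simp add: c_def)
  also have "?X - c Q ** c ?D ** c (transpose Q) = c Q ** (?X - c ?D) ** c (transpose Q)"
  proof -
    have "c Q ** ?X ** c (transpose Q) = ?X ** (c Q ** c (transpose Q))"
      by (simp only: comm matrix_mul_assoc)
    hence "?X = c Q ** ?X ** c (transpose Q)" unfolding QQ by simp
    moreover have "c Q ** (?X - c ?D) ** c (transpose Q) = c Q ** ?X ** c (transpose Q) - c Q ** c ?D ** c (transpose Q)"
      by (simp add: vec_eq_iff matrix_matrix_mult_def sum_subtractf sum_distrib_left sum_distrib_right algebra_simps)
    ultimately show ?thesis by simp
  qed
  also have "det \<dots> = det (c Q) * det (?X - c ?D) * det (c (transpose Q))" by (simp add: det_mul)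
  also have "\<dots> = det (c Q ** c (transpose Q)) * det (?X - c ?D)" by (simp add: det_mul mult_ac)
  also have "\<dots> = det (?X - c ?D)" unfolding QQ by simp
  also have "\<dots> = (\<Prod>i\<in>UNIV. (?X - c ?D) $ i $ i)" by (rule det_diagonal) (simp add: mat_def c_def)
  also have "\<dots> = (\<Prod>i\<in>UNIV. [:- l i, 1:])" by (simp add: mat_def c_def)
  finally show ?thesis .
qed

lemma eigenvalues_mset_conj_diag:
  fixes Q :: "real^'n^'n"
  assumes "orthogonal_matrix Q"
  shows "eigenvalues_mset (conj_diag Q l) = image_mset l (mset_set UNIV)"
proof -
  have "proots (\<Prod>i\<in>(UNIV :: 'n set). [:- l i, 1:]) = (\<Sum>i\<in>UNIV. proots [:- l i, 1:])"
    by (rule proots_prod) auto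
  also have "\<dots> = (\<Sum>i\<in>UNIV. {#l i#})" by simp
  also have "\<dots> = image_mset l (mset_set UNIV)"
    by (simp add: sum_unfold_sum_mset sum_mset.distrib)
  finally show ?thesis unfolding eigenvalues_mset_def characteristic_poly_conj_diag[OF assms] .
qed

section \<open>Iterates on quadratic objectives\<close>

fun residual_matrix :: "real^'n^'n \<Rightarrow> nat \<Rightarrow> real^'n^'n" where
  "residual_matrix A 0 = mat 1"
| "residual_matrix A (Suc 0) = mat 1 - A"
| "residual_matrix A (Suc (Suc t)) = (mat 1 - A) ** (residual_matrix A (Suc t) +
     (real t / (real t + 3)) *\<^sub>R (residual_matrix A (Suc t) - residual_matrix A t))"

lemma residual_matrix_conj_diag:
  assumes "orthogonal_matrix Q"
  shows "residual_matrix (conj_diag Q l) t = conj_diag Q (\<lambda>i. nesterov_residual (l i) t)"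
proof (induction t rule: induct_nat_012)
  case 0
  show ?case by (simp add: conj_diag_one[OF assms])
next
  case 1
  show ?case by (simp add: conj_diag_one[OF assms, symmetric] conj_diag_diff)
next
  case (ge2 t)
  thus ?case
    by (simp add: conj_diag_one[OF assms, symmetric] conj_diag_diff conj_diag_add conj_diag_scaleR conj_diag_mult[OF assms])
qed

text \<open>Uniqueness, as the definite description in \<open>gradient\<close> demands: the
  difference of two candidates is tested against itself.\<close>

lemma gradient_eqI:
  assumes "GDERIV f x :> D"
  shows "gradient f x = D"
  unfolding gradient_def
proof (rule the_equality)
  fix D' assume "GDERIV f x :> D'"
  hence "(\<lambda>h. h \<bullet> D') = (\<lambda>h. h \<bullet> D)"
    using assms unfolding gderiv_def by (rule has_derivative_unique)
  hence "(D' - D) \<bullet> D' = (D' - D) \<bullet> D" by (rule fun_cong)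
  hence "(D' - D) \<bullet> (D' - D) = 0" by (simp only: inner_diff_right)
  thus "D' = D" by simp
qed (rule assms)

text \<open>
  \<open>H\<close> is symmetric only almost surely; with its symmetric part the formulas hold at every sample
  point, so that the integrands below are measurable.
\<close>
definition sym_part :: "real^'n^'n \<Rightarrow> real^'n^'n" where
  "sym_part A = (1 / 2) *\<^sub>R (A + transpose A)"

lemma gradient_quadratic_objective:
  "gradient (quadratic_objective H xs) x = sym_part H *v (x - xs)"
proof (rule gradient_eqI)
  have lin: "((\<lambda>x. H *v (x - xs)) has_derivative (\<lambda>h. H *v h)) (at x)"
    by (rule bounded_linear.has_derivative[OF matrix_vector_mul_bounded_linear]) (auto intro!: derivative_eq_intros)
  have "((\<lambda>x. (1/2) * ((x - xs) \<bullet> (H *v (x - xs)))) has_derivative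
      (\<lambda>h. (1/2) * ((x - xs) \<bullet> (H *v h) + h \<bullet> (H *v (x - xs))))) (at x)"
    by (intro has_derivative_mult_right has_derivative_inner lin) (auto intro!: derivative_eq_intros)
  moreover have "(1/2) * ((x - xs) \<bullet> (H *v h) + h \<bullet> (H *v (x - xs))) = h \<bullet> (sym_part H *v (x - xs))" for h
  proof -
    have "(x - xs) \<bullet> (H *v h) = h \<bullet> (transpose H *v (x - xs))"
      using inner_matrix_mult_transpose[of H h "x - xs"] by (simp only: inner_commute)
    thus ?thesis
      by (simp only: sym_part_def scaleR_matrix_vector_assoc[symmetric] matrix_vector_mult_add_rdistrib
          inner_scaleR_right inner_add_right add.commute)
  qed
  ultimately show "GDERIV (quadratic_objective H xs) x :> sym_part H *v (x - xs)"
    unfolding gderiv_def quadratic_objective_def[abs_def] by simp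
qed

text \<open>The minimizer is a fixed point of the gradient step, and the extrapolation is an affine
  combination, so the errors obey a linear recursion, that of the residual polynomials at the
  symmetric part of H / L.\<close>

lemma nesterov_x_quadratic:
  fixes H :: "real^'n^'n"
  shows "nesterov_x L (quadratic_objective H xs) z t - xs = residual_matrix ((1 / L) *\<^sub>R sym_part H) t *v (z - xs)"
proof (induction t rule: induct_nat_012)
  case 0
  show ?case by simp
next
  case 1
  show ?case
    by (simp add: gradient_quadratic_objective matrix_vector_mult_diff_rdistrib scaleR_matrix_vector_assoc)
next
  case (ge2 t)
  let ?x = "nesterov_x L (quadratic_objective H xs) z" and ?R = "residual_matrix ((1 / L) *\<^sub>R sym_part H)"
  let ?c = "real t / (real t + 3)"
  let ?y = "?x (Suc t) + ?c *\<^sub>R (?x (Suc t) - ?x t)"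
  have y: "?y - xs = (?R (Suc t) + ?c *\<^sub>R (?R (Suc t) - ?R t)) *v (z - xs)"
  proof -
    have "?y - xs = (?x (Suc t) - xs) + ?c *\<^sub>R ((?x (Suc t) - xs) - (?x t - xs))" by simp
    also have "\<dots> = (?R (Suc t) + ?c *\<^sub>R (?R (Suc t) - ?R t)) *v (z - xs)"
      unfolding ge2 by (simp add: matrix_vector_mult_add_rdistrib matrix_vector_mult_diff_rdistrib scaleR_matrix_vector_assoc[symmetric])
    finally show ?thesis .
  qed
  have "?x (Suc (Suc t)) - xs = (?y - xs) - (1 / L) *\<^sub>R (sym_part H *v (?y - xs))"
    by (simp add: gradient_quadratic_objective)
  also have "\<dots> = (mat 1 - (1 / L) *\<^sub>R sym_part H) *v (?y - xs)"
    by (simp only: matrix_vector_mult_diff_rdistrib scaleR_matrix_vector_assoc[symmetric] matrix_vector_mul_lid)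
  also have "\<dots> = ?R (Suc (Suc t)) *v (z - xs)"
    unfolding y by (simp add: matrix_vector_mul_assoc)
  finally show ?case .
qed

section \<open>Expected spectral distribution\<close>

text \<open>
  Measurability of the eigenvalues as functions of the sample point is avoided. Nonnegative integrals
  of arbitrary functions are lower integrals, hence only superadditive, and this gives one inequality
  for the spectral averages; applied to both \<open>h\<close> and \<open>K - h\<close> it gives equality.
\<close>
lemma nn_integral_measurable_minorant:
  obtains u where "u \<in> borel_measurable M" "\<And>x. u x \<le> f x" "(\<integral>\<^sup>+x. u x \<partial>M) = (\<integral>\<^sup>+x. f x \<partial>M)"
proof -
  let ?A = "{g. simple_function M g \<and> g \<le> f}"
  have "?A \<noteq> {}" by (auto intro!: exI[of _ "\<lambda>_. 0"] simp: le_fun_def)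
  \<comment> \<open>The integral is a supremum over simple minorants. A sequence of them attains it,
    and the pointwise supremum of that sequence is the measurable minorant.\<close>
  then obtain v :: "nat \<Rightarrow> ennreal" where v: "range v \<subseteq> integral\<^sup>S M ` ?A" "Sup (integral\<^sup>S M ` ?A) = Sup (range v)"
    using ennreal_Sup_countable_SUP[of "integral\<^sup>S M ` ?A"] by auto
  have "\<forall>n. \<exists>g. g \<in> ?A \<and> v n = integral\<^sup>S M g" using v(1) by blast
  then obtain g where g: "\<And>n. g n \<in> ?A" "\<And>n. v n = integral\<^sup>S M (g n)" by metis
  define u where "u = (\<lambda>x. SUP n. g n x)"
  have m: "u \<in> borel_measurable M" unfolding u_def
    using g(1) by (intro borel_measurable_SUP) (auto intro: borel_measurable_simple_function)
  have le: "u x \<le> f x" for x unfolding u_def using g(1) by (auto simp: le_fun_def intro!: SUP_least)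
  have "(\<integral>\<^sup>+x. f x \<partial>M) = Sup (range v)" unfolding nn_integral_def using v(2) by simp
  also have "\<dots> \<le> (\<integral>\<^sup>+x. u x \<partial>M)"
  proof (rule Sup_least, clarsimp)
    fix n
    have "v n = (\<integral>\<^sup>+x. g n x \<partial>M)" using g by (simp add: nn_integral_eq_simple_integral)
    also have "\<dots> \<le> (\<integral>\<^sup>+x. u x \<partial>M)" by (intro nn_integral_mono) (auto simp: u_def intro: SUP_upper)
    finally show "v n \<le> (\<integral>\<^sup>+x. u x \<partial>M)" .
  qed
  finally have "(\<integral>\<^sup>+x. f x \<partial>M) \<le> (\<integral>\<^sup>+x. u x \<partial>M)" .
  moreover have "(\<integral>\<^sup>+x. u x \<partial>M) \<le> (\<integral>\<^sup>+x. f x \<partial>M)" by (intro nn_integral_mono le)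
  ultimately have "(\<integral>\<^sup>+x. u x \<partial>M) = (\<integral>\<^sup>+x. f x \<partial>M)" by (rule antisym[rotated])
  thus ?thesis using that m le by blast
qed

text \<open>The measurable minorants of f and g have additive integrals, and their sum lies below f
  + g. For nonmeasurable functions the inequality can be strict.\<close>

lemma nn_integral_superadditive: "(\<integral>\<^sup>+x. f x \<partial>M) + (\<integral>\<^sup>+x. g x \<partial>M) \<le> (\<integral>\<^sup>+x. f x + g x \<partial>M)"
proof -
  obtain u where u: "u \<in> borel_measurable M" "\<And>x. u x \<le> f x" "(\<integral>\<^sup>+x. u x \<partial>M) = (\<integral>\<^sup>+x. f x \<partial>M)"
    by (rule nn_integral_measurable_minorant[of M f]) blast
  obtain v where v: "v \<in> borel_measurable M" "\<And>x. v x \<le> g x" "(\<integral>\<^sup>+x. v x \<partial>M) = (\<integral>\<^sup>+x. g x \<partial>M)"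
    by (rule nn_integral_measurable_minorant[of M g]) blast
  have "(\<integral>\<^sup>+x. f x \<partial>M) + (\<integral>\<^sup>+x. g x \<partial>M) = (\<integral>\<^sup>+x. u x + v x \<partial>M)"
    using u v by (simp add: nn_integral_add)
  also have "\<dots> \<le> (\<integral>\<^sup>+x. f x + g x \<partial>M)" by (intro nn_integral_mono add_mono u v)
  finally show ?thesis .
qed

lemma nn_integral_sum_superadditive:
  assumes "finite S"
  shows "(\<Sum>i\<in>S. \<integral>\<^sup>+x. f i x \<partial>M) \<le> (\<integral>\<^sup>+x. (\<Sum>i\<in>S. f i x) \<partial>M)"
  using assms
proof (induction S)
  case (insert i S)
  have "(\<Sum>i\<in>insert i S. \<integral>\<^sup>+x. f i x \<partial>M) \<le> (\<integral>\<^sup>+x. f i x \<partial>M) + (\<integral>\<^sup>+x. (\<Sum>i\<in>S. f i x) \<partial>M)"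
    using insert by (simp add: add_left_mono)
  also have "\<dots> \<le> (\<integral>\<^sup>+x. f i x + (\<Sum>i\<in>S. f i x) \<partial>M)" by (rule nn_integral_superadditive)
  finally show ?case using insert by simp
qed simp

lemma nn_integral_cmult_le: "c * (\<integral>\<^sup>+x. f x \<partial>M) \<le> (\<integral>\<^sup>+x. c * f x \<partial>M)"
proof -
  obtain u where u: "u \<in> borel_measurable M" "\<And>x. u x \<le> f x" "(\<integral>\<^sup>+x. u x \<partial>M) = (\<integral>\<^sup>+x. f x \<partial>M)"
    by (rule nn_integral_measurable_minorant[of M f]) blast
  have "c * (\<integral>\<^sup>+x. f x \<partial>M) = (\<integral>\<^sup>+x. c * u x \<partial>M)" using u by (simp add: nn_integral_cmult)
  also have "\<dots> \<le> (\<integral>\<^sup>+x. c * f x \<partial>M)" by (intro nn_integral_mono mult_left_mono u) auto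
  finally show ?thesis .
qed

text \<open>\<open>measure_of\<close> takes the intended values only if these are countably
  additive; here they form a finite sum of point masses, treated by induction over the
  multiset.\<close>

lemma emeasure_empirical_spectral_measure:
  fixes A :: "real^'n^'n"
  assumes "S \<in> sets borel"
  shows "emeasure (empirical_spectral_measure A) S = (\<Sum>l\<in>#eigenvalues_mset A. indicator S l) / of_nat CARD('n)"
proof -
  let ?\<mu> = "\<lambda>S. (\<Sum>l\<in>#eigenvalues_mset A. emeasure (return borel l) S) / of_nat CARD('n)"
  have "emeasure (empirical_spectral_measure A) S = ?\<mu> S"
  proof (rule emeasure_measure_of[OF empirical_spectral_measure_def])
    have sets: "sets (empirical_spectral_measure A) = sets borel"
      using sets.sigma_sets_eq[of "borel :: real measure"] by (simp add: empirical_spectral_measure_def)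
    thus "S \<in> sets (empirical_spectral_measure A)" using assms by simp
    show "positive (sets (empirical_spectral_measure A)) ?\<mu>" by (simp add: positive_def)
    show "countably_additive (sets (empirical_spectral_measure A)) ?\<mu>"
      unfolding countably_additive_def sets
    proof (intro allI impI)
      fix F :: "nat \<Rightarrow> real set" assume F: "range F \<subseteq> sets borel" "disjoint_family F"
      have "(\<Sum>n. \<Sum>l\<in>#Z. emeasure (return borel l) (F n)) = (\<Sum>l\<in>#Z. emeasure (return borel l) (\<Union>(range F)))" for Z :: "real multiset"
      proof (induction Z)
        case (add x Z)
        have "(\<Sum>n. emeasure (return borel x) (F n) + (\<Sum>l\<in>#Z. emeasure (return borel l) (F n))) =
          (\<Sum>n. emeasure (return borel x) (F n)) + (\<Sum>n. \<Sum>l\<in>#Z. emeasure (return borel l) (F n))"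
          by (intro suminf_add[symmetric]) auto
        also have "(\<Sum>n. emeasure (return borel x) (F n)) = emeasure (return borel x) (\<Union>(range F))"
          using F by (intro suminf_emeasure) auto
        finally show ?case using add by simp
      qed simp
      thus "(\<Sum>n. ?\<mu> (F n)) = ?\<mu> (\<Union>(range F))" by (simp add: divide_ennreal_def ennreal_suminf_multc)
    qed
  qed auto
  also have "(\<Sum>l\<in>#eigenvalues_mset A. emeasure (return borel l) S) = (\<Sum>l\<in>#eigenvalues_mset A. indicator S l)"
    using assms by (simp add: emeasure_return)
  finally show ?thesis .
qed

text \<open>\<open>measure_of\<close> yields the zero measure when its argument is not countably
  additive. Total mass 1 excludes this, so countable additivity of the averaged spectral measures is
  read off from the hypothesis instead of from measurability.\<close>

lemma emeasure_expected_spectral_distribution: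
  assumes "prob_space (expected_spectral_distribution M H)" "S \<in> sets borel"
  shows "emeasure (expected_spectral_distribution M H) S = (\<integral>\<^sup>+ \<omega>. emeasure (empirical_spectral_measure (H \<omega>)) S \<partial>M)"
proof -
  let ?\<mu> = "\<lambda>S. \<integral>\<^sup>+ \<omega>. emeasure (empirical_spectral_measure (H \<omega>)) S \<partial>M"
  have sig: "sigma_sets UNIV (sets (borel :: real measure)) = sets borel"
    using sets.sigma_sets_eq[of "borel :: real measure"] by simp
  have eq: "emeasure (expected_spectral_distribution M H) S =
      (if S \<in> sets borel \<and> measure_space UNIV (sets borel) ?\<mu> then ?\<mu> S else 0)" for S
    unfolding expected_spectral_distribution_def emeasure_measure_of_conv sig ..
  have "emeasure (expected_spectral_distribution M H) (space (expected_spectral_distribution M H)) = 1"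
    by (rule prob_space.emeasure_space_1[OF assms(1)])
  hence "measure_space UNIV (sets borel) ?\<mu>" unfolding eq by (auto split: if_splits)
  thus ?thesis unfolding eq using assms(2) by simp
qed

text \<open>Here e is an arbitrary labelling of the eigenvalues, with no measurability in omega. For
  a simple function below h the spectral average is a finite sum of lower integrals, and
  superadditivity moves the sum inside.\<close>

lemma nn_integral_expected_spectral_distribution_le:
  fixes H :: "'w \<Rightarrow> real^'n^'n" and e :: "'w \<Rightarrow> 'n \<Rightarrow> real" and h :: "real \<Rightarrow> ennreal"
  assumes prob: "prob_space (expected_spectral_distribution M H)"
    and e: "AE \<omega> in M. eigenvalues_mset (H \<omega>) = image_mset (e \<omega>) (mset_set UNIV)"
  shows "(\<integral>\<^sup>+ l. h l \<partial>expected_spectral_distribution M H) \<le> (\<integral>\<^sup>+ \<omega>. (\<Sum>i\<in>UNIV. h (e \<omega> i)) / of_nat CARD('n) \<partial>M)"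
proof -
  let ?\<nu> = "expected_spectral_distribution M H"
  have sets: "sets ?\<nu> = sets borel"
    using sets.sigma_sets_eq[of "borel :: real measure"] by (simp add: expected_spectral_distribution_def)
  have space: "space ?\<nu> = UNIV" by (simp add: expected_spectral_distribution_def space_measure_of_conv)
  have "integral\<^sup>S ?\<nu> s \<le> (\<integral>\<^sup>+ \<omega>. (\<Sum>i\<in>UNIV. h (e \<omega> i)) / of_nat CARD('n) \<partial>M)" if s: "simple_function ?\<nu> s" "s \<le> h" for s
  proof -
    have fin: "finite (range s)" using s(1) by (simp add: simple_function_def space)
    have m: "s -` {y} \<in> sets borel" for y
    proof (cases "y \<in> range s")
      case True
      thus ?thesis using s(1) by (auto simp: simple_function_def space sets)
    next
      case False
      hence "s -` {y} = {}" by auto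
      thus ?thesis by simp
    qed
    let ?c = "\<lambda>\<omega> y. emeasure (empirical_spectral_measure (H \<omega>)) (s -` {y})"
    have "integral\<^sup>S ?\<nu> s = (\<Sum>y\<in>range s. y * (\<integral>\<^sup>+ \<omega>. ?c \<omega> y \<partial>M))"
      unfolding simple_integral_def space using emeasure_expected_spectral_distribution[OF prob m] by simp
    also have "\<dots> \<le> (\<Sum>y\<in>range s. \<integral>\<^sup>+ \<omega>. y * ?c \<omega> y \<partial>M)" by (intro sum_mono nn_integral_cmult_le)
    also have "\<dots> \<le> (\<integral>\<^sup>+ \<omega>. (\<Sum>y\<in>range s. y * ?c \<omega> y) \<partial>M)" by (rule nn_integral_sum_superadditive[OF fin])
    also have "\<dots> \<le> (\<integral>\<^sup>+ \<omega>. (\<Sum>i\<in>UNIV. h (e \<omega> i)) / of_nat CARD('n) \<partial>M)"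
    proof (rule nn_integral_mono_AE)
      show "AE \<omega> in M. (\<Sum>y\<in>range s. y * ?c \<omega> y) \<le> (\<Sum>i\<in>UNIV. h (e \<omega> i)) / of_nat CARD('n)"
        using e
      proof eventually_elim
        case (elim \<omega>)
        have c: "?c \<omega> y = (\<Sum>i\<in>UNIV. indicator (s -` {y}) (e \<omega> i)) / of_nat CARD('n)" for y
          unfolding emeasure_empirical_spectral_measure[OF m] elim by (simp add: sum_unfold_sum_mset image_mset.compositionality o_def)
        have "(\<Sum>y\<in>range s. y * ?c \<omega> y) = (\<Sum>y\<in>range s. \<Sum>i\<in>UNIV. y * indicator (s -` {y}) (e \<omega> i)) / of_nat CARD('n)"
          unfolding c by (simp only: divide_ennreal_def sum_distrib_left sum_distrib_right mult.assoc)
        also have "(\<Sum>y\<in>range s. \<Sum>i\<in>UNIV. y * indicator (s -` {y}) (e \<omega> i)) = (\<Sum>i\<in>UNIV. \<Sum>y\<in>range s. y * indicator (s -` {y}) (e \<omega> i))"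
          by (rule sum.swap)
        also have "\<dots> = (\<Sum>i\<in>UNIV. s (e \<omega> i))"
        proof (rule sum.cong[OF refl])
          fix i
          have "(\<Sum>y\<in>range s. y * indicator (s -` {y}) (e \<omega> i)) = (\<Sum>y\<in>range s. if y = s (e \<omega> i) then y else 0)"
            by (intro sum.cong) (auto simp: indicator_def)
          thus "(\<Sum>y\<in>range s. y * indicator (s -` {y}) (e \<omega> i)) = s (e \<omega> i)" using fin by simp
        qed
        also have "\<dots> / of_nat CARD('n) \<le> (\<Sum>i\<in>UNIV. h (e \<omega> i)) / of_nat CARD('n)"
          using s(2) by (intro divide_right_mono_ennreal sum_mono) (auto simp: le_fun_def)
        finally show ?case .
      qed
    qed
    finally show ?thesis .
  qed
  thus ?thesis unfolding nn_integral_def[of ?\<nu>] by (intro SUP_least) auto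
qed

text \<open>G is a measurable representative of the sum over the eigenvalues; in the application it
  is a trace. The inequalities for h and for K - h combine to an equality because both measures have
  mass 1 and all integrals are finite.\<close>

lemma expectation_spectral_sum:
  fixes H :: "'w \<Rightarrow> real^'n^'n" and e :: "'w \<Rightarrow> 'n \<Rightarrow> real" and h :: "real \<Rightarrow> real"
  assumes M: "prob_space M"
    and prob: "prob_space (expected_spectral_distribution M H)"
    and e: "AE \<omega> in M. eigenvalues_mset (H \<omega>) = image_mset (e \<omega>) (mset_set UNIV)"
    and X: "X \<in> sets borel" and ae: "AE \<omega> in M. \<forall>i. e \<omega> i \<in> X" and nu: "AE l in expected_spectral_distribution M H. l \<in> X"
    and h: "(\<lambda>l. indicator X l * h l) \<in> borel_measurable borel" "\<And>l. l \<in> X \<Longrightarrow> 0 \<le> h l \<and> h l \<le> K"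
    and G: "G \<in> borel_measurable M" "AE \<omega> in M. G \<omega> = (\<Sum>i\<in>UNIV. h (e \<omega> i))"
  shows "(\<integral>\<omega>. G \<omega> \<partial>M) = CARD('n) * (\<integral>l. indicator X l * h l \<partial>expected_spectral_distribution M H)"
proof -
  let ?\<nu> = "expected_spectral_distribution M H" and ?d = "real CARD('n)"
  interpret M: prob_space M by (rule M)
  interpret N: prob_space ?\<nu> by (rule prob)
  have sets: "sets ?\<nu> = sets borel"
    using sets.sigma_sets_eq[of "borel :: real measure"] by (simp add: expected_spectral_distribution_def)
  \<comment> \<open>Cutting off outside X gives bounds valid for every real number, as the
    inequality below asks for nonnegative functions on the whole line.\<close>
  define h' where "h' = (\<lambda>l. indicator X l * h l)"
  have h'm: "h' \<in> borel_measurable ?\<nu>" using h(1) sets by (simp add: h'_def cong: measurable_cong_sets)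
  have "AE \<omega> in M. X \<noteq> {}" using ae by eventually_elim auto
  hence "X \<noteq> {}" by simp
  hence K: "K \<ge> 0" using h(2) by force
  have h'b: "0 \<le> h' l" "h' l \<le> K" for l using h(2) K by (auto simp: h'_def indicator_def)
  define g where "g = (\<lambda>\<omega>. G \<omega> / ?d)"
  have gm: "g \<in> borel_measurable M" using G(1) by (simp add: g_def)
  have ge: "AE \<omega> in M. g \<omega> = (\<Sum>i\<in>UNIV. h' (e \<omega> i)) / ?d"
    using G(2) ae by eventually_elim (simp add: g_def h'_def)
  have gb: "AE \<omega> in M. 0 \<le> g \<omega> \<and> g \<omega> \<le> K"
    using ge
  proof eventually_elim
    case (elim \<omega>)
    have "(\<Sum>i\<in>(UNIV :: 'n set). h' (e \<omega> i)) \<le> (\<Sum>i\<in>(UNIV :: 'n set). K)" by (intro sum_mono h'b)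
    hence "(\<Sum>i\<in>UNIV. h' (e \<omega> i)) / ?d \<le> K" by (simp add: divide_le_eq mult.commute)
    thus ?case using elim h'b by (auto intro!: divide_nonneg_nonneg sum_nonneg)
  qed
  have ih: "integrable ?\<nu> h'"
    using h'b h'm by (intro N.integrable_const_bound[where B = K]) auto
  have ig: "integrable M g"
    using gb gm by (intro M.integrable_const_bound[where B = K]) auto
  have ineq: "(\<integral>l. f l \<partial>?\<nu>) \<le> (\<integral>\<omega>. F \<omega> \<partial>M)"
    if f: "integrable ?\<nu> f" "\<And>l. 0 \<le> f l" and F: "integrable M F" "AE \<omega> in M. F \<omega> = (\<Sum>i\<in>UNIV. f (e \<omega> i)) / ?d" for f F
  proof -
    have F0: "AE \<omega> in M. 0 \<le> F \<omega>" using F(2) by eventually_elim (auto intro!: divide_nonneg_nonneg sum_nonneg f)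
    have "ennreal (\<integral>l. f l \<partial>?\<nu>) = (\<integral>\<^sup>+l. ennreal (f l) \<partial>?\<nu>)" using f by (intro nn_integral_eq_integral[symmetric]) auto
    also have "\<dots> \<le> (\<integral>\<^sup>+ \<omega>. (\<Sum>i\<in>UNIV. ennreal (f (e \<omega> i))) / of_nat CARD('n) \<partial>M)"
      by (rule nn_integral_expected_spectral_distribution_le[OF prob e])
    also have "\<dots> = (\<integral>\<^sup>+ \<omega>. ennreal (F \<omega>) \<partial>M)"
    proof (rule nn_integral_cong_AE)
      show "AE \<omega> in M. (\<Sum>i\<in>UNIV. ennreal (f (e \<omega> i))) / of_nat CARD('n) = ennreal (F \<omega>)"
        using F(2) by eventually_elim
          (simp add: sum_ennreal f divide_ennreal[symmetric] sum_nonneg ennreal_of_nat_eq_real_of_nat)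
    qed
    also have "\<dots> = ennreal (\<integral>\<omega>. F \<omega> \<partial>M)" using F(1) F0 by (intro nn_integral_eq_integral) auto
    finally show ?thesis
      using F0 by (subst (asm) ennreal_le_iff) (auto intro: integral_nonneg_AE)
  qed
  have "(\<integral>l. h' l \<partial>?\<nu>) \<le> (\<integral>\<omega>. g \<omega> \<partial>M)" by (rule ineq[OF ih h'b(1) ig ge])
  moreover have "(\<integral>l. K - h' l \<partial>?\<nu>) \<le> (\<integral>\<omega>. K - g \<omega> \<partial>M)"
  proof (rule ineq)
    show "AE \<omega> in M. K - g \<omega> = (\<Sum>i\<in>UNIV. K - h' (e \<omega> i)) / ?d"
      using ge by eventually_elim (simp add: sum_subtractf diff_divide_distrib)
  qed (use ih ig h'b in auto)
  ultimately have "(\<integral>\<omega>. g \<omega> \<partial>M) = (\<integral>l. h' l \<partial>?\<nu>)"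
    using ih ig by (simp add: M.prob_space N.prob_space)
  thus ?thesis by (simp add: g_def h'_def field_simps)
qed

text \<open>The fraction f of eigenvalues in X is at most 1, and its lower integral is at least the
  mass 1 of X. A measurable minorant with the same integral must then equal 1 almost surely, and so
  does f, which leaves no eigenvalue outside X.\<close>

lemma AE_eigenvalues_in:
  fixes H :: "'w \<Rightarrow> real^'n^'n" and e :: "'w \<Rightarrow> 'n \<Rightarrow> real"
  assumes M: "prob_space M"
    and prob: "prob_space (expected_spectral_distribution M H)"
    and e: "AE \<omega> in M. eigenvalues_mset (H \<omega>) = image_mset (e \<omega>) (mset_set UNIV)"
    and X: "X \<in> sets borel" "emeasure (expected_spectral_distribution M H) (- X) = 0"
  shows "AE \<omega> in M. \<forall>i. e \<omega> i \<in> X"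
proof -
  let ?\<nu> = "expected_spectral_distribution M H" and ?d = "of_nat CARD('n) :: ennreal"
  interpret M: prob_space M by (rule M)
  interpret N: prob_space ?\<nu> by (rule prob)
  have sets: "sets ?\<nu> = sets borel"
    using sets.sigma_sets_eq[of "borel :: real measure"] by (simp add: expected_spectral_distribution_def)
  have space: "space ?\<nu> = UNIV" by (simp add: expected_spectral_distribution_def space_measure_of_conv)
  have "emeasure ?\<nu> X + emeasure ?\<nu> (- X) = emeasure ?\<nu> (X \<union> - X)"
    using X(1) by (intro plus_emeasure) (auto simp: sets)
  hence X1: "emeasure ?\<nu> X = 1" using X(2) N.emeasure_space_1 by (simp add: space)
  define f where "f = (\<lambda>\<omega>. (\<Sum>i\<in>UNIV. indicator X (e \<omega> i)) / ?d)"
  have dd: "?d / ?d = 1" by (rule ennreal_divide_self) (auto simp: of_nat_less_top)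
  have f1: "f \<omega> \<le> 1" for \<omega>
  proof -
    have "(\<Sum>i\<in>(UNIV :: 'n set). indicator X (e \<omega> i)) \<le> (\<Sum>i\<in>(UNIV :: 'n set). (1 :: ennreal))"
      by (intro sum_mono) (auto simp: indicator_def)
    hence "f \<omega> \<le> ?d / ?d" unfolding f_def by (intro divide_right_mono_ennreal) simp
    thus ?thesis unfolding dd .
  qed
  obtain u where u: "u \<in> borel_measurable M" "\<And>x. u x \<le> f x" "(\<integral>\<^sup>+x. u x \<partial>M) = (\<integral>\<^sup>+x. f x \<partial>M)"
    by (rule nn_integral_measurable_minorant[of M f]) blast
  have "1 = (\<integral>\<^sup>+l. indicator X l \<partial>?\<nu>)" using X X1 by (simp add: sets)
  also have "\<dots> \<le> (\<integral>\<^sup>+x. u x \<partial>M)"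
    unfolding u(3) f_def by (rule nn_integral_expected_spectral_distribution_le[OF prob e])
  finally have u1: "1 \<le> (\<integral>\<^sup>+x. u x \<partial>M)" .
  have ule: "u x \<le> 1" for x using u(2)[of x] f1[of x] by (rule order.trans)
  have "(\<integral>\<^sup>+x. 1 - u x \<partial>M) = (\<integral>\<^sup>+x. 1 \<partial>M) - (\<integral>\<^sup>+x. u x \<partial>M)"
  proof (rule nn_integral_diff)
    have "(\<integral>\<^sup>+x. u x \<partial>M) \<le> (\<integral>\<^sup>+x. 1 \<partial>M)" by (intro nn_integral_mono ule)
    thus "(\<integral>\<^sup>+x. u x \<partial>M) \<noteq> \<infinity>" by (auto simp: M.emeasure_space_1 top_unique)
  qed (use u ule in auto)
  also have "\<dots> = 0" using u1 by (simp add: M.emeasure_space_1 diff_eq_0_ennreal)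
  finally have "AE x in M. 1 - u x = 0" using u(1) by (subst (asm) nn_integral_0_iff_AE) auto
  thus ?thesis
  proof eventually_elim
    case (elim \<omega>)
    hence "1 \<le> u \<omega>" by (simp add: diff_eq_0_iff_ennreal)
    hence f1': "f \<omega> = 1" using u(2)[of \<omega>] f1[of \<omega>] by (intro antisym) auto
    show ?case
    proof (rule ccontr)
      assume "\<not> (\<forall>i. e \<omega> i \<in> X)"
      then obtain j where j: "e \<omega> j \<notin> X" by blast
      have eq: "(\<Sum>i\<in>UNIV. indicator X (e \<omega> i) :: ennreal) = of_nat (card {i. e \<omega> i \<in> X})"
        by (simp add: indicator_def of_nat_eq_iff flip: sum.inter_filter)
      have lt: "card {i. e \<omega> i \<in> X} < CARD('n)" using j by (intro psubset_card_mono) auto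
      have "of_nat (card {i. e \<omega> i \<in> X}) / ?d = (1 :: ennreal)" using f1' unfolding f_def eq .
      hence "of_nat (card {i. e \<omega> i \<in> X}) / ?d * ?d = ?d" by simp
      hence "of_nat (card {i. e \<omega> i \<in> X}) = ?d" by (simp only: ennreal_divide_times dd mult_1_right)
      thus False using lt by simp
    qed
  qed
qed

section \<open>Independence and expected quadratic forms\<close>

lemma (in prob_space) indep_set_mono:
  "indep_set A B \<Longrightarrow> A' \<subseteq> A \<Longrightarrow> B' \<subseteq> B \<Longrightarrow> indep_set A' B'"
  unfolding indep_sets2_eq by blast

text \<open>Events of f(e) are events of e, and likewise for H. Preimages are closed under
  intersection, which lifts independence to the generated sigma-algebras, the form in which
  \<open>indep_var\<close> is stated. Here f and g may have a common target type although e and H do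
  not.\<close>

lemma (in prob_space) indep_var_comp:
  assumes indep: "indep_set {e -` A \<inter> space M | A. A \<in> sets S} {H -` B \<inter> space M | B. B \<in> sets T}"
    and e: "e \<in> measurable M S" and H: "H \<in> measurable M T"
    and f: "f \<in> measurable S S'" and g: "g \<in> measurable T T'"
  shows "indep_var S' (\<lambda>\<omega>. f (e \<omega>)) T' (\<lambda>\<omega>. g (H \<omega>))"
proof -
  let ?A = "{(\<lambda>\<omega>. f (e \<omega>)) -` A \<inter> space M | A. A \<in> sets S'}" and ?B = "{(\<lambda>\<omega>. g (H \<omega>)) -` A \<inter> space M | A. A \<in> sets T'}"
  have A: "?A \<subseteq> {e -` A \<inter> space M | A. A \<in> sets S}"
  proof safe
    fix A assume A: "A \<in> sets S'"
    have "(\<lambda>\<omega>. f (e \<omega>)) -` A \<inter> space M = e -` (f -` A \<inter> space S) \<inter> space M"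
      using measurable_space[OF e] by auto
    thus "\<exists>A'. (\<lambda>\<omega>. f (e \<omega>)) -` A \<inter> space M = e -` A' \<inter> space M \<and> A' \<in> sets S"
      using measurable_sets[OF f A] by blast
  qed
  have B: "?B \<subseteq> {H -` A \<inter> space M | A. A \<in> sets T}"
  proof safe
    fix A assume A: "A \<in> sets T'"
    have "(\<lambda>\<omega>. g (H \<omega>)) -` A \<inter> space M = H -` (g -` A \<inter> space T) \<inter> space M"
      using measurable_space[OF H] by auto
    thus "\<exists>A'. (\<lambda>\<omega>. g (H \<omega>)) -` A \<inter> space M = H -` A' \<inter> space M \<and> A' \<in> sets T"
      using measurable_sets[OF g A] by blast
  qed
  have "indep_set ?A ?B"
    by (rule indep_set_mono[OF indep A B])
  moreover have "Int_stable ?A" unfolding Int_stable_def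
  proof safe
    fix A B assume "A \<in> sets S'" "B \<in> sets S'"
    thus "\<exists>C. (\<lambda>\<omega>. f (e \<omega>)) -` A \<inter> space M \<inter> ((\<lambda>\<omega>. f (e \<omega>)) -` B \<inter> space M) = (\<lambda>\<omega>. f (e \<omega>)) -` C \<inter> space M \<and> C \<in> sets S'"
      by (intro exI[of _ "A \<inter> B"]) auto
  qed
  moreover have "Int_stable ?B" unfolding Int_stable_def
  proof safe
    fix A B assume "A \<in> sets T'" "B \<in> sets T'"
    thus "\<exists>C. (\<lambda>\<omega>. g (H \<omega>)) -` A \<inter> space M \<inter> ((\<lambda>\<omega>. g (H \<omega>)) -` B \<inter> space M) = (\<lambda>\<omega>. g (H \<omega>)) -` C \<inter> space M \<and> C \<in> sets T'"
      by (intro exI[of _ "A \<inter> B"]) auto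
  qed
  ultimately have "indep_set (sigma_sets (space M) ?A) (sigma_sets (space M) ?B)" by (rule indep_set_sigma_sets)
  thus ?thesis unfolding indep_var_eq using e H f g by (auto intro: measurable_compose)
qed

text \<open>Entry by entry, independence factors the expectation of e_i e_j g_ij; the second moments
  form the identity matrix, so the diagonal of g(H) remains. The almost sure bound provides the
  integrability of its entries.\<close>

lemma expectation_quadratic_form:
  fixes H :: "'w \<Rightarrow> real^'n^'n" and x0 xs :: "'w \<Rightarrow> real^'n" and g :: "real^'n^'n \<Rightarrow> real^'n^'n" and K :: real
  assumes rqp: "random_quadratic_problem M H x0 xs"
    and g: "\<And>i j. (\<lambda>A. g A $ i $ j) \<in> borel_measurable borel"
    and bnd: "AE \<omega> in M. \<forall>i j. \<bar>g (H \<omega>) $ i $ j\<bar> \<le> K"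
  shows "(\<integral>\<omega>. (x0 \<omega> - xs \<omega>) \<bullet> (g (H \<omega>) *v (x0 \<omega> - xs \<omega>)) \<partial>M) = (\<integral>\<omega>. trace (g (H \<omega>)) \<partial>M)"
proof -
  interpret prob_space M using rqp by (simp add: random_quadratic_problem_def)
  define e where "e = (\<lambda>\<omega>. x0 \<omega> - xs \<omega>)"
  have H: "H \<in> borel_measurable M" and e: "e \<in> borel_measurable M"
    using rqp by (auto simp: random_quadratic_problem_def e_def)
  have indep: "indep_set {e -` A \<inter> space M | A. A \<in> sets borel} {H -` B \<inter> space M | B. B \<in> sets borel}"
    using rqp by (simp add: random_quadratic_problem_def e_def)
  let ?E = "\<lambda>\<omega>. (\<chi> i j. e \<omega> $ i * e \<omega> $ j) :: real^'n^'n"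
  have cov: "(\<integral>\<omega>. ?E \<omega> \<partial>M) = mat 1" using rqp by (simp add: random_quadratic_problem_def e_def)
  have Eint: "integrable M ?E"
  proof (rule ccontr)
    assume "\<not> integrable M ?E"
    hence "(mat 1 :: real^'n^'n) = 0" using cov by (simp add: not_integrable_integral_eq)
    hence "(mat 1 :: real^'n^'n) $ undefined $ undefined = 0" by simp
    thus False by (simp add: mat_def)
  qed
  have bl: "bounded_linear (\<lambda>A :: real^'n^'n. A $ i $ j)" for i j
    using bounded_linear_compose[OF bounded_linear_vec_nth bounded_linear_vec_nth] .
  have eij: "integrable M (\<lambda>\<omega>. e \<omega> $ i * e \<omega> $ j)" "(\<integral>\<omega>. e \<omega> $ i * e \<omega> $ j \<partial>M) = (if i = j then 1 else 0)" for i j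
  proof -
    show "integrable M (\<lambda>\<omega>. e \<omega> $ i * e \<omega> $ j)"
      using integrable_bounded_linear[OF bl[of i j] Eint] by simp
    have "(\<integral>\<omega>. ?E \<omega> $ i $ j \<partial>M) = (\<integral>\<omega>. ?E \<omega> \<partial>M) $ i $ j"
      by (rule integral_bounded_linear[OF bl Eint])
    thus "(\<integral>\<omega>. e \<omega> $ i * e \<omega> $ j \<partial>M) = (if i = j then 1 else 0)" unfolding cov by (simp add: mat_def)
  qed
  have gH: "(\<lambda>\<omega>. g (H \<omega>) $ i $ j) \<in> borel_measurable M" for i j
    using measurable_compose[OF H g] .
  have gint: "integrable M (\<lambda>\<omega>. g (H \<omega>) $ i $ j)" for i j
  proof (rule integrable_const_bound)
    show "AE \<omega> in M. norm (g (H \<omega>) $ i $ j) \<le> K" using bnd by eventually_elim simp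
  qed (rule gH)
  have ind: "indep_var borel (\<lambda>\<omega>. e \<omega> $ i * e \<omega> $ j) borel (\<lambda>\<omega>. g (H \<omega>) $ i $ j)" for i j
    by (rule indep_var_comp[OF indep e H _ g, where f = "\<lambda>v. v $ i * v $ j"]) measurable
  have pint: "integrable M (\<lambda>\<omega>. e \<omega> $ i * e \<omega> $ j * g (H \<omega>) $ i $ j)" for i j
    by (rule indep_var_integrable[OF ind eij(1) gint])
  have pval: "(\<integral>\<omega>. e \<omega> $ i * e \<omega> $ j * g (H \<omega>) $ i $ j \<partial>M) = (if i = j then (\<integral>\<omega>. g (H \<omega>) $ i $ j \<partial>M) else 0)" for i j
    using indep_var_lebesgue_integral[OF ind eij(1) gint] eij(2) by simp
  have "(\<integral>\<omega>. e \<omega> \<bullet> (g (H \<omega>) *v e \<omega>) \<partial>M) = (\<integral>\<omega>. (\<Sum>i\<in>UNIV. \<Sum>j\<in>UNIV. e \<omega> $ i * e \<omega> $ j * g (H \<omega>) $ i $ j) \<partial>M)"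
    by (simp add: inner_vec_def matrix_vector_mult_def sum_distrib_left mult_ac)
  also have "\<dots> = (\<Sum>i\<in>UNIV. \<Sum>j\<in>UNIV. (\<integral>\<omega>. e \<omega> $ i * e \<omega> $ j * g (H \<omega>) $ i $ j \<partial>M))"
    using pint by simp
  also have "\<dots> = (\<Sum>i\<in>UNIV. (\<integral>\<omega>. g (H \<omega>) $ i $ i \<partial>M))" unfolding pval by simp
  also have "\<dots> = (\<integral>\<omega>. trace (g (H \<omega>)) \<partial>M)" unfolding trace_def using gint by simp
  finally show ?thesis by (simp add: e_def)
qed

text \<open>Assumption \<open>gh\<close> says that g applies h to the eigenvalues of a symmetric
  matrix. The diagonalization is chosen separately at each sample point and enters through almost
  sure statements only; the measurable objects are the entries of g(H) and its trace.\<close>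

lemma expectation_spectral_function:
  fixes H :: "'w \<Rightarrow> real^'n^'n" and x0 xs :: "'w \<Rightarrow> real^'n" and g :: "real^'n^'n \<Rightarrow> real^'n^'n" and h :: "real \<Rightarrow> real"
  assumes rqp: "random_quadratic_problem M H x0 xs"
    and prob: "prob_space (expected_spectral_distribution M H)"
    and L: "emeasure (expected_spectral_distribution M H) (- {0<..L}) = 0"
    and g: "\<And>i j. (\<lambda>A. g A $ i $ j) \<in> borel_measurable borel"
    and gh: "\<And>Q l. orthogonal_matrix Q \<Longrightarrow> g (conj_diag Q l) = conj_diag Q (\<lambda>i. h (l i))"
    and h: "continuous_on UNIV h" "\<And>l. l \<in> {0<..L} \<Longrightarrow> 0 \<le> h l"
  shows "(\<integral>\<omega>. (x0 \<omega> - xs \<omega>) \<bullet> (g (H \<omega>) *v (x0 \<omega> - xs \<omega>)) \<partial>M) =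
    CARD('n) * (\<integral>l. indicator {0<..L} l * h l \<partial>expected_spectral_distribution M H)"
proof -
  let ?\<nu> = "expected_spectral_distribution M H"
  have M: "prob_space M" using rqp by (simp add: random_quadratic_problem_def)
  have sets: "sets ?\<nu> = sets borel"
    using sets.sigma_sets_eq[of "borel :: real measure"] by (simp add: expected_spectral_distribution_def)
  have "\<forall>\<omega>. \<exists>Ql. transpose (H \<omega>) = H \<omega> \<longrightarrow> orthogonal_matrix (fst Ql) \<and> H \<omega> = conj_diag (fst Ql) (snd Ql)"
    using symmetric_matrix_diagonalizable by (metis fst_conv snd_conv)
  then obtain Ql where Ql: "\<And>\<omega>. transpose (H \<omega>) = H \<omega> \<Longrightarrow> orthogonal_matrix (fst (Ql \<omega>)) \<and> H \<omega> = conj_diag (fst (Ql \<omega>)) (snd (Ql \<omega>))"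
    by metis
  define Q where "Q = (\<lambda>\<omega>. fst (Ql \<omega>))"
  define e where "e = (\<lambda>\<omega>. snd (Ql \<omega>))"
  have "AE \<omega> in M. symmetric_pos_def (H \<omega>)" using rqp by (simp add: random_quadratic_problem_def)
  hence diag: "AE \<omega> in M. orthogonal_matrix (Q \<omega>) \<and> H \<omega> = conj_diag (Q \<omega>) (e \<omega>)"
    by eventually_elim (use Ql in \<open>auto simp: symmetric_pos_def_def Q_def e_def\<close>)
  have ev: "AE \<omega> in M. eigenvalues_mset (H \<omega>) = image_mset (e \<omega>) (mset_set UNIV)"
    using diag
  proof eventually_elim
    case (elim \<omega>)
    thus ?case using eigenvalues_mset_conj_diag[of "Q \<omega>" "e \<omega>"] by simp
  qed
  have mem: "AE \<omega> in M. \<forall>i. e \<omega> i \<in> {0<..L}" by (rule AE_eigenvalues_in[OF M prob ev _ L]) simp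
  have "compact (h ` {0..L})" by (intro compact_continuous_image continuous_on_subset[OF h(1)]) auto
  then obtain K where K0: "\<forall>y \<in> h ` {0..L}. norm y \<le> K" using compact_imp_bounded bounded_iff by blast
  have K: "\<bar>h l\<bar> \<le> K" if "l \<in> {0<..L}" for l using K0 that by auto
  have "(\<integral>\<omega>. (x0 \<omega> - xs \<omega>) \<bullet> (g (H \<omega>) *v (x0 \<omega> - xs \<omega>)) \<partial>M) = (\<integral>\<omega>. trace (g (H \<omega>)) \<partial>M)"
  proof (rule expectation_quadratic_form[OF rqp g])
    show "AE \<omega> in M. \<forall>i j. \<bar>g (H \<omega>) $ i $ j\<bar> \<le> real CARD('n) * K"
      using diag mem
    proof eventually_elim
      case (elim \<omega>)
      have "\<bar>conj_diag (Q \<omega>) (\<lambda>k. h (e \<omega> k)) $ i $ j\<bar> \<le> real CARD('n) * K" for i j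
        using elim K by (intro abs_conj_diag_nth_le) auto
      thus ?case using elim gh[of "Q \<omega>" "e \<omega>"] by simp
    qed
  qed
  also have "\<dots> = CARD('n) * (\<integral>l. indicator {0<..L} l * h l \<partial>?\<nu>)"
  proof (rule expectation_spectral_sum[OF M prob ev _ mem])
    have H: "H \<in> borel_measurable M" using rqp by (simp add: random_quadratic_problem_def)
    show "(\<lambda>\<omega>. trace (g (H \<omega>))) \<in> borel_measurable M"
      unfolding trace_def by (intro borel_measurable_sum measurable_compose[OF H g])
    show "AE \<omega> in M. trace (g (H \<omega>)) = (\<Sum>i\<in>UNIV. h (e \<omega> i))"
      using diag by eventually_elim (metis gh trace_conj_diag)
    show "(\<lambda>l. indicator {0<..L} l * h l) \<in> borel_measurable borel"
      by (intro borel_measurable_times borel_measurable_indicator borel_measurable_continuous_onI h) simp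
    show "0 \<le> h l \<and> h l \<le> K" if "l \<in> {0<..L}" for l using h(2)[OF that] K[OF that] by auto
    show "AE l in ?\<nu>. l \<in> {0<..L}"
      by (rule AE_I[OF _ L]) (auto simp: sets)
  qed simp
  finally show ?thesis .
qed

section \<open>Average-case rates\<close>

text \<open>The factor l^k moves into the density and raises the edge exponent from xi to xi + k.
  The limit c of the density ratio is positive because the lower half of the Theta bound keeps the
  ratio away from 0.\<close>

lemma edge_distribution_moment_rate:
  assumes L: "L > 0" and \<xi>: "\<xi> > -1" and edge: "edge_distribution L \<tau> \<xi> \<nu>"
  obtains K where "K > 0"
    "(\<lambda>t. (\<integral>l. indicator {0<..L} l * (l ^ k * nesterov_residual (l / L) t ^ 2) \<partial>\<nu>) / nesterov_rate (\<xi> + real k) t) \<longlonglongrightarrow> K"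
proof -
  from edge[unfolded edge_distribution_def, THEN conjunct2, THEN conjunct2]
  obtain p where p': "p \<in> borel_measurable borel \<and> (\<forall>l. 0 \<le> p l) \<and>
      \<nu> = density lborel (\<lambda>l. ennreal (p l)) \<and> (\<forall>l\<in>{0<..<L}. 0 < p l) \<and>
      p \<in> \<Theta>[at_right 0](\<lambda>l. l powr \<xi>) \<and> (\<exists>c. ((\<lambda>l. p l / l powr \<xi>) \<longlongrightarrow> c) (at_right 0)) \<and>
      p \<in> \<Theta>[at_left L](\<lambda>l. (L - l) powr \<tau>)" ..
  have p: "p \<in> borel_measurable borel" "\<And>l. 0 \<le> p l" "\<nu> = density lborel (\<lambda>l. ennreal (p l))"
    "p \<in> \<Theta>[at_right 0](\<lambda>l. l powr \<xi>)"
    using p' by blast+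
  obtain c where c: "((\<lambda>l. p l / l powr \<xi>) \<longlongrightarrow> c) (at_right 0)" using p' by blast
  interpret prob_space \<nu> using edge by (simp add: edge_distribution_def)
  have c0: "c > 0"
  proof -
    have "p \<in> \<Omega>[at_right 0](\<lambda>l. l powr \<xi>)" using p(4) by (rule bigthetaD2)
    then obtain a where a: "a > 0" "\<forall>\<^sub>F l in at_right 0. norm (p l) \<ge> a * norm (l powr \<xi>)"
      by (auto elim: landau_omega.bigE)
    have "\<forall>\<^sub>F l in at_right 0. a \<le> p l / l powr \<xi>"
      using a(2) eventually_at_rightI[of 0 1 "\<lambda>l::real. l > 0", simplified]
    proof eventually_elim
      case (elim l)
      thus ?case using p(2)[of l] by (simp add: le_divide_eq)
    qed
    hence "a \<le> c" by (rule tendsto_lowerbound[OF c]) simp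
    thus ?thesis using a(1) by linarith
  qed
  define q where "q = (\<lambda>l. l ^ k * p l)"
  have pint: "integrable lborel p"
  proof (rule integrableI_nonneg)
    have "(\<integral>\<^sup>+ l. ennreal (p l) \<partial>lborel) = emeasure \<nu> (space \<nu>)"
      using p(1) unfolding p(3) by (subst emeasure_density) auto
    thus "(\<integral>\<^sup>+ l. ennreal (p l) \<partial>lborel) < \<infinity>" by (simp add: emeasure_space_1)
  qed (use p in auto)
  have qint: "integrable lborel (\<lambda>l. indicator {0..L} l * q l)"
  proof (rule Bochner_Integration.integrable_bound)
    show "integrable lborel (\<lambda>l. L ^ k * p l)" using pint by simp
    show "(\<lambda>l. indicator {0..L} l * q l) \<in> borel_measurable lborel" using p(1) by (simp add: q_def)
    show "AE l in lborel. norm (indicator {0..L} l * q l) \<le> norm (L ^ k * p l)"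
      using p(2) L by (intro AE_I2) (auto simp: q_def indicator_def abs_mult intro!: mult_right_mono power_mono)
  qed
  have qlim: "((\<lambda>l. q l / l powr (\<xi> + real k)) \<longlongrightarrow> c) (at_right 0)"
  proof (rule Lim_transform_eventually[OF c])
    show "\<forall>\<^sub>F l in at_right 0. p l / l powr \<xi> = q l / l powr (\<xi> + real k)"
      by (rule eventually_at_rightI[of 0 1]) (auto simp: q_def powr_add powr_realpow)
  qed
  obtain K where K: "K > 0"
    "(\<lambda>t. (\<integral>l. indicator {0..L} l * q l * nesterov_residual (l / L) t ^ 2 \<partial>lborel) / nesterov_rate (\<xi> + real k) t) \<longlonglongrightarrow> K"
    by (rule nesterov_moment_density[OF L _ qint qlim c0]) (use \<xi> in auto)
  have "(\<integral>l. indicator {0<..L} l * (l ^ k * nesterov_residual (l / L) t ^ 2) \<partial>\<nu>) =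
      (\<integral>l. indicator {0..L} l * q l * nesterov_residual (l / L) t ^ 2 \<partial>lborel)" for t
  proof -
    have "(\<lambda>l. nesterov_residual (l / L) t) \<in> borel_measurable borel"
      by (intro borel_measurable_continuous_onI continuous_intros) (use L in auto)
    hence m: "(\<lambda>l. indicator {0<..L} l * (l ^ k * nesterov_residual (l / L) t ^ 2)) \<in> borel_measurable borel" by simp
    have "(\<integral>l. indicator {0<..L} l * (l ^ k * nesterov_residual (l / L) t ^ 2) \<partial>\<nu>) =
       (\<integral>l. p l * (indicator {0<..L} l * (l ^ k * nesterov_residual (l / L) t ^ 2)) \<partial>lborel)"
      unfolding p(3) using m p(1,2) by (subst integral_density) auto
    also have "\<dots> = (\<integral>l. indicator {0..L} l * q l * nesterov_residual (l / L) t ^ 2 \<partial>lborel)"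
    proof (rule integral_cong_AE)
      show "AE l in lborel. p l * (indicator {0<..L} l * (l ^ k * nesterov_residual (l / L) t ^ 2)) =
          indicator {0..L} l * q l * nesterov_residual (l / L) t ^ 2"
        using AE_lborel_singleton[of 0] by eventually_elim (auto simp: q_def indicator_def)
      show "(\<lambda>l. p l * (indicator {0<..L} l * (l ^ k * nesterov_residual (l / L) t ^ 2))) \<in> borel_measurable lborel"
        using m p(1) by simp
      show "(\<lambda>l. indicator {0..L} l * q l * nesterov_residual (l / L) t ^ 2) \<in> borel_measurable lborel"
        using \<open>(\<lambda>l. nesterov_residual (l / L) t) \<in> borel_measurable borel\<close> p(1) by (simp add: q_def)
    qed
    finally show ?thesis .
  qed
  thus ?thesis using K that by simp
qed

section \<open>Objective and gradient as quadratic forms\<close>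

lemma borel_measurable_residual_matrix_nth:
  fixes B :: "'a \<Rightarrow> real^'n^'n"
  assumes B: "\<And>i j. (\<lambda>\<omega>. B \<omega> $ i $ j) \<in> borel_measurable N"
  shows "(\<lambda>\<omega>. residual_matrix (B \<omega>) t $ i $ j) \<in> borel_measurable N"
proof (induction t arbitrary: i j rule: induct_nat_012)
  case 0
  show ?case by simp
next
  case 1
  show ?case using B by simp
next
  case (ge2 t)
  have A: "(\<lambda>\<omega>. (mat 1 - B \<omega>) $ i $ k) \<in> borel_measurable N" for i k
    using B by simp
  have "(\<lambda>\<omega>. \<Sum>k\<in>UNIV. (mat 1 - B \<omega>) $ i $ k * (residual_matrix (B \<omega>) (Suc t) $ k $ j +
     (real t / (real t + 3)) * (residual_matrix (B \<omega>) (Suc t) $ k $ j - residual_matrix (B \<omega>) t $ k $ j))) \<in> borel_measurable N"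
    by (intro borel_measurable_sum borel_measurable_times borel_measurable_add borel_measurable_diff borel_measurable_const A ge2.IH)
  thus ?case by (simp add: matrix_matrix_mult_def)
qed

definition scaled_residual :: "real \<Rightarrow> nat \<Rightarrow> real^'n^'n \<Rightarrow> real^'n^'n" where
  "scaled_residual L t A = residual_matrix ((1 / L) *\<^sub>R sym_part A) t"

text \<open>The middle factor is A itself since \<open>quadratic_objective\<close> contains H
  unsymmetrized, whereas the iterates see the symmetric part through the gradient. On symmetric
  matrices the two agree.\<close>

definition objective_matrix :: "real \<Rightarrow> nat \<Rightarrow> real^'n^'n \<Rightarrow> real^'n^'n" where
  "objective_matrix L t A = transpose (scaled_residual L t A) ** (A ** scaled_residual L t A)"

definition gradient_matrix :: "real \<Rightarrow> nat \<Rightarrow> real^'n^'n \<Rightarrow> real^'n^'n" where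
  "gradient_matrix L t A = transpose (sym_part A ** scaled_residual L t A) ** (sym_part A ** scaled_residual L t A)"

lemma borel_measurable_objective_matrix: "(\<lambda>A :: real^'n^'n. objective_matrix L t A $ i $ j) \<in> borel_measurable borel"
  and borel_measurable_gradient_matrix: "(\<lambda>A :: real^'n^'n. gradient_matrix L t A $ i $ j) \<in> borel_measurable borel"
proof -
  have A: "(\<lambda>A :: real^'n^'n. A $ i $ k) \<in> borel_measurable borel" for i k :: 'n
    by (intro borel_measurable_continuous_onI continuous_intros)
  have S: "(\<lambda>A :: real^'n^'n. sym_part A $ i $ k) \<in> borel_measurable borel" for i k :: 'n
    using A by (simp add: sym_part_def transpose_def)
  have R: "(\<lambda>A :: real^'n^'n. scaled_residual L t A $ i $ k) \<in> borel_measurable borel" for i k :: 'n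
    unfolding scaled_residual_def by (rule borel_measurable_residual_matrix_nth) (use S in simp)
  show "(\<lambda>A :: real^'n^'n. objective_matrix L t A $ i $ j) \<in> borel_measurable borel"
    unfolding objective_matrix_def matrix_matrix_mult_def transpose_def
    by (simp, intro borel_measurable_sum borel_measurable_times A R)
  show "(\<lambda>A :: real^'n^'n. gradient_matrix L t A $ i $ j) \<in> borel_measurable borel"
    unfolding gradient_matrix_def matrix_matrix_mult_def transpose_def
    by (simp, intro borel_measurable_sum borel_measurable_times S R)
qed

lemma sym_part_conj_diag: "sym_part (conj_diag Q l) = conj_diag Q l"
  unfolding sym_part_def transpose_conj_diag conj_diag_add conj_diag_scaleR by simp

lemma scaled_residual_conj_diag:
  assumes "orthogonal_matrix Q"
  shows "scaled_residual L t (conj_diag Q l) = conj_diag Q (\<lambda>i. nesterov_residual (l i / L) t)"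
  unfolding scaled_residual_def sym_part_conj_diag conj_diag_scaleR residual_matrix_conj_diag[OF assms] by simp

text \<open>The exponent 1 is written out so that objective and gradient are the cases k = 1 and k =
  2 of one family l^k.\<close>

lemma objective_matrix_conj_diag:
  assumes "orthogonal_matrix Q"
  shows "objective_matrix L t (conj_diag Q l) = conj_diag Q (\<lambda>i. l i ^ 1 * nesterov_residual (l i / L) t ^ 2)"
  unfolding objective_matrix_def scaled_residual_conj_diag[OF assms] transpose_conj_diag conj_diag_mult[OF assms]
  by (simp add: power2_eq_square mult_ac)

lemma gradient_matrix_conj_diag:
  assumes "orthogonal_matrix Q"
  shows "gradient_matrix L t (conj_diag Q l) = conj_diag Q (\<lambda>i. l i ^ 2 * nesterov_residual (l i / L) t ^ 2)"
  unfolding gradient_matrix_def scaled_residual_conj_diag[OF assms] sym_part_conj_diag conj_diag_mult[OF assms] transpose_conj_diag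
  by (simp add: power2_eq_square mult_ac)

lemma nesterov_objective_quadratic_form:
  fixes H :: "real^'n^'n" and xs :: "real^'n"
  defines "f \<equiv> quadratic_objective H xs"
  shows "f (nesterov_x L f z t) - f xs = 1/2 * ((z - xs) \<bullet> (objective_matrix L t H *v (z - xs)))"
proof -
  define y where "y = nesterov_x L f z t"
  have y: "y - xs = scaled_residual L t H *v (z - xs)"
    unfolding y_def f_def scaled_residual_def by (rule nesterov_x_quadratic)
  have "f y - f xs = 1/2 * ((y - xs) \<bullet> (H *v (y - xs)))" by (simp add: f_def quadratic_objective_def)
  also have "\<dots> = 1/2 * ((z - xs) \<bullet> (objective_matrix L t H *v (z - xs)))"
    unfolding y inner_matrix_mult_transpose objective_matrix_def by (simp only: matrix_vector_mul_assoc)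
  finally show ?thesis unfolding y_def .
qed

lemma nesterov_gradient_quadratic_form:
  fixes H :: "real^'n^'n" and xs :: "real^'n"
  defines "f \<equiv> quadratic_objective H xs"
  shows "norm (gradient f (nesterov_x L f z t)) ^ 2 = (z - xs) \<bullet> (gradient_matrix L t H *v (z - xs))"
proof -
  have "gradient f (nesterov_x L f z t) = sym_part H ** scaled_residual L t H *v (z - xs)"
    unfolding f_def gradient_quadratic_objective nesterov_x_quadratic scaled_residual_def by (simp only: matrix_vector_mul_assoc)
  thus ?thesis
    unfolding power2_norm_eq_inner by (simp only: inner_matrix_mult_transpose gradient_matrix_def matrix_vector_mul_assoc)
qed

theorem theorem4p4:
  fixes L \<tau> \<xi> :: real and \<nu> :: "real measure"
  assumes "L > 0" and "\<tau> > -1" and "\<xi> > -1"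
    and "edge_distribution L \<tau> \<xi> \<nu>"
  shows "\<exists>C1 C2 :: real. C1 > 0 \<and> C2 > 0 \<and>
    (\<forall>(M :: 'w measure) (H :: 'w \<Rightarrow> real ^ 'n ^ 'n) x0 xs.
       random_quadratic_problem M H x0 xs \<and> expected_spectral_distribution M H = \<nu> \<longrightarrow>
       (let f = (\<lambda>\<omega>. quadratic_objective (H \<omega>) (xs \<omega>));
            x = (\<lambda>t \<omega>. nesterov_x L (f \<omega>) (x0 \<omega>) t)
        in
          (\<lambda>t. \<integral>\<omega>. (f \<omega> (x t \<omega>) - f \<omega> (xs \<omega>)) \<partial>M) \<sim>[sequentially]
            (\<lambda>t. C1 * (if \<xi> < -1/2 then real t powr (-2 * (\<xi> + 2))
                        else if \<xi> = -1/2 then real t powr (-3) * ln (real t)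
                        else real t powr (- (\<xi> + 7/2)))) \<and>
          (\<lambda>t. \<integral>\<omega>. (norm (gradient (f \<omega>) (x t \<omega>)))\<^sup>2 \<partial>M) \<sim>[sequentially]
            (\<lambda>t. C2 * real t powr (- (\<xi> + 9/2)))))"
proof -
  let ?S = "\<lambda>k t. \<integral>l. indicator {0<..L} l * (l ^ k * nesterov_residual (l / L) t ^ 2) \<partial>\<nu>"
  obtain K1 where K1: "K1 > 0" "(\<lambda>t. ?S 1 t / nesterov_rate (\<xi> + real 1) t) \<longlonglongrightarrow> K1"
    by (rule edge_distribution_moment_rate[OF assms(1,3,4), of 1]) blast
  obtain K2 where K2: "K2 > 0" "(\<lambda>t. ?S 2 t / nesterov_rate (\<xi> + real 2) t) \<longlonglongrightarrow> K2"
    by (rule edge_distribution_moment_rate[OF assms(1,3,4), of 2]) blast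
  have rate1: "nesterov_rate (\<xi> + real 1) t = (if \<xi> < -1/2 then real t powr (-2 * (\<xi> + 2))
      else if \<xi> = -1/2 then real t powr (-3) * ln (real t) else real t powr (- (\<xi> + 7/2)))" for t
  proof -
    have "\<xi> + real 1 < 1/2 \<longleftrightarrow> \<xi> < -1/2" "\<xi> + real 1 = 1/2 \<longleftrightarrow> \<xi> = -1/2"
      "\<xi> + real 1 + 1 = \<xi> + 2" "\<xi> + real 1 + 5/2 = \<xi> + 7/2" by auto
    thus ?thesis unfolding nesterov_rate_def by (simp only:)
  qed
  have rate2: "nesterov_rate (\<xi> + real 2) t = real t powr (- (\<xi> + 9/2))" for t
  proof -
    have "\<not> \<xi> + real 2 < 1/2" "\<xi> + real 2 \<noteq> 1/2" "\<xi> + real 2 + 5/2 = \<xi> + 9/2" using assms(3) by auto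
    thus ?thesis unfolding nesterov_rate_def by (simp only: if_False)
  qed
  have asymp: "(\<lambda>t. a * S t) \<sim>[sequentially] (\<lambda>t. (a * K) * r t)"
    if lim: "(\<lambda>t. S t / r t) \<longlonglongrightarrow> K" and pos: "K > 0" "a > 0" for S r :: "nat \<Rightarrow> real" and a K
  proof (rule asymp_equivI')
    have *: "(\<lambda>t. S t / r t / K) \<longlonglongrightarrow> K / K" using pos by (intro tendsto_divide lim tendsto_const) auto
    have eq: "a * S t / (a * K * r t) = S t / r t / K" for t using pos by simp
    show "(\<lambda>t. a * S t / (a * K * r t)) \<longlonglongrightarrow> 1" unfolding eq using * pos by simp
  qed
  let ?d = "real CARD('n)"
  show ?thesis
  \<comment> \<open>The factor d undoes the normalization 1/d of the spectral distribution, and 1/2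
    is that of the objective. K1 and K2 come from nu alone, so both constants are fixed before the
    random problem is.\<close>
  proof (rule exI[of _ "?d / 2 * K1"], rule exI[of _ "?d * K2"], intro conjI allI impI, goal_cases)
    case 1
    show ?case using K1 by simp
  next
    case 2
    show ?case using K2 by simp
  next
    case (3 M H x0 xs)
    hence rqp: "random_quadratic_problem M H x0 xs" and nu: "expected_spectral_distribution M H = \<nu>" by auto
    have prob: "prob_space (expected_spectral_distribution M H)"
      and null: "emeasure (expected_spectral_distribution M H) (- {0<..L}) = 0"
      using assms(4) unfolding nu by (auto simp: edge_distribution_def)
    have cont: "continuous_on UNIV (\<lambda>l. l ^ k * nesterov_residual (l / L) t ^ 2)" for k t
      using assms(1) by (intro continuous_intros) auto
    have obj: "(\<integral>\<omega>. (quadratic_objective (H \<omega>) (xs \<omega>) (nesterov_x L (quadratic_objective (H \<omega>) (xs \<omega>)) (x0 \<omega>) t)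
        - quadratic_objective (H \<omega>) (xs \<omega>) (xs \<omega>)) \<partial>M) = ?d / 2 * ?S 1 t" for t
    proof -
      have "(\<integral>\<omega>. (x0 \<omega> - xs \<omega>) \<bullet> (objective_matrix L t (H \<omega>) *v (x0 \<omega> - xs \<omega>)) \<partial>M) = ?d * ?S 1 t"
        unfolding nu[symmetric]
        by (rule expectation_spectral_function[OF rqp prob null borel_measurable_objective_matrix objective_matrix_conj_diag cont]) auto
      thus ?thesis unfolding nesterov_objective_quadratic_form by simp
    qed
    have grad: "(\<integral>\<omega>. (norm (gradient (quadratic_objective (H \<omega>) (xs \<omega>))
        (nesterov_x L (quadratic_objective (H \<omega>) (xs \<omega>)) (x0 \<omega>) t)))\<^sup>2 \<partial>M) = ?d * ?S 2 t" for t
      unfolding nesterov_gradient_quadratic_form nu[symmetric]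
      by (rule expectation_spectral_function[OF rqp prob null borel_measurable_gradient_matrix gradient_matrix_conj_diag cont]) auto
    show ?case
      unfolding Let_def obj grad rate1[symmetric] rate2[symmetric]
      using K1 K2 by (intro conjI asymp) auto
  qed
qed

end
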